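(* Let $X$ be a random walk on $\mathbb{R}$ with $X_0=0$, let $q\in(0,1)$, $a_1\le a_2$, $x_1\le x_2\le a_2$, and let the following conditions hold: (i) there exist $\mu_-<0<\mu_+$ such that for all $\gamma\in[\mu_-,\mu_+]$, $\mathbb{E}[e^{-\gamma Y}]<\infty$ and $1-q\Phi(i\gamma)>0$; (ii) there exists $\delta>0$ such that $\Phi(\xi)=O(|\xi|^{-\delta})$ as $\xi\to\infty$ in the strip $S_{[\mu_-,\mu_+]}=\{\xi\in\mathbb{C}:\mathrm{Im}\,\xi\in[\mu_-,\mu_+]\}$. Then, for any $\mu_-<\omega_-<0<\omega_1<\mu_+$ and $\omega\in(0,\mu_+)$, $$\begin{aligned}\tilde V(f;q,x_1,x_2)={}&\mathbf{1}_{(-\infty,a_1]}(x_1)+\frac1{2\pi}\int_{\mathrm{Im}\,\xi_1=\omega}\frac{e^{i(x_1-a_1)\xi_1}q\Phi(\xi_1)}{-i\xi_1(1-q\Phi(\xi_1))}\,d\xi_1\\&+\frac1{(2\pi)^2(1-q)}\int_{\mathrm{Im}\,\eta=\omega_-}d\eta\,e^{i(x_1-a_2)\eta}\phi^{++}_q(\eta)\int_{\mathrm{Im}\,\xi_1=\omega_1}d\xi_1\,\frac{e^{i\xi_1(a_2-a_1)}\phi^{--}_q(\xi_1)}{\xi_1(\xi_1-\eta)}.\end{aligned}$$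
   Context: Let $Y,Y_1,Y_2,\dots$ be i.i.d. real-valued random variables on a probability space with measure $\mathbb{Q}$ and expectation $\mathbb{E}$; $\Phi(\xi)=\mathbb{E}[e^{i\xi Y}]$ (for complex $\xi$ where it converges). $X_0=0$, $X_n=Y_1+\dots+Y_n$, $\bar X_n=\max_{0\le m\le n}X_m$, $\underline X_n=\min_{0\le m\le n}X_m$. For $a_1\le a_2$ and $x_1\le x_2$, $f(x_1,x_2)=\mathbf{1}_{(-\infty,\min\{a_1,x_2\}]}(x_1)\mathbf{1}_{(-\infty,a_2]}(x_2)$, and $$V(f;n,x_1,x_2)=\mathbb{E}[f(x_1+X_n,\max\{x_2,x_1+\bar X_n\})]=\mathbb{Q}[x_1+X_n\le a_1,\ \max\{x_2,x_1+\bar X_n\}\le a_2],$$ $$\tilde V(f;q,x_1,x_2)=\sum_{n=0}^\infty q^nV(f;n,x_1,x_2).$$ $T_q$ is a random variable independent of $X$ with $\mathbb{Q}[T_q=n]=(1-q)q^n$, $n=0,1,\dots$. Wiener–Hopf factors: $\phi^+_q(\xi)=\mathbb{E}[e^{i\xi\bar X_{T_q}}]$, analytic in $\{\mathrm{Im}\,\xi>\mu_-\}$ under (i), and $\phi^-_q(\xi)=\mathbb{E}[e^{i\xi\underline X_{T_q}}]$, analytic in $\{\mathrm{Im}\,\xi<\mu_+\}$. Define $$c^+_q=\exp\Big[\frac1{2\pi i}\int_{\mathrm{Im}\,\eta=\alpha}\frac{\ln(1-q\Phi(\eta))}{\eta}d\eta\Big],\ \alpha\in(\mu_-,0);\qquad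 c^-_q=\exp\Big[-\frac1{2\pi i}\int_{\mathrm{Im}\,\eta=\beta}\frac{\ln(1-q\Phi(\eta))}{\eta}d\eta\Big],\ \beta\in(0,\mu_+),$$ which are the limits of $\phi^\pm_q(\xi)$ as $\xi\to\infty$ in strips $S_{[\mu_-+\epsilon,\mu_+-\epsilon]}$, $\epsilon>0$, and set $\phi^{++}_q=\phi^+_q-c^+_q$, $\phi^{--}_q=\phi^-_q-c^-_q$. *)

theory Defs
  imports "HOL-Probability.Probability" "HOL-Library.Landau_Symbols"
begin

text \<open>
  The i.i.d. family \<open>Y, Y\<^sub>1, Y\<^sub>2, \<dots>\<close> is a single sequence \<open>Y :: nat \<Rightarrow> 'a \<Rightarrow> real\<close> on the
  probability space \<open>M\<close>, where \<open>Y 0\<close> is the generic copy that enters \<open>\<Phi>\<close> and \<open>Y 1, Y 2, \<dots>\<close> are the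
  increments of the walk.
\<close>

definition walk :: "(nat \<Rightarrow> 'a \<Rightarrow> real) \<Rightarrow> nat \<Rightarrow> 'a \<Rightarrow> real" where
  "walk Y n w = (\<Sum>k=1..n. Y k w)"

definition walk_max :: "(nat \<Rightarrow> 'a \<Rightarrow> real) \<Rightarrow> nat \<Rightarrow> 'a \<Rightarrow> real" where
  "walk_max Y n w = Max ((\<lambda>m. walk Y m w) ` {0..n})"

definition walk_min :: "(nat \<Rightarrow> 'a \<Rightarrow> real) \<Rightarrow> nat \<Rightarrow> 'a \<Rightarrow> real" where
  "walk_min Y n w = Min ((\<lambda>m. walk Y m w) ` {0..n})"

text \<open>
  The Bochner integral below is \<open>0\<close> by convention where the expectation does not converge
  absolutely. On the imaginary axis the value \<open>\<Phi>(\<i> \<gamma>) = E[exp (- \<gamma> Y)]\<close> is real, so a condition such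
  as \<open>1 - q \<Phi>(\<i> \<gamma>) > 0\<close> is one on the real part.
\<close>

definition Phi :: "'a measure \<Rightarrow> (nat \<Rightarrow> 'a \<Rightarrow> real) \<Rightarrow> complex \<Rightarrow> complex" where
  "Phi M Y \<xi> = (LINT w|M. exp (\<i> * \<xi> * complex_of_real (Y 0 w)))"

definition payoff :: "real \<Rightarrow> real \<Rightarrow> real \<Rightarrow> real \<Rightarrow> real" where
  "payoff a1 a2 x1 x2 = indicator {..min a1 x2} x1 * indicator {..a2} x2"

definition V :: "'a measure \<Rightarrow> (nat \<Rightarrow> 'a \<Rightarrow> real) \<Rightarrow> (real \<Rightarrow> real \<Rightarrow> real)
    \<Rightarrow> nat \<Rightarrow> real \<Rightarrow> real \<Rightarrow> real" where
  "V M Y f n x1 x2 = (LINT w|M. f (x1 + walk Y n w) (max x2 (x1 + walk_max Y n w)))"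

definition V_gen :: "'a measure \<Rightarrow> (nat \<Rightarrow> 'a \<Rightarrow> real) \<Rightarrow> (real \<Rightarrow> real \<Rightarrow> real)
    \<Rightarrow> real \<Rightarrow> real \<Rightarrow> real \<Rightarrow> real" where
  "V_gen M Y f q x1 x2 = (\<Sum>n. q ^ n * V M Y f n x1 x2)"

text \<open>
  \<open>T\<close> is independent of the whole path of the walk (the independence of the generated sigma-algebras
  is spelled out because \<^const>\<open>prob_space.indep_var\<close> requires both variables to have
  the same value type) and has the geometric law started at \<open>0\<close>.
\<close>

definition indep_geometric_time ::
    "'a measure \<Rightarrow> (nat \<Rightarrow> 'a \<Rightarrow> real) \<Rightarrow> real \<Rightarrow> ('a \<Rightarrow> nat) \<Rightarrow> bool" where
  "indep_geometric_time M Y q T \<longleftrightarrow>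
     T \<in> measurable M (count_space UNIV) \<and>
     (\<forall>n. measure M {w \<in> space M. T w = n} = (1 - q) * q ^ n) \<and>
     prob_space.indep_set M
       {T -` A \<inter> space M | A. A \<in> sets (count_space UNIV)}
       {(\<lambda>w n. walk Y n w) -` B \<inter> space M | B. B \<in> sets (Pi\<^sub>M UNIV (\<lambda>_. borel))}"

definition phi_plus ::
    "'a measure \<Rightarrow> (nat \<Rightarrow> 'a \<Rightarrow> real) \<Rightarrow> ('a \<Rightarrow> nat) \<Rightarrow> complex \<Rightarrow> complex" where
  "phi_plus M Y T \<xi> = (LINT w|M. exp (\<i> * \<xi> * complex_of_real (walk_max Y (T w) w)))"

definition phi_minus ::
    "'a measure \<Rightarrow> (nat \<Rightarrow> 'a \<Rightarrow> real) \<Rightarrow> ('a \<Rightarrow> nat) \<Rightarrow> complex \<Rightarrow> complex" where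
  "phi_minus M Y T \<xi> = (LINT w|M. exp (\<i> * \<xi> * complex_of_real (walk_min Y (T w) w)))"

text \<open>
  Integrals over the line \<open>Im \<xi> = \<omega>\<close>, traversed from left to right, as Lebesgue integrals in the
  real part; \<^term>\<open>line_integral \<omega> g\<close> is only meaningful when \<^term>\<open>line_integrable \<omega> g\<close>.
\<close>

definition line_integrable :: "real \<Rightarrow> (complex \<Rightarrow> complex) \<Rightarrow> bool" where
  "line_integrable \<omega> g \<longleftrightarrow> integrable lborel (\<lambda>t. g (Complex t \<omega>))"

definition line_integral :: "real \<Rightarrow> (complex \<Rightarrow> complex) \<Rightarrow> complex" where
  "line_integral \<omega> g = (LINT t|lborel. g (Complex t \<omega>))"

text \<open>
  \<open>c\<^sup>+\<close> and \<open>c\<^sup>-\<close> depend formally on the line of integration, at height \<open>\<alpha> < 0\<close> and \<open>\<beta> > 0\<close>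
  respectively. The principal logarithm is the intended branch: on these lines
  \<open>\<bar>q \<Phi>(\<eta>)\<bar> \<le> q \<Phi>(\<i> Im \<eta>) < 1\<close>.
\<close>

definition c_plus :: "'a measure \<Rightarrow> (nat \<Rightarrow> 'a \<Rightarrow> real) \<Rightarrow> real \<Rightarrow> real \<Rightarrow> complex" where
  "c_plus M Y q \<alpha> =
     exp (1 / (2 * of_real pi * \<i>) *
          line_integral \<alpha> (\<lambda>\<eta>. Ln (1 - of_real q * Phi M Y \<eta>) / \<eta>))"

definition c_minus :: "'a measure \<Rightarrow> (nat \<Rightarrow> 'a \<Rightarrow> real) \<Rightarrow> real \<Rightarrow> real \<Rightarrow> complex" where
  "c_minus M Y q \<beta> =
     exp (- (1 / (2 * of_real pi * \<i>)) *
          line_integral \<beta> (\<lambda>\<eta>. Ln (1 - of_real q * Phi M Y \<eta>) / \<eta>))"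

definition phi_pp :: "'a measure \<Rightarrow> (nat \<Rightarrow> 'a \<Rightarrow> real) \<Rightarrow> real \<Rightarrow> ('a \<Rightarrow> nat) \<Rightarrow> real
    \<Rightarrow> complex \<Rightarrow> complex" where
  "phi_pp M Y q T \<alpha> \<xi> = phi_plus M Y T \<xi> - c_plus M Y q \<alpha>"

definition phi_mm :: "'a measure \<Rightarrow> (nat \<Rightarrow> 'a \<Rightarrow> real) \<Rightarrow> real \<Rightarrow> ('a \<Rightarrow> nat) \<Rightarrow> real
    \<Rightarrow> complex \<Rightarrow> complex" where
  "phi_mm M Y q T \<beta> \<xi> = phi_minus M Y T \<xi> - c_minus M Y q \<beta>"

definition single_integrand :: "'a measure \<Rightarrow> (nat \<Rightarrow> 'a \<Rightarrow> real) \<Rightarrow> real \<Rightarrow> real \<Rightarrow> real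
    \<Rightarrow> complex \<Rightarrow> complex" where
  "single_integrand M Y q a1 x1 \<xi> =
     exp (\<i> * of_real (x1 - a1) * \<xi>) * of_real q * Phi M Y \<xi> /
     (- \<i> * \<xi> * (1 - of_real q * Phi M Y \<xi>))"

definition inner_integrand :: "'a measure \<Rightarrow> (nat \<Rightarrow> 'a \<Rightarrow> real) \<Rightarrow> real \<Rightarrow> ('a \<Rightarrow> nat) \<Rightarrow> real
    \<Rightarrow> real \<Rightarrow> real \<Rightarrow> complex \<Rightarrow> complex \<Rightarrow> complex" where
  "inner_integrand M Y q T \<beta> a1 a2 \<eta> \<xi> =
     exp (\<i> * \<xi> * of_real (a2 - a1)) * phi_mm M Y q T \<beta> \<xi> / (\<xi> * (\<xi> - \<eta>))"

definition outer_integrand :: "'a measure \<Rightarrow> (nat \<Rightarrow> 'a \<Rightarrow> real) \<Rightarrow> real \<Rightarrow> ('a \<Rightarrow> nat) \<Rightarrow> real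
    \<Rightarrow> real \<Rightarrow> real \<Rightarrow> real \<Rightarrow> real \<Rightarrow> real \<Rightarrow> complex \<Rightarrow> complex" where
  "outer_integrand M Y q T \<alpha> \<beta> a1 a2 x1 \<omega>1 \<eta> =
     exp (\<i> * of_real (x1 - a2) * \<eta>) * phi_pp M Y q T \<alpha> \<eta> *
     line_integral \<omega>1 (inner_integrand M Y q T \<beta> a1 a2 \<eta>)"

end

theory Submission
  imports Defs "HOL-Complex_Analysis.Complex_Analysis"
begin

text \<open>
  Let \<open>M\<close>, \<open>D \<le> 0\<close> be the maximum and the excess (walk minus maximum) at the geometric time. One step
  of the chain \<open>(M, D)\<close> gives, for fixed \<open>x\<close>, an identity between \<open>z \<mapsto> E[exp (\<i>xM + \<i>zD)] (1 - q \<Phi>(z))\<close>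
  and a function that is analytic and bounded in the upper half plane. With
  \<open>A\<^sup>\<plusminus>(z) = \<Sum>\<^sub>n q\<^sup>n/n E[exp (\<i>zX\<^sub>n); \<plusminus>X\<^sub>n > 0]\<close> one has \<open>1 - q \<Phi> = exp (- A\<^sup>+ - A\<^sup>-)\<close> on the strip, so
  Liouville's theorem yields \<open>E[exp (\<i>xM + \<i>zD)] = (1 - q) exp (A\<^sup>+(x) + A\<^sup>-(z))\<close>, hence the
  independence of \<open>M\<close> and \<open>D\<close> and both Wiener--Hopf factors. Inverting the
  transform \<open>- ln (1 - q \<Phi>)\<close> of \<open>\<Sum>\<^sub>n q\<^sup>n/n P(X\<^sub>n \<in> dx)\<close> on a half line identifies \<open>c\<^sup>\<plusminus> = exp (- A\<^sup>\<plusminus>(0))\<close> and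
  shows that \<open>A\<^sup>\<plusminus>\<close> decays like a power of \<open>|z|\<close> on horizontal lines; the decay of \<open>\<Phi>\<close> also rules
  out atoms of \<open>X\<^sub>n\<close> for \<open>n \<ge> 1\<close>. The value function is the law of the walk at the geometric
  time minus the probability that the walk ends below \<open>a\<^sub>1\<close> after its maximum has exceeded \<open>a\<^sub>2\<close>; the latter is
  inverted first in the walk, then in \<open>M\<close>, and Fubini's theorem exchanges the two line integrals.
\<close>

section \<open>Fourier inversion on a half line\<close>

text \<open>The law of the stopped walk has parts whose transforms do not decay: the start T = 0,
  and the atoms of M and D at 0. The restriction to T >= 1 in the single integral and the
  subtraction of \<open>c_plus\<close> and \<open>c_minus\<close> in the double one remove exactly
  these. On the event to be subtracted this costs nothing: there M > a2 - x1 >= 0, and X <= a1 - x1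
  <= a2 - x1 < M forces D < 0. As \<delta> may be small, the remaining factors are only shown to
  decay with exponent \<delta>/4 and need not be integrable on a line. Every inversion is therefore
  stated for a transform divided by \<eta> - \<xi>, which supplies the missing power, and is proved
  by Gaussian smoothing. Series in q^n with path functionals as coefficients are read as
  expectations at T, so that a single domination argument, a sum over all candidate times of the
  maximum, serves all of them. The minus half of the theory is the plus half for the walk with
  increments -Y.\<close>

lemma integrable_norm_le:
  fixes f :: "'a \<Rightarrow> 'b::{banach, second_countable_topology}" and g :: "'a \<Rightarrow> real"
  assumes "integrable M g" "f \<in> borel_measurable M" "\<And>x. norm (f x) \<le> g x"
  shows "integrable M f"
  by (rule Bochner_Integration.integrable_bound[OF assms(1,2)])
     (auto intro!: AE_I2 order_trans[OF assms(3) abs_ge_self])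

lemma integral_tendsto_dominated:
  fixes s :: "nat \<Rightarrow> 'a \<Rightarrow> 'b::{banach, second_countable_topology}" and w :: "'a \<Rightarrow> real"
  assumes "\<And>n. s n \<in> borel_measurable M" "integrable M w"
    and "\<And>x. (\<lambda>n. s n x) \<longlonglongrightarrow> f x" "\<And>n x. norm (s n x) \<le> w x"
  shows "(\<lambda>n. LINT x|M. s n x) \<longlonglongrightarrow> (LINT x|M. f x)"
proof (rule integral_dominated_convergence)
  show "f \<in> borel_measurable M"
    by (rule borel_measurable_LIMSEQ_metric[of s]) (use assms in auto)
qed (use assms in auto)

lemma integrable_gauss_exp:
  "integrable lborel (\<lambda>u::real. complex_of_real (exp (- u\<^sup>2 / 2)) * exp (\<i> * of_real (u * x)))"
proof -
  have "integrable lborel (\<lambda>x. std_normal_density x)"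
    using integrable_std_normal_moment[of 0] by simp
  hence "integrable lborel (\<lambda>x. sqrt (2*pi) * std_normal_density x)"
    by (rule integrable_mult_right)
  hence "integrable lborel (\<lambda>x::real. exp (- x\<^sup>2 / 2))"
    by (simp add: normal_density_def)
  then show ?thesis
    by (rule Bochner_Integration.integrable_bound) (auto simp: norm_mult)
qed

lemma integrable_gauss: "integrable lborel (\<lambda>u::real. exp (- u\<^sup>2 / 2))"
  using integrable_norm[OF integrable_gauss_exp[of 0]] by (simp add: norm_mult)

lemma gauss_char:
  "(LINT u|lborel. complex_of_real (exp (- u\<^sup>2 / 2)) * exp (\<i> * of_real (u * x)))
     = of_real (sqrt (2*pi) * exp (- x\<^sup>2 / 2))"
proof -
  have "char std_normal_distribution x = of_real (exp (- x\<^sup>2 / 2))"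
    by (simp add: char_std_normal_distribution)
  also have "char std_normal_distribution x = (LINT u|lborel. std_normal_density u *\<^sub>R iexp (x * u))"
    unfolding char_def by (subst integral_density) (auto simp: normal_density_nonneg)
  also have "(\<lambda>u. std_normal_density u *\<^sub>R iexp (x * u)) =
     (\<lambda>u. (1 / of_real (sqrt (2*pi))) * (complex_of_real (exp (- u\<^sup>2 / 2)) * exp (\<i> * of_real (u * x))))"
    by (auto simp: normal_density_def scaleR_conv_of_real mult_ac)
  finally show ?thesis by (simp add: field_simps)
qed

lemma
  fixes s :: complex
  assumes s: "Re s > 0"
  shows integrable_exp_halfline: "integrable lborel (\<lambda>v. indicator {0<..} v *\<^sub>R exp (- s * of_real v))"
    and integral_exp_halfline: "(LINT v|lborel. indicator {0<..} v *\<^sub>R exp (- s * of_real v)) = 1 / s"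
proof -
  have "set_integrable lborel {0<..} (\<lambda>v::real. exp (- (v * Re s)))"
    by (rule integrable_I0i_exp_mscale[OF s])
  then show 1: "integrable lborel (\<lambda>v. indicator {0<..} v *\<^sub>R exp (- s * of_real v))"
    unfolding set_integrable_def
    by (rule Bochner_Integration.integrable_bound) (auto simp: indicator_def mult_ac)
  have "(LBINT v=ereal 0..\<infinity>. exp (- s * of_real v)) = 0 - (- (1/s))"
  proof (rule interval_integral_FTC_integrable)
    fix x :: real
    show "((\<lambda>v. - exp (- s * of_real v) / s) has_vector_derivative exp (- s * complex_of_real x)) (at x)"
      using s by (auto intro!: derivative_eq_intros has_vector_derivative_real_field simp: field_simps)
    show "isCont (\<lambda>x. exp (- s * complex_of_real x)) x" by (intro continuous_intros)
  next
    show "set_integrable lborel (einterval (ereal 0) \<infinity>) (\<lambda>x. exp (- s * complex_of_real x))"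
      using 1 by (simp add: set_integrable_def)
    have "((\<lambda>v. - exp (- s * of_real v) / s) \<longlongrightarrow> - exp (- s * of_real 0) / s) (at_right (0::real))"
      using s by (intro tendsto_intros) auto
    then show "(((\<lambda>v. - exp (- s * of_real v) / s) \<circ> real_of_ereal) \<longlongrightarrow> - (1 / s)) (at_right (ereal 0))"
      by (simp add: ereal_tendsto_simps)
    have "((\<lambda>v. norm (- exp (- s * of_real v) / s)) \<longlongrightarrow> 0) at_top"
    proof -
      have "((\<lambda>v. exp (- Re s * v)) \<longlongrightarrow> 0) at_top"
        using s by real_asymp
      from tendsto_divide_zero[OF this, of "norm s"] show ?thesis by (simp add: norm_divide)
    qed
    then have "((\<lambda>v. - exp (- s * of_real v) / s) \<longlongrightarrow> 0) at_top"
      by (rule tendsto_norm_zero_cancel)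
    then show "(((\<lambda>v. - exp (- s * of_real v) / s) \<circ> real_of_ereal) \<longlongrightarrow> 0) (at_left \<infinity>)"
      by (simp add: ereal_tendsto_simps)
  qed simp
  then show "(LINT v|lborel. indicator {0<..} v *\<^sub>R exp (- s * of_real v)) = 1 / s"
    by (simp add: interval_lebesgue_integral_def set_lebesgue_integral_def)
qed

lemma integrable_pair_mult:
  fixes f g :: "_ \<Rightarrow> real"
  assumes "sigma_finite_measure M1" "sigma_finite_measure M2" "integrable M1 f" "integrable M2 g"
  shows "integrable (M1 \<Otimes>\<^sub>M M2) (\<lambda>(x, y). f x * g y)"
proof -
  interpret pair_sigma_finite M1 M2 using assms by (simp add: pair_sigma_finite_def)
  have [measurable]: "f \<in> borel_measurable M1" "g \<in> borel_measurable M2" using assms by auto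
  show ?thesis
  proof (rule Fubini_integrable)
    have "integrable M1 (\<lambda>x. \<bar>f x\<bar> * (LINT y|M2. \<bar>g y\<bar>))"
      using assms by (intro integrable_mult_left integrable_abs)
    then show "integrable M1 (\<lambda>x. LINT y|M2. norm (case (x, y) of (x, y) \<Rightarrow> f x * g y))"
      by (simp add: abs_mult)
  qed (use assms in auto)
qed

text \<open>Writing 1/(s + it) as the Laplace integral of exp(-(s + it)v) over v > 0 gives a double
  integral whose t-part is a Gaussian Fourier integral, of width \<epsilon> around v = y; the
  substitution v = y + \<epsilon>z yields the right side. The Gaussian factor makes Fubini
  applicable, since 1/(s + it) alone is not integrable in t.\<close>

lemma gauss_smoothed_kernel:
  fixes s :: complex and y \<epsilon> :: real
  assumes s: "Re s > 0" and e: "\<epsilon> > 0"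
  shows "(LINT t|lborel. complex_of_real (exp (- (\<epsilon> * t)\<^sup>2 / 2)) * exp (\<i> * of_real (t * y)) / (s + \<i> * of_real t))
     = of_real (sqrt (2*pi)) * (LINT z|lborel. complex_of_real (exp (- z\<^sup>2 / 2)) *
         (indicator {0<..} (y + \<epsilon> * z) *\<^sub>R exp (- s * of_real (y + \<epsilon> * z))))"
proof -
  define F where "F = (\<lambda>t v. complex_of_real (exp (- (\<epsilon> * t)\<^sup>2 / 2)) * exp (\<i> * of_real (t * y)) *
      (indicator {0<..} v *\<^sub>R exp (- (s + \<i> * of_real t) * of_real v)))"
  have F_meas[measurable]: "case_prod F \<in> borel_measurable (lborel \<Otimes>\<^sub>M lborel)"
    unfolding F_def by measurable
  have g1: "integrable lborel (\<lambda>t. exp (- (\<epsilon> * t)\<^sup>2 / 2))"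
    using lborel_integrable_real_affine[OF integrable_gauss, of \<epsilon> 0] e by simp
  have g2: "integrable lborel (\<lambda>v. indicator {0<..} v * exp (- Re s * v))"
    using integrable_norm[OF integrable_exp_halfline[OF s]] by (simp add: mult_ac)
  have Fint: "integrable (lborel \<Otimes>\<^sub>M lborel) (case_prod F)"
    by (rule Bochner_Integration.integrable_bound[OF integrable_pair_mult[OF _ _ g1 g2]])
       (auto simp: F_def norm_mult indicator_def lborel.sigma_finite_measure_axioms)
  have "(LINT t|lborel. LINT v|lborel. F t v) =
     (LINT t|lborel. complex_of_real (exp (- (\<epsilon> * t)\<^sup>2 / 2)) * exp (\<i> * of_real (t * y)) / (s + \<i> * of_real t))"
    unfolding F_def using s
    by (subst integral_mult_right_zero, subst integral_exp_halfline) auto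
  moreover have "(LINT t|lborel. LINT v|lborel. F t v) = (LINT v|lborel. LINT t|lborel. F t v)"
    using lborel_pair.Fubini_integral[OF Fint] by simp
  moreover have "(LINT t|lborel. F t v) = of_real (sqrt (2*pi) / \<epsilon> * exp (- ((y - v) / \<epsilon>)\<^sup>2 / 2)) *
       (indicator {0<..} v *\<^sub>R exp (- s * of_real v))" for v
  proof -
    have "(LINT u|lborel. complex_of_real (exp (- u\<^sup>2 / 2)) * exp (\<i> * of_real (u * ((y - v) / \<epsilon>))))
       = \<epsilon> *\<^sub>R (LINT t|lborel. complex_of_real (exp (- (\<epsilon> * t)\<^sup>2 / 2)) * exp (\<i> * of_real (t * (y - v))))"
      using e by (subst lborel_integral_real_affine[where c = \<epsilon> and t = 0]) auto
    then have *: "(LINT t|lborel. complex_of_real (exp (- (\<epsilon> * t)\<^sup>2 / 2)) * exp (\<i> * of_real (t * (y - v))))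
      = of_real (sqrt (2*pi) / \<epsilon> * exp (- ((y - v) / \<epsilon>)\<^sup>2 / 2))"
      using e unfolding gauss_char by (simp add: scaleR_conv_of_real field_simps)
    have "F t v = complex_of_real (exp (- (\<epsilon> * t)\<^sup>2 / 2)) * exp (\<i> * of_real (t * (y - v))) *
       (indicator {0<..} v *\<^sub>R exp (- s * of_real v))" for t
      by (simp add: F_def indicator_def exp_add[symmetric] algebra_simps)
    then show ?thesis by (simp only: integral_mult_left_zero *)
  qed
  moreover have "(LINT v|lborel. of_real (sqrt (2*pi) / \<epsilon> * exp (- ((y - v) / \<epsilon>)\<^sup>2 / 2)) *
       (indicator {0<..} v *\<^sub>R exp (- s * of_real v))) =
     of_real (sqrt (2*pi)) * (LINT z|lborel. complex_of_real (exp (- z\<^sup>2 / 2)) *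
         (indicator {0<..} (y + \<epsilon> * z) *\<^sub>R exp (- s * of_real (y + \<epsilon> * z))))"
    using e
    by (subst lborel_integral_real_affine[where c = \<epsilon> and t = y])
       (auto simp: scaleR_conv_of_real mult.assoc power_divide)
  ultimately show ?thesis by simp
qed

text \<open>The bound involves neither y nor \<epsilon>, because exp(-sv) has modulus at most 1 for
  v > 0; it is the dominating constant in \<open>halfline_inversion\<close>.\<close>

lemma norm_gauss_smoothed_le:
  fixes s :: complex and y \<epsilon> :: real
  assumes s: "Re s > 0"
  shows "norm (LINT z|lborel. complex_of_real (exp (- z\<^sup>2 / 2)) *
         (indicator {0<..} (y + \<epsilon> * z) *\<^sub>R exp (- s * of_real (y + \<epsilon> * z)))) \<le> (LINT z|lborel. exp (- z\<^sup>2 / 2))"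
proof (rule order_trans[OF integral_norm_bound], rule integral_mono_AE'[OF integrable_gauss])
  show "AE x in lborel. cmod (complex_of_real (exp (- x\<^sup>2 / 2)) *
      (indicat_real {0<..} (y + \<epsilon> * x) *\<^sub>R exp (- s * complex_of_real (y + \<epsilon> * x)))) \<le> exp (- x\<^sup>2 / 2)"
    using s by (intro AE_I2) (auto simp: norm_mult indicator_def)
qed simp

text \<open>At y = 0 the indicator equals 1 on half of the Gaussian mass at every scale, so the
  limit there would be \<open>sqrt (2*pi) / 2\<close> instead of 0. This is why the inversion asks
  the weight to vanish where X = b.\<close>

lemma gauss_smoothed_limit:
  fixes s :: complex and y :: real
  assumes s: "Re s > 0" and y: "y \<noteq> 0"
  shows "(\<lambda>n. LINT z|lborel. complex_of_real (exp (- z\<^sup>2 / 2)) *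
         (indicator {0<..} (y + inverse (real (Suc n)) * z) *\<^sub>R exp (- s * of_real (y + inverse (real (Suc n)) * z))))
     \<longlonglongrightarrow> of_real (sqrt (2*pi)) * (indicator {0<..} y *\<^sub>R exp (- s * of_real y))"
proof -
  have "(\<lambda>n. LINT z|lborel. complex_of_real (exp (- z\<^sup>2 / 2)) *
         (indicator {0<..} (y + inverse (real (Suc n)) * z) *\<^sub>R exp (- s * of_real (y + inverse (real (Suc n)) * z))))
     \<longlonglongrightarrow> (LINT z|lborel. complex_of_real (exp (- z\<^sup>2 / 2)) * (indicator {0<..} y *\<^sub>R exp (- s * of_real y)))"
  proof (rule integral_tendsto_dominated[OF _ integrable_gauss])
    show "cmod (complex_of_real (exp (- x\<^sup>2 / 2)) * (indicat_real {0<..} (y + inverse (real (Suc n)) * x) *\<^sub>R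
        exp (- s * complex_of_real (y + inverse (real (Suc n)) * x)))) \<le> exp (- x\<^sup>2 / 2)" for n x
    proof -
      have "cmod (complex_of_real (exp (- x\<^sup>2 / 2)) * (indicat_real {0<..} (y + e * x) *\<^sub>R
        exp (- s * complex_of_real (y + e * x)))) \<le> exp (- x\<^sup>2 / 2)" for e
        using s by (auto simp: norm_mult indicator_def)
      then show ?thesis .
    qed
    have "(\<lambda>n. indicat_real {0<..} (y + inverse (real (Suc n)) * z) *\<^sub>R exp (- s * complex_of_real (y + inverse (real (Suc n)) * z)))
        \<longlonglongrightarrow> indicat_real {0<..} y *\<^sub>R exp (- s * complex_of_real y)" for z
    proof (intro tendsto_scaleR)
      have lim: "(\<lambda>n. y + inverse (real (Suc n)) * z) \<longlonglongrightarrow> y"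
        using tendsto_add[OF tendsto_const tendsto_mult_left_zero[OF LIMSEQ_inverse_real_of_nat, of z], of y] by simp
      show "(\<lambda>n. exp (- s * complex_of_real (y + inverse (real (Suc n)) * z))) \<longlonglongrightarrow> exp (- s * complex_of_real y)"
        by (intro tendsto_intros lim)
      show "(\<lambda>n. indicat_real {0<..} (y + inverse (real (Suc n)) * z)) \<longlonglongrightarrow> indicat_real {0<..} y"
      proof (cases "y > 0")
        case True
        then have "\<forall>\<^sub>F n in sequentially. y + inverse (real (Suc n)) * z > 0"
          using order_tendstoD(1)[OF lim] by auto
        then have "\<forall>\<^sub>F n in sequentially. indicat_real {0<..} (y + inverse (real (Suc n)) * z) = 1"
          by eventually_elim auto
        then show ?thesis using True by (auto intro: tendsto_eventually)
      next
        case False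
        then have "\<forall>\<^sub>F n in sequentially. y + inverse (real (Suc n)) * z < 0"
          using order_tendstoD(2)[OF lim, of 0] y by auto
        then have "\<forall>\<^sub>F n in sequentially. indicat_real {0<..} (y + inverse (real (Suc n)) * z) = 0"
          by eventually_elim auto
        then show ?thesis using False by (auto intro: tendsto_eventually)
      qed
    qed
    then show "(\<lambda>n. complex_of_real (exp (- z\<^sup>2 / 2)) *
         (indicator {0<..} (y + inverse (real (Suc n)) * z) *\<^sub>R exp (- s * of_real (y + inverse (real (Suc n)) * z))))
       \<longlonglongrightarrow> complex_of_real (exp (- z\<^sup>2 / 2)) * (indicator {0<..} y *\<^sub>R exp (- s * of_real y))" for z
      by (intro tendsto_mult tendsto_const)
  qed measurable
  moreover have "(LINT z|lborel. complex_of_real (exp (- z\<^sup>2 / 2))) = of_real (sqrt (2 * pi))"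
    using gauss_char[of 0] by simp
  ultimately show ?thesis by simp
qed

text \<open>The Gaussian-damped integral \<open>I n\<close> tends to the line integral by dominated
  convergence in t, and by Fubini it is also an expectation of smoothed half-line kernels, which
  converge wherever X differs from b. Integrability is asked of the transform divided by s + it, not
  of the transform. The weight W is complex so that exponential tilts and further transforms can be
  absorbed in it.\<close>

theorem halfline_inversion:
  fixes W :: "'a \<Rightarrow> complex" and X :: "'a \<Rightarrow> real" and s :: complex and b :: real
  assumes M: "sigma_finite_measure M"
    and W: "integrable M W" and X[measurable]: "X \<in> borel_measurable M"
    and s: "Re s > 0"
    and no_atom: "AE w in M. X w = b \<longrightarrow> W w = 0"
    and int: "integrable lborel (\<lambda>t. (LINT w|M. W w * exp (\<i> * of_real (t * X w))) / (s + \<i> * of_real t))"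
  shows "(LINT w|M. W w * (indicator {b<..} (X w) *\<^sub>R exp (- s * of_real (X w - b)))) =
     1 / (2 * of_real pi) *
       (LINT t|lborel. exp (- \<i> * of_real (t * b)) * ((LINT w|M. W w * exp (\<i> * of_real (t * X w))) / (s + \<i> * of_real t)))"
proof -
  interpret M: sigma_finite_measure M by fact
  interpret P: pair_sigma_finite M lborel by (simp add: pair_sigma_finite_def M lborel.sigma_finite_measure_axioms)
  have [measurable]: "W \<in> borel_measurable M" using W by auto
  define \<psi> where "\<psi> t = (LINT w|M. W w * exp (\<i> * of_real (t * X w)))" for t :: real
  define K where "K n y = (LINT z|lborel. complex_of_real (exp (- z\<^sup>2 / 2)) *
         (indicator {0<..} (y + inverse (real (Suc n)) * z) *\<^sub>R exp (- s * of_real (y + inverse (real (Suc n)) * z))))" for n y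
  have K_meas[measurable]: "K n \<in> borel_measurable borel" for n unfolding K_def by measurable
  define I where "I n = (LINT t|lborel. complex_of_real (exp (- (inverse (real (Suc n)) * t)\<^sup>2 / 2)) *
        (exp (- \<i> * of_real (t * b)) * (\<psi> t / (s + \<i> * of_real t))))" for n
  have int': "integrable lborel (\<lambda>t. \<psi> t / (s + \<i> * of_real t))" using int by (simp add: \<psi>_def)
  then have psi_meas[measurable]: "(\<lambda>t. \<psi> t / (s + \<i> * of_real t)) \<in> borel_measurable lborel" by auto
  have lim1: "I \<longlonglongrightarrow> (LINT t|lborel. 1 * (exp (- \<i> * of_real (t * b)) * (\<psi> t / (s + \<i> * of_real t))))"
    unfolding I_def
  proof (rule integral_tendsto_dominated[OF _ integrable_norm[OF int']])
    fix t
    have "(\<lambda>n. complex_of_real (exp (- (inverse (real (Suc n)) * t)\<^sup>2 / 2))) \<longlonglongrightarrow> of_real (exp (- (0 * t)\<^sup>2 / 2))"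
      by (intro tendsto_intros LIMSEQ_inverse_real_of_nat) auto
    then have "(\<lambda>n. complex_of_real (exp (- (inverse (real (Suc n)) * t)\<^sup>2 / 2))) \<longlonglongrightarrow> 1" by simp
    then show "(\<lambda>n. complex_of_real (exp (- (inverse (real (Suc n)) * t)\<^sup>2 / 2)) *
        (exp (- \<i> * of_real (t * b)) * (\<psi> t / (s + \<i> * of_real t))))
        \<longlonglongrightarrow> 1 * (exp (- \<i> * of_real (t * b)) * (\<psi> t / (s + \<i> * of_real t)))"
      by (intro tendsto_mult tendsto_const)
    show "norm (complex_of_real (exp (- (inverse (real (Suc n)) * t)\<^sup>2 / 2)) *
        (exp (- \<i> * of_real (t * b)) * (\<psi> t / (s + \<i> * of_real t)))) \<le> norm (\<psi> t / (s + \<i> * of_real t))" for n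
    proof -
      have "norm (complex_of_real (exp (- (inverse (real (Suc n)) * t)\<^sup>2 / 2)) *
        (exp (- \<i> * of_real (t * b)) * (\<psi> t / (s + \<i> * of_real t)))) =
        exp (- (inverse (real (Suc n)) * t)\<^sup>2 / 2) * norm (\<psi> t / (s + \<i> * of_real t))"
        by (simp add: norm_mult norm_divide)
      also have "\<dots> \<le> norm (\<psi> t / (s + \<i> * of_real t))" by (intro mult_left_le_one_le) auto
      finally show ?thesis .
    qed
  qed measurable
  have I_eq: "I n = (LINT w|M. W w * (of_real (sqrt (2*pi)) * K n (X w - b)))" for n
  proof -
    define \<epsilon> where "\<epsilon> = inverse (real (Suc n))"
    have e: "\<epsilon> > 0" by (simp add: \<epsilon>_def)
    define F where "F = (\<lambda>w t. W w * (complex_of_real (exp (- (\<epsilon> * t)\<^sup>2 / 2)) * exp (\<i> * of_real (t * (X w - b))) / (s + \<i> * of_real t)))"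
    have [measurable]: "case_prod F \<in> borel_measurable (M \<Otimes>\<^sub>M lborel)" unfolding F_def by measurable
    have g1: "integrable lborel (\<lambda>t. exp (- (\<epsilon> * t)\<^sup>2 / 2) / Re s)"
      using lborel_integrable_real_affine[OF integrable_gauss, of \<epsilon> 0] e by simp
    have Fint: "integrable (M \<Otimes>\<^sub>M lborel) (case_prod F)"
    proof (rule Bochner_Integration.integrable_bound[OF integrable_pair_mult[OF M _ integrable_norm[OF W] g1]])
      have "norm (F x y) \<le> norm (cmod (W x) * (exp (- (\<epsilon> * y)\<^sup>2 / 2) / Re s))" for x y
      proof -
        have "Re s \<le> norm (s + \<i> * of_real y)" using complex_Re_le_cmod[of "s + \<i> * of_real y"] by simp
        then show ?thesis using s by (auto simp: F_def norm_mult norm_divide intro!: mult_left_mono divide_left_mono mult_pos_pos)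
      qed
      then show "AE x in M \<Otimes>\<^sub>M lborel. norm (case x of (x, y) \<Rightarrow> F x y)
         \<le> norm (case x of (x, y) \<Rightarrow> cmod (W x) * (exp (- (\<epsilon> * y)\<^sup>2 / 2) / Re s))"
        by auto
    qed (auto simp: lborel.sigma_finite_measure_axioms)
    have "I n = (LINT t|lborel. LINT w|M. F w t)"
      unfolding I_def \<epsilon>_def[symmetric] \<psi>_def
    proof (intro Bochner_Integration.integral_cong refl)
      fix t
      have "F w t = (complex_of_real (exp (- (\<epsilon> * t)\<^sup>2 / 2)) * exp (- \<i> * of_real (t * b)) / (s + \<i> * of_real t)) * (W w * exp (\<i> * of_real (t * X w)))" for w
        by (simp add: F_def exp_add[symmetric] right_diff_distrib exp_diff exp_minus field_simps)
      then show "complex_of_real (exp (- (\<epsilon> * t)\<^sup>2 / 2)) * (exp (- \<i> * of_real (t * b)) * ((LINT w|M. W w * exp (\<i> * of_real (t * X w))) / (s + \<i> * of_real t))) = (LINT w|M. F w t)"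
        by (simp only: integral_mult_right_zero) simp
    qed
    also have "\<dots> = (LINT w|M. LINT t|lborel. F w t)" using P.Fubini_integral[OF Fint] .
    also have "\<dots> = (LINT w|M. W w * (of_real (sqrt (2*pi)) * K n (X w - b)))"
      by (simp only: F_def integral_mult_right_zero gauss_smoothed_kernel[OF s e] K_def
          flip: \<epsilon>_def)
    finally show ?thesis .
  qed
  have lim2: "(\<lambda>n. LINT w|M. W w * (of_real (sqrt (2*pi)) * K n (X w - b))) \<longlonglongrightarrow>
      (LINT w|M. W w * (of_real (sqrt (2*pi)) * (of_real (sqrt (2*pi)) * (indicator {b<..} (X w) *\<^sub>R exp (- s * of_real (X w - b))))))"
  proof (rule integral_dominated_convergence[where w = "\<lambda>w. norm (W w) * (sqrt (2*pi) * (LINT z|lborel. exp (- z\<^sup>2 / 2)))"])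
    show "integrable M (\<lambda>w. norm (W w) * (sqrt (2*pi) * (LINT z|lborel. exp (- z\<^sup>2 / 2))))"
      using W by (intro integrable_mult_left integrable_norm)
    show "AE w in M. norm (W w * (of_real (sqrt (2*pi)) * K n (X w - b))) \<le>
        norm (W w) * (sqrt (2*pi) * (LINT z|lborel. exp (- z\<^sup>2 / 2)))" for n
      unfolding norm_mult K_def
      by (intro AE_I2 mult_mono norm_gauss_smoothed_le s mult_nonneg_nonneg) auto
    show "AE w in M. (\<lambda>n. W w * (of_real (sqrt (2*pi)) * K n (X w - b))) \<longlonglongrightarrow>
      W w * (of_real (sqrt (2*pi)) * (of_real (sqrt (2*pi)) * (indicator {b<..} (X w) *\<^sub>R exp (- s * of_real (X w - b)))))"
      using no_atom
    proof eventually_elim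
      case (elim w)
      show ?case
      proof (cases "X w = b")
        case False
        have "indicat_real {b<..} (X w) = indicator {0<..} (X w - b)" by (auto simp: indicator_def)
        then show ?thesis unfolding K_def using gauss_smoothed_limit[OF s, of "X w - b"] False
          by (intro tendsto_mult tendsto_const) auto
      qed (use elim in auto)
    qed
  qed measurable
  have "(LINT t|lborel. exp (- \<i> * of_real (t * b)) * (\<psi> t / (s + \<i> * of_real t))) =
     (LINT w|M. W w * (of_real (sqrt (2*pi)) * (of_real (sqrt (2*pi)) * (indicator {b<..} (X w) *\<^sub>R exp (- s * of_real (X w - b))))))"
    using LIMSEQ_unique[OF lim1 lim2[folded I_eq]] by simp
  \<comment> \<open>One factor sqrt(2 pi) comes from the Gaussian Fourier integral, the other is the
    Gaussian mass left over in the limit.\<close>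
  also have "\<dots> = (LINT w|M. (2 * of_real pi) * (W w * (indicator {b<..} (X w) *\<^sub>R exp (- s * of_real (X w - b)))))"
  proof (intro Bochner_Integration.integral_cong refl)
    have "complex_of_real (sqrt (2*pi)) * of_real (sqrt (2*pi)) = of_real (2*pi)"
      by (simp flip: of_real_mult)
    then show "W w * (of_real (sqrt (2*pi)) * (of_real (sqrt (2*pi)) * (indicator {b<..} (X w) *\<^sub>R exp (- s * of_real (X w - b))))) =
        (2 * of_real pi) * (W w * (indicator {b<..} (X w) *\<^sub>R exp (- s * of_real (X w - b))))" for w
      by (simp add: mult.assoc[symmetric])
  qed
  finally show ?thesis unfolding \<psi>_def[symmetric] integral_mult_right_zero by simp
qed

text \<open>The integral of \<psi>(un) exp(-iunb) against exp(-u^2/2) in u is sqrt(2 pi) times the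
  expectation of exp(-(n(X - b))^2/2), which tends to the probability of X = b. The same integral
  tends to 0, because \<psi>(un) does so for every u other than 0.\<close>

lemma no_atom_if_char_tendsto_0:
  fixes X :: "'a \<Rightarrow> real"
  assumes M: "prob_space M" and X[measurable]: "X \<in> borel_measurable M"
    and lim: "((\<lambda>t. LINT w|M. exp (\<i> * of_real (t * X w))) \<longlongrightarrow> 0) at_infinity"
  shows "AE w in M. X w \<noteq> b"
proof -
  interpret M: prob_space M by fact
  interpret P: pair_sigma_finite M lborel by (simp add: pair_sigma_finite_def M.sigma_finite_measure_axioms lborel.sigma_finite_measure_axioms)
  define \<psi> where "\<psi> t = (LINT w|M. exp (\<i> * of_real (t * X w)))" for t :: real
  have [measurable]: "\<psi> \<in> borel_measurable borel" unfolding \<psi>_def by measurable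
  have psi_le: "norm (\<psi> t) \<le> 1" for t
    unfolding \<psi>_def by (rule order_trans[OF integral_norm_bound]) (simp add: M.prob_space)
  define A where "A n = (LINT u|lborel. complex_of_real (exp (- u\<^sup>2 / 2)) * (exp (- \<i> * of_real (u * (real n * b))) * \<psi> (u * real n)))" for n
  have A_eq: "A n = (LINT w|M. of_real (sqrt (2*pi) * exp (- (real n * (X w - b))\<^sup>2 / 2)))" for n
  proof -
    define F where "F = (\<lambda>w u. complex_of_real (exp (- u\<^sup>2 / 2)) * exp (\<i> * of_real (u * (real n * (X w - b)))))"
    have [measurable]: "case_prod F \<in> borel_measurable (M \<Otimes>\<^sub>M lborel)" unfolding F_def by measurable
    have Fint: "integrable (M \<Otimes>\<^sub>M lborel) (case_prod F)"
      by (rule Bochner_Integration.integrable_bound[OF integrable_pair_mult[OF _ _ M.integrable_const[of 1] integrable_gauss]])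
         (auto simp: F_def norm_mult lborel.sigma_finite_measure_axioms M.sigma_finite_measure_axioms)
    have "A n = (LINT u|lborel. LINT w|M. F w u)"
      unfolding A_def \<psi>_def
    proof (intro Bochner_Integration.integral_cong refl)
      fix u
      have "F w u = complex_of_real (exp (- u\<^sup>2 / 2)) * exp (- \<i> * of_real (u * (real n * b))) * exp (\<i> * of_real (u * real n * X w))" for w
        by (simp add: F_def exp_add[symmetric] right_diff_distrib exp_diff exp_minus field_simps)
      then show "complex_of_real (exp (- u\<^sup>2 / 2)) * (exp (- \<i> * of_real (u * (real n * b))) * (LINT w|M. exp (\<i> * of_real (u * real n * X w)))) = (LINT w|M. F w u)"
        by (simp only: integral_mult_right_zero mult.assoc)
    qed
    also have "\<dots> = (LINT w|M. LINT u|lborel. F w u)" using P.Fubini_integral[OF Fint] .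
    also have "\<dots> = (LINT w|M. of_real (sqrt (2*pi) * exp (- (real n * (X w - b))\<^sup>2 / 2)))"
      unfolding F_def gauss_char ..
    finally show ?thesis .
  qed
  have "A \<longlonglongrightarrow> (LINT (u::real)|lborel. (0::complex))"
    unfolding A_def
  proof (rule integral_dominated_convergence[OF _ _ integrable_gauss])
    show "AE x in lborel. norm (complex_of_real (exp (- x\<^sup>2 / 2)) * (exp (- \<i> * of_real (x * (real n * b))) * \<psi> (x * real n))) \<le> exp (- x\<^sup>2 / 2)" for n
      using psi_le by (intro AE_I2) (auto simp: norm_mult)
    have *: "(\<lambda>n. complex_of_real (exp (- x\<^sup>2 / 2)) * (exp (- \<i> * of_real (x * (real n * b))) * \<psi> (x * real n))) \<longlonglongrightarrow> 0" if "x \<noteq> 0" for x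
    proof (rule Lim_null_comparison)
      have "filterlim (\<lambda>n. x * real n) at_infinity sequentially"
        by (intro tendsto_mult_filterlim_at_infinity[OF tendsto_const that]
            filterlim_at_top_imp_at_infinity filterlim_real_sequentially)
      then have "(\<lambda>n. \<psi> (x * real n)) \<longlonglongrightarrow> 0"
        using lim unfolding \<psi>_def[symmetric] by (rule filterlim_compose[rotated])
      then show "(\<lambda>n. norm (\<psi> (x * real n))) \<longlonglongrightarrow> 0" by (rule tendsto_norm_zero)
      show "\<forall>\<^sub>F n in sequentially. norm (complex_of_real (exp (- x\<^sup>2 / 2)) * (exp (- \<i> * of_real (x * (real n * b))) * \<psi> (x * real n))) \<le> norm (\<psi> (x * real n))"
        by (intro always_eventually allI) (simp add: norm_mult mult_left_le_one_le)
    qed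
    from AE_lborel_singleton[of "0::real"]
    show "AE x in lborel. (\<lambda>n. complex_of_real (exp (- x\<^sup>2 / 2)) * (exp (- \<i> * of_real (x * (real n * b))) * \<psi> (x * real n))) \<longlonglongrightarrow> 0"
      by eventually_elim (rule *)
  qed measurable
  moreover have "A \<longlonglongrightarrow> (LINT w|M. of_real (sqrt (2*pi) * indicator {w. X w = b} w))"
    unfolding A_eq
  proof (rule integral_tendsto_dominated[where w = "\<lambda>_. sqrt (2*pi)"])
    have "(\<lambda>n. exp (- (real n * y)\<^sup>2 / 2)) \<longlonglongrightarrow> (if y = 0 then 1 else 0)" for y :: real
    proof (cases "y = 0")
      case False
      then have "y\<^sup>2 > 0" by simp
      then have "(\<lambda>n. exp (- ((real n)\<^sup>2 * y\<^sup>2) / 2)) \<longlonglongrightarrow> 0" by real_asymp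
      then have "(\<lambda>n. exp (- (real n * y)\<^sup>2 / 2)) \<longlonglongrightarrow> 0" by (simp add: power_mult_distrib)
      then show ?thesis using False by simp
    qed simp
    then have "(\<lambda>n. complex_of_real (sqrt (2 * pi) * exp (- (real n * (X x - b))\<^sup>2 / 2)))
       \<longlonglongrightarrow> complex_of_real (sqrt (2 * pi) * (if X x - b = 0 then 1 else 0))" for x
      by (rule tendsto_of_real[OF tendsto_mult[OF tendsto_const]])
    moreover have "(if X x - b = 0 then 1 else 0) = indicat_real {w. X w = b} x" for x by auto
    ultimately show "(\<lambda>n. complex_of_real (sqrt (2 * pi) * exp (- (real n * (X x - b))\<^sup>2 / 2)))
       \<longlonglongrightarrow> complex_of_real (sqrt (2 * pi) * indicat_real {w. X w = b} x)" for x
      by simp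
    show "norm (complex_of_real (sqrt (2 * pi) * exp (- (real n * (X x - b))\<^sup>2 / 2))) \<le> sqrt (2 * pi)" for n x
      by (simp add: norm_mult mult_left_le)
  qed auto
  ultimately have "(LINT w|M. of_real (sqrt (2*pi) * indicator {w. X w = b} w)) = (0::complex)"
    by (auto dest: LIMSEQ_unique)
  then have "(LINT w|M. sqrt (2*pi) * indicator {w. X w = b} w) = 0"
    by (simp only: integral_complex_of_real of_real_eq_0_iff)
  then have "(LINT w|M. indicator {w. X w = b} w) = (0::real)"
    unfolding integral_mult_right_zero by simp
  also have "(LINT w|M. indicator {w. X w = b} w) = (LINT w|M. indicator {w \<in> space M. X w = b} w :: real)"
    by (intro Bochner_Integration.integral_cong) (auto simp: indicator_def)
  finally have "(LINT w|M. indicator {w \<in> space M. X w = b} w) = (0::real)" .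
  then have "M.prob {w \<in> space M. X w = b} = 0" by simp
  then show ?thesis by (subst AE_iff_measurable[OF _ refl]) (auto simp: M.emeasure_eq_measure)
qed

section \<open>Power weights on the real line\<close>

abbreviation decay :: "real \<Rightarrow> real \<Rightarrow> real" where
  "decay p t \<equiv> (1 + \<bar>t\<bar>) powr (- p)"

text \<open>The modulus is exp(-x Im z): on the line Im z = \<gamma> the transform of X is the
  Fourier transform of its law tilted by exp(-\<gamma>X).\<close>

abbreviation iexpz :: "complex \<Rightarrow> real \<Rightarrow> complex" where
  "iexpz z x \<equiv> exp (\<i> * z * of_real x)"

lemma integrable_one_plus_abs_powr:
  fixes p :: real
  assumes "p > 1"
  shows "integrable lborel (\<lambda>t. decay p t)"
proof -
  have "((\<lambda>x. x powr (- p)) has_integral - (1 powr (- p + 1)) / (- p + 1)) {1..}"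
    using assms by (intro has_integral_powr_to_inf) auto
  then have "(\<lambda>x. x powr (- p)) absolutely_integrable_on {1..}"
    by (intro nonnegative_absolutely_integrable_1) (auto intro: has_integral_integrable)
  then have 1: "integrable lborel (\<lambda>x. indicator {1..} x * x powr (- p))"
    unfolding set_integrable_def by (subst (asm) integrable_completion) auto
  have 2: "integrable lborel (\<lambda>x. indicator {1..} (1 + x) * (1 + x) powr (- p))"
    using lborel_integrable_real_affine[OF 1, of 1 1] by simp
  have 3: "integrable lborel (\<lambda>x. indicator {1..} (1 - x) * (1 - x) powr (- p))"
    using lborel_integrable_real_affine[OF 1, of "-1" 1] by simp
  show ?thesis
    by (rule Bochner_Integration.integrable_bound[OF Bochner_Integration.integrable_add[OF 2 3]])
       (auto simp: indicator_def)
qed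

text \<open>The smaller of x and y can carry the whole exponent p + r, and the sum covers both
  cases. In contrast to Hoelder's inequality, neither exponent has to be integrable by
  itself.\<close>

lemma mult_powr_le_add_powr:
  fixes x y p r :: real
  assumes "x \<ge> 1" "y \<ge> 1" "p \<ge> 0" "r \<ge> 0"
  shows "x powr (- p) * y powr (- r) \<le> x powr (- (p + r)) + y powr (- (p + r))"
proof (cases "x \<le> y")
  case True
  then have "y powr (- r) \<le> x powr (- r)" using assms by (intro powr_mono2') auto
  then have "x powr (- p) * y powr (- r) \<le> x powr (- p) * x powr (- r)" by (intro mult_left_mono) auto
  also have "\<dots> = x powr (- (p + r))" using assms by (simp flip: powr_add)
  finally show ?thesis by (simp add: add_increasing2)
next
  case False
  then have "x powr (- p) \<le> y powr (- p)" using assms by (intro powr_mono2') auto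
  then have "x powr (- p) * y powr (- r) \<le> y powr (- p) * y powr (- r)" by (intro mult_right_mono) auto
  also have "\<dots> = y powr (- (p + r))" using assms by (simp flip: powr_add)
  finally show ?thesis by (simp add: add_increasing)
qed

text \<open>The two terms of \<open>mult_powr_le_add_powr\<close> have the same integral by
  translation, whence the factor 2 and a bound that is uniform in s.\<close>

lemma
  fixes p r s :: real
  assumes "p \<ge> 0" "r \<ge> 0" "p + r > 1"
  shows integrable_powr_shift: "integrable lborel (\<lambda>t. decay p t * decay r (t - s))"
    and integral_powr_shift_le: "(LINT t|lborel. decay p t * decay r (t - s))
      \<le> 2 * (LINT t|lborel. decay (p + r) t)"
proof -
  have 1: "integrable lborel (\<lambda>t. decay (p + r) t)"
    using integrable_one_plus_abs_powr[of "p + r"] assms by simp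
  have 2: "integrable lborel (\<lambda>t. decay (p + r) (t - s))"
    using lborel_integrable_real_affine[OF 1, of 1 "- s"] by simp
  have 3: "(LINT t|lborel. decay (p + r) (t - s)) = (LINT t|lborel. decay (p + r) t)"
    using lborel_integral_real_affine[of 1 "\<lambda>t. decay (p + r) t" "- s"] by simp
  have le: "decay p t * decay r (t - s) \<le> decay (p + r) t + decay (p + r) (t - s)" for t
    using assms by (intro mult_powr_le_add_powr) auto
  show 4: "integrable lborel (\<lambda>t. decay p t * decay r (t - s))"
    using le by (intro Bochner_Integration.integrable_bound[OF Bochner_Integration.integrable_add[OF 1 2]]) (auto simp: abs_mult)
  have "(LINT t|lborel. decay p t * decay r (t - s)) \<le>
     (LINT t|lborel. decay (p + r) t + decay (p + r) (t - s))"
    using le by (intro integral_mono 1 2 4 Bochner_Integration.integrable_add)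
  also have "\<dots> = 2 * (LINT t|lborel. decay (p + r) t)"
    using 1 2 3 by simp
  finally show "(LINT t|lborel. decay p t * decay r (t - s))
      \<le> 2 * (LINT t|lborel. decay (p + r) t)" .
qed

text \<open>Peetre's inequality: a weight in s is paid for by one in t and one in t - s. It passes
  the decay of a density on one line to its Cauchy integral on another.\<close>

lemma one_plus_abs_le_mult: "1 + \<bar>s\<bar> \<le> (1 + \<bar>t\<bar>) * (1 + \<bar>t - s\<bar>)" for s t :: real
proof -
  have "1 + \<bar>s\<bar> \<le> 1 + \<bar>t\<bar> + \<bar>t - s\<bar>" by linarith
  also have "\<dots> \<le> (1 + \<bar>t\<bar>) * (1 + \<bar>t - s\<bar>)" by (simp add: algebra_simps)
  finally show ?thesis .
qed

section \<open>Analytic functions on half planes\<close>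

text \<open>The two open half planes overlap and cover the plane, so f and g are pieces of one
  entire function; the bounds on the closed upper and lower half planes already cover it
  too.\<close>

lemma liouville_glue:
  fixes f g :: "complex \<Rightarrow> complex"
  assumes ab: "a < 0" "0 < b"
    and f: "f holomorphic_on {z. a < Im z}" and g: "g holomorphic_on {z. Im z < b}"
    and eq: "\<And>z. a < Im z \<Longrightarrow> Im z < b \<Longrightarrow> f z = g z"
    and bf: "\<And>z. Im z \<ge> 0 \<Longrightarrow> norm (f z) \<le> B" and bg: "\<And>z. Im z \<le> 0 \<Longrightarrow> norm (g z) \<le> C"
  obtains c where "\<And>z. a < Im z \<Longrightarrow> f z = c" "\<And>z. Im z < b \<Longrightarrow> g z = c"
proof -
  define h where "h z = (if a < Im z then f z else g z)" for z
  have hg: "h z = g z" if "Im z < b" for z using that eq by (auto simp: h_def)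
  have "h holomorphic_on {z. a < Im z}" using f by (rule holomorphic_transform) (auto simp: h_def)
  moreover have "h holomorphic_on {z. Im z < b}" using g by (rule holomorphic_transform) (auto simp: hg)
  moreover have "open {z. a < Im z}" "open {z. Im z < b}"
    by (auto intro!: open_Collect_less continuous_intros)
  ultimately have "h holomorphic_on {z. a < Im z} \<union> {z. Im z < b}" by (intro holomorphic_on_Un)
  moreover have "{z. a < Im z} \<union> {z. Im z < b} = UNIV" using ab by auto
  ultimately have "h holomorphic_on UNIV" by simp
  moreover have "norm (h z) \<le> max B C" for z
  proof (cases "Im z \<ge> 0")
    case True
    then show ?thesis using bf[of z] ab by (auto simp: h_def)
  next
    case False
    then show ?thesis using bg[of z] hg[of z] ab by auto
  qed
  ultimately have "h constant_on UNIV" by (intro Liouville_theorem) (auto simp: bounded_iff)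
  then obtain c where c: "\<And>z. h z = c" by (auto simp: constant_on_def)
  show ?thesis
  proof (rule that)
    show "f z = c" if "a < Im z" for z using that c[of z] by (simp add: h_def)
    show "g z = c" if "Im z < b" for z using hg[OF that] c[of z] by simp
  qed
qed

text \<open>Around z0 the exponential is expanded in powers of z - z0 and integrated term by term,
  which exhibits a power series. The domination uses integrability at the two points z0 + ir and z0
  - ir, where r is the radius of a closed disc in S.\<close>

lemma integral_exp_holomorphic:
  fixes W :: "'a \<Rightarrow> complex" and X :: "'a \<Rightarrow> real"
  assumes S: "open S" and X[measurable]: "X \<in> borel_measurable M" and W[measurable]: "W \<in> borel_measurable M"
    and int: "\<And>z. z \<in> S \<Longrightarrow> integrable M (\<lambda>w. W w * iexpz z (X w))"
  shows "(\<lambda>z. LINT w|M. W w * iexpz z (X w)) holomorphic_on S"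
proof -
  have "\<exists>r>0. (\<lambda>z. LINT w|M. W w * iexpz z (X w)) holomorphic_on ball z0 r" if z0: "z0 \<in> S" for z0
  proof -
    obtain r where r: "r > 0" "cball z0 r \<subseteq> S" using S z0 open_contains_cball by blast
    have "((\<lambda>n. (LINT w|M. W w * iexpz z0 (X w) * (\<i> * of_real (X w)) ^ n / fact n) * (z - z0) ^ n) sums
        (LINT w|M. W w * iexpz z (X w)))" if z: "z \<in> ball z0 r" for z
    proof -
      define f where "f n w = W w * iexpz z0 (X w) * ((\<i> * of_real (X w) * (z - z0)) ^ n / fact n)" for n w
      have [measurable]: "f n \<in> borel_measurable M" for n unfolding f_def by measurable
      \<comment> \<open>Moving z0 vertically by r multiplies the modulus of the integrand by
        exp(-rX) or exp(rX); the sum of the two dominates exp(r|X|), hence the sum of the moduli of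
        all terms on the disc.\<close>
      define u where "u w = norm (W w * exp (\<i> * (z0 + \<i> * of_real r) * of_real (X w))) + norm (W w * exp (\<i> * (z0 - \<i> * of_real r) * of_real (X w)))" for w
      have u: "integrable M u"
        unfolding u_def using r by (intro Bochner_Integration.integrable_add integrable_norm int) (auto simp: dist_norm norm_mult)
      have f_sums: "(\<lambda>n. f n w) sums (W w * iexpz z (X w))" for w
      proof -
        have "(\<lambda>n. (\<i> * of_real (X w) * (z - z0)) ^ n / fact n) sums exp (\<i> * of_real (X w) * (z - z0))"
          using exp_converges[of "\<i> * of_real (X w) * (z - z0)"] by (simp add: scaleR_conv_of_real divide_inverse mult_ac)
        from sums_mult[OF this, of "W w * iexpz z0 (X w)"] show ?thesis
          by (simp add: f_def mult.assoc flip: exp_add) (simp add: algebra_simps)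
      qed
      have nf_sums: "(\<lambda>n. norm (f n w)) sums (norm (W w * iexpz z0 (X w)) * exp (\<bar>X w\<bar> * norm (z - z0)))" for w
      proof -
        have "(\<lambda>n. (\<bar>X w\<bar> * norm (z - z0)) ^ n / fact n) sums exp (\<bar>X w\<bar> * norm (z - z0))"
          using exp_converges[of "\<bar>X w\<bar> * norm (z - z0)"] by (simp add: divide_inverse mult_ac)
        from sums_mult[OF this, of "norm (W w * iexpz z0 (X w))"] show ?thesis
          by (simp add: f_def norm_mult norm_divide norm_power)
      qed
      have nf_le: "norm (W w * iexpz z0 (X w)) * exp (\<bar>X w\<bar> * norm (z - z0)) \<le> u w" for w
      proof -
        have "\<bar>X w\<bar> * norm (z - z0) \<le> \<bar>X w\<bar> * r"
          using z by (intro mult_left_mono) (auto simp: dist_norm norm_minus_commute)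
        then have "norm (W w * iexpz z0 (X w)) * exp (\<bar>X w\<bar> * norm (z - z0)) \<le>
           norm (W w) * (exp (- Im z0 * X w) * exp (\<bar>X w\<bar> * r))"
          by (simp add: norm_mult mult.assoc mult_left_mono)
        also have "\<dots> \<le> norm (W w) * (exp (- Im z0 * X w) * (exp (X w * r) + exp (- X w * r)))"
          by (intro mult_left_mono) (auto simp: abs_if)
        also have "\<dots> = u w"
          by (simp add: u_def norm_mult algebra_simps exp_add[symmetric])
        finally show ?thesis .
      qed
      have f_int: "integrable M (f n)" for n
      proof (rule Bochner_Integration.integrable_bound[OF u])
        have "norm (f n w) \<le> norm (u w)" for w
        proof -
          have "norm (f n w) \<le> norm (W w * iexpz z0 (X w)) * exp (\<bar>X w\<bar> * norm (z - z0))"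
            by (rule sums_le[OF _ sums_single[of n "\<lambda>n. norm (f n w)"] nf_sums]) auto
          also have "\<dots> \<le> norm (u w)" using nf_le[of w] by (auto simp: u_def)
          finally show ?thesis .
        qed
        then show "AE w in M. norm (f n w) \<le> norm (u w)" by simp
      qed simp
      have "summable (\<lambda>n. LINT w|M. norm (f n w))"
      proof (rule summableI_nonneg_bounded)
        fix n
        have "(\<Sum>i<n. LINT w|M. norm (f i w)) = (LINT w|M. (\<Sum>i<n. norm (f i w)))"
          using f_int by (subst Bochner_Integration.integral_sum) auto
        also have "\<dots> \<le> (LINT w|M. u w)"
        proof (rule integral_mono[OF _ u])
          show "(\<Sum>i<n. norm (f i w)) \<le> u w" for w
            using sum_le_suminf[OF sums_summable[OF nf_sums[of w]], of "{..<n}"] nf_le[of w] sums_unique[OF nf_sums[of w]] by auto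
        qed (use f_int in auto)
        finally show "(\<Sum>i<n. LINT w|M. norm (f i w)) \<le> (LINT w|M. u w)" .
      qed auto
      then have "(\<lambda>n. LINT w|M. f n w) sums (LINT w|M. (\<Sum>n. f n w))"
        using f_int nf_sums by (intro sums_integral) (auto intro: sums_summable)
      moreover have "(LINT w|M. (\<Sum>n. f n w)) = (LINT w|M. W w * iexpz z (X w))"
        using f_sums by (intro Bochner_Integration.integral_cong refl) (auto simp: sums_iff)
      moreover have "(LINT w|M. f n w) = (LINT w|M. W w * iexpz z0 (X w) * (\<i> * of_real (X w)) ^ n / fact n) * (z - z0) ^ n" for n
      proof -
        have "f n w = W w * iexpz z0 (X w) * (\<i> * of_real (X w)) ^ n / fact n * (z - z0) ^ n" for w
          by (simp add: f_def power_mult_distrib)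
        then show ?thesis by (simp only: integral_mult_left_zero)
      qed
      ultimately show ?thesis by simp
    qed
    from power_series_holomorphic[OF this] r show ?thesis by blast
  qed
  then show ?thesis
    by (metis (no_types, lifting) S centre_in_ball field_differentiable_at_within holomorphic_on_def
        holomorphic_on_imp_differentiable_at open_ball)
qed

section \<open>Random walk stopped at an independent geometric time\<close>

lemma Phi_imaginary: "Phi M Y (\<i> * of_real \<gamma>) = of_real (LINT w|M. exp (- \<gamma> * Y 0 w))"
proof -
  have "exp (\<i> * (\<i> * complex_of_real \<gamma>) * complex_of_real (Y 0 w)) = of_real (exp (- \<gamma> * Y 0 w))" for w
    by (simp add: exp_of_real[symmetric] mult.assoc[symmetric] del: exp_of_real)
  then show ?thesis unfolding Phi_def by (simp only: integral_complex_of_real)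
qed

text \<open>The assumptions are closed under replacing Y by -Y and the strip by its mirror image, so
  results for the maximum transfer to the minimum. Condition (ii) enters as a power bound on each
  single line, with 1 + |t| so that it holds near the origin as well;
  \<open>\<delta> \<le> 1\<close> is arranged by lowering the exponent.\<close>

locale geometric_walk = prob_space M for M :: "'a measure" +
  fixes Y :: "nat \<Rightarrow> 'a \<Rightarrow> real" and T :: "'a \<Rightarrow> nat" and q \<mu>m \<mu>p \<delta> :: real
  assumes indep: "indep_vars (\<lambda>_. borel) Y UNIV"
    and ident: "\<And>n. distr M borel (Y n) = distr M borel (Y 0)"
    and q: "0 < q" "q < 1"
    and geometric: "indep_geometric_time M Y q T"
    and mu: "\<mu>m < 0" "0 < \<mu>p"
    and mgf_integrable: "\<And>\<gamma>. \<mu>m \<le> \<gamma> \<Longrightarrow> \<gamma> \<le> \<mu>p \<Longrightarrow> integrable M (\<lambda>w. exp (- \<gamma> * Y 0 w))"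
    and mgf_less: "\<And>\<gamma>. \<mu>m \<le> \<gamma> \<Longrightarrow> \<gamma> \<le> \<mu>p \<Longrightarrow> q * (LINT w|M. exp (- \<gamma> * Y 0 w)) < 1"
    and delta: "0 < \<delta>" "\<delta> \<le> 1"
    and Phi_decay: "\<And>\<gamma>. \<mu>m \<le> \<gamma> \<Longrightarrow> \<gamma> \<le> \<mu>p \<Longrightarrow>
      \<exists>C. \<forall>t. norm (Phi M Y (Complex t \<gamma>)) \<le> C * decay \<delta> t"
begin

text \<open>The sigma-algebra of the whole path. Its sets are the second family in
  \<open>indep_geometric_time\<close>, so measurability with respect to it is what makes a path
  functional independent of T.\<close>

definition walk_algebra :: "'a measure" where
  "walk_algebra = vimage_algebra (space M) (\<lambda>w n. walk Y n w) (Pi\<^sub>M UNIV (\<lambda>_. borel))"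

abbreviation excess :: "nat \<Rightarrow> 'a \<Rightarrow> real" where
  "excess n w \<equiv> walk Y n w - walk_max Y n w"

lemma Y_measurable[measurable]: "Y n \<in> borel_measurable M"
  using indep by (auto simp: indep_vars_def)

lemma walk_measurable[measurable]: "walk Y n \<in> borel_measurable M"
  unfolding walk_def by measurable

lemma walk_max_measurable[measurable]: "walk_max Y n \<in> borel_measurable M"
  unfolding walk_max_def by measurable

lemma T_measurable[measurable]: "T \<in> measurable M (count_space UNIV)"
  using geometric by (simp add: indep_geometric_time_def)

lemma measurable_T: "(\<lambda>w. f (T w)) \<in> borel_measurable M"
  by (rule measurable_compose[OF T_measurable]) simp

lemma prob_T: "prob {w \<in> space M. T w = n} = (1 - q) * q ^ n"
  using geometric by (simp add: indep_geometric_time_def)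

lemma sets_walk_algebra:
  "sets walk_algebra = {(\<lambda>w n. walk Y n w) -` B \<inter> space M | B. B \<in> sets (Pi\<^sub>M UNIV (\<lambda>_. borel))}"
  unfolding walk_algebra_def by (subst sets_vimage_algebra2) (auto simp: space_PiM)

lemma space_walk_algebra[simp]: "space walk_algebra = space M"
  by (simp add: walk_algebra_def)

lemma subalgebra_walk_algebra: "subalgebra M walk_algebra"
  using geometric unfolding subalgebra_def sets_walk_algebra indep_geometric_time_def indep_sets2_eq by simp

lemma measurable_walk_algebra_imp: "f \<in> borel_measurable walk_algebra \<Longrightarrow> f \<in> borel_measurable M"
  by (rule measurable_from_subalg[OF subalgebra_walk_algebra])

lemma walk_measurable'[measurable]: "walk Y n \<in> borel_measurable walk_algebra"
proof -
  have "(\<lambda>w n. walk Y n w) \<in> measurable walk_algebra (Pi\<^sub>M UNIV (\<lambda>_. borel))"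
    unfolding walk_algebra_def by (rule measurable_vimage_algebra1) (auto simp: space_PiM)
  from measurable_compose[OF this measurable_component_singleton[of n]] show ?thesis by simp
qed

lemma walk_max_measurable'[measurable]: "walk_max Y n \<in> borel_measurable walk_algebra"
  unfolding walk_max_def by measurable

lemma integral_indicator_T_mult:
  fixes G :: "'a \<Rightarrow> complex"
  assumes G: "G \<in> borel_measurable walk_algebra" "integrable M G"
  shows "(LINT w|M. indicator {n} (T w) * G w) = of_real ((1 - q) * q ^ n) * (LINT w|M. G w)"
proof -
  note [measurable] = measurable_walk_algebra_imp[OF G(1)]
  \<comment> \<open>The event T = n enters as a complex-valued indicator, so that both independent
    variables have the same value type.\<close>
  define I where "I w = (indicator {n} (T w) :: complex)" for w
  have I_meas[measurable]: "I \<in> borel_measurable M" unfolding I_def by (rule measurable_T)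
  have I_eq: "I w = of_real (indicator {w \<in> space M. T w = n} w)" if "w \<in> space M" for w
    using that by (auto simp: I_def indicator_def)
  have I_int: "integrable M I"
    by (rule integrable_const_bound[of _ 1]) (auto simp: I_def indicator_def)
  have "indep_set {T -` A \<inter> space M | A. A \<in> sets (count_space UNIV)} (sets walk_algebra)"
    using geometric by (simp add: indep_geometric_time_def sets_walk_algebra)
  then have "indep_set (sigma_sets (space M) {I -` A \<inter> space M | A. A \<in> sets borel})
     (sigma_sets (space M) {G -` A \<inter> space M | A. A \<in> sets borel})"
    unfolding indep_set_def
  proof (rule indep_sets_mono_sets)
    fix i :: bool
    have T: "{T -` A \<inter> space M | A. A \<in> sets (count_space UNIV)} = sets (vimage_algebra (space M) T (count_space UNIV))"
      by (subst sets_vimage_algebra2) auto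
    have "\<exists>B. I -` A \<inter> space M = T -` B \<inter> space M" for A
      by (rule exI[of _ "{m. (indicator {n} m :: complex) \<in> A}"]) (auto simp: I_def)
    then have "sigma_sets (space M) {I -` A \<inter> space M | A. A \<in> sets borel} \<subseteq>
       {T -` A \<inter> space M | A. A \<in> sets (count_space UNIV)}"
      unfolding T by (intro sets.sigma_sets_subset[of _ "vimage_algebra (space M) T (count_space UNIV)", simplified]) (auto simp: T[symmetric])
    moreover have "sigma_sets (space M) {G -` A \<inter> space M | A. A \<in> sets borel} \<subseteq> sets walk_algebra"
      using measurable_sets[OF G(1)]
      by (intro sets.sigma_sets_subset[of _ walk_algebra, simplified]) auto
    ultimately show "case_bool (sigma_sets (space M) {I -` A \<inter> space M |A. A \<in> sets borel})
         (sigma_sets (space M) {G -` A \<inter> space M |A. A \<in> sets borel}) i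
       \<subseteq> case_bool {T -` A \<inter> space M |A. A \<in> sets (count_space UNIV)} (sets walk_algebra) i"
      by (cases i) auto
  qed
  then have "indep_var borel I borel G"
    unfolding indep_var_eq by simp
  from indep_var_lebesgue_integral[OF this I_int G(2)]
  have "(LINT w|M. I w * G w) = (LINT w|M. I w) * (LINT w|M. G w)" .
  also have "(LINT w|M. I w) = (LINT w|M. of_real (indicator {w \<in> space M. T w = n} w))"
    by (intro Bochner_Integration.integral_cong refl I_eq)
  also have "\<dots> = of_real ((1 - q) * q ^ n)"
    by (simp add: prob_T)
  finally show ?thesis by (simp add: I_def)
qed

text \<open>For every w only the term n = T w of the sum of 1{T = n} G n survives, and by
  independence each term has expectation (1 - q) q^n E[G n]. Summability of the expected norms
  justifies the exchange of sum and integral. A power series in q thereby becomes one expectation,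
  to which analyticity and dominated convergence apply.\<close>

lemma
  fixes G :: "nat \<Rightarrow> 'a \<Rightarrow> complex"
  assumes G: "\<And>n. G n \<in> borel_measurable walk_algebra" "\<And>n. integrable M (G n)"
    and summable: "summable (\<lambda>n. q ^ n * (LINT w|M. norm (G n w)))"
  shows integrable_at_T: "integrable M (\<lambda>w. G (T w) w)"
    and sums_at_T: "(\<lambda>n. of_real ((1 - q) * q ^ n) * (LINT w|M. G n w)) sums (LINT w|M. G (T w) w)"
proof -
  note [measurable] = measurable_walk_algebra_imp[OF G(1)]
  define f where "f n w = indicator {n} (T w) * G n w" for n w
  have [measurable]: "f n \<in> borel_measurable M" for n
    unfolding f_def by (intro borel_measurable_times measurable_T) simp
  have f_int: "integrable M (f n)" for n
    by (rule Bochner_Integration.integrable_bound[OF G(2)[of n]]) (auto simp: f_def indicator_def)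
  have fin: "finite {n. f n w \<noteq> 0}" for w
    by (rule finite_subset[of _ "{T w}"]) (auto simp: f_def indicator_def split: if_splits)
  have f_sums: "(\<lambda>n. f n w) sums G (T w) w" for w
    using sums_finite[of "{T w}" "\<lambda>n. f n w"] by (auto simp: f_def)
  have nf: "(LINT w|M. norm (f n w)) = (1 - q) * (q ^ n * (LINT w|M. norm (G n w)))" for n
  proof -
    have [measurable]: "(\<lambda>w. complex_of_real (norm (G n w))) \<in> borel_measurable walk_algebra"
      using G(1)[of n] by measurable
    have "complex_of_real (LINT w|M. norm (f n w)) = (LINT w|M. indicator {n} (T w) * of_real (norm (G n w)))"
      by (subst integral_complex_of_real[symmetric], intro Bochner_Integration.integral_cong refl)
         (auto simp: f_def norm_mult indicator_def)
    also have "\<dots> = of_real ((1 - q) * q ^ n) * (LINT w|M. of_real (norm (G n w)))"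
      by (rule integral_indicator_T_mult) (use G(2)[of n] in auto)
    also have "\<dots> = of_real ((1 - q) * (q ^ n * (LINT w|M. norm (G n w))))"
      by (simp add: mult.assoc)
    finally show ?thesis by (simp only: of_real_eq_iff)
  qed
  have 1: "AE w in M. summable (\<lambda>n. norm (f n w))"
    by (intro AE_I2 summable_finite[OF fin]) auto
  have 2: "summable (\<lambda>n. LINT w|M. norm (f n w))"
    unfolding nf by (rule summable_mult[OF summable])
  have s: "(\<lambda>w. \<Sum>n. f n w) = (\<lambda>w. G (T w) w)" using f_sums by (auto simp: sums_iff)
  show "integrable M (\<lambda>w. G (T w) w)"
    using integrable_suminf[OF f_int 1 2] s by simp
  show "(\<lambda>n. of_real ((1 - q) * q ^ n) * (LINT w|M. G n w)) sums (LINT w|M. G (T w) w)"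
    using sums_integral[OF f_int 1 2] unfolding s
    by (simp only: f_def integral_indicator_T_mult[OF G])
qed

section \<open>Exponential moments of the walk, its maximum and its excess\<close>

definition mgf :: "real \<Rightarrow> real" where
  "mgf \<gamma> = (LINT w|M. exp (- \<gamma> * Y 0 w))"

lemma mgf_nonneg: "0 \<le> mgf \<gamma>"
  unfolding mgf_def by (rule Bochner_Integration.integral_nonneg) simp

lemma q_mgf_less: "\<mu>m \<le> \<gamma> \<Longrightarrow> \<gamma> \<le> \<mu>p \<Longrightarrow> q * mgf \<gamma> < 1"
  using mgf_less by (simp add: mgf_def)

lemma norm_Phi_le: "norm (Phi M Y z) \<le> mgf (Im z)"
  unfolding Phi_def mgf_def by (rule order_trans[OF integral_norm_bound]) simp

lemma
  assumes "\<mu>m \<le> Im z" "Im z \<le> \<mu>p"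
  shows integrable_exp_Y: "integrable M (\<lambda>w. iexpz z (Y n w))"
    and integral_exp_Y: "(LINT w|M. iexpz z (Y n w)) = Phi M Y z"
proof -
  define g where "g y = exp (\<i> * z * complex_of_real y)" for y :: real
  have [measurable]: "g \<in> borel_measurable borel" unfolding g_def by measurable
  have "integrable M (\<lambda>w. g (Y 0 w))"
    unfolding g_def
    by (rule Bochner_Integration.integrable_bound[OF mgf_integrable[OF assms]]) auto
  then have "integrable (distr M borel (Y n)) g"
    unfolding ident[of n] by (subst integrable_distr_eq) auto
  then show "integrable M (\<lambda>w. iexpz z (Y n w))"
    by (subst (asm) integrable_distr_eq) (auto simp: g_def)
  have "(LINT w|M. g (Y n w)) = integral\<^sup>L (distr M borel (Y n)) g"
    by (subst integral_distr) auto
  also have "\<dots> = (LINT w|M. g (Y 0 w))"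
    unfolding ident[of n] by (subst integral_distr) auto
  finally show "(LINT w|M. iexpz z (Y n w)) = Phi M Y z"
    by (simp add: g_def Phi_def)
qed

text \<open>The transform argument may change from one increment to the next, so that the increments
  before and after a given time can be weighted differently.\<close>

lemma
  assumes "\<And>i. \<mu>m \<le> Im (z i)" "\<And>i. Im (z i) \<le> \<mu>p"
  shows integrable_prod_exp_Y: "integrable M (\<lambda>w. \<Prod>i=1..n. exp (\<i> * z i * of_real (Y i w)))"
    and integral_prod_exp_Y: "(LINT w|M. (\<Prod>i=1..n. exp (\<i> * z i * of_real (Y i w)))) = (\<Prod>i=1..n. Phi M Y (z i))"
proof -
  have "indep_vars (\<lambda>_. borel) (\<lambda>i w. exp (\<i> * z i * of_real (Y i w))) {1..n}"
    by (rule indep_vars_compose2[OF indep_vars_subset[OF indep subset_UNIV]]) measurable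
  then show "integrable M (\<lambda>w. \<Prod>i=1..n. exp (\<i> * z i * of_real (Y i w)))"
    "(LINT w|M. (\<Prod>i=1..n. exp (\<i> * z i * of_real (Y i w)))) = (\<Prod>i=1..n. Phi M Y (z i))"
    using integrable_exp_Y[OF assms] integral_exp_Y[OF assms]
    by (auto simp: indep_vars_lebesgue_integral intro!: indep_vars_integrable)
qed

lemma walk_0[simp]: "walk Y 0 w = 0" and walk_Suc: "walk Y (Suc n) w = walk Y n w + Y (Suc n) w"
  by (simp_all add: walk_def)

lemma walk_max_0[simp]: "walk_max Y 0 w = 0"
  by (simp add: walk_max_def)

lemma walk_max_Suc: "walk_max Y (Suc n) w = max (walk_max Y n w) (walk Y (Suc n) w)"
proof -
  have "(\<lambda>m. walk Y m w) ` {0..Suc n} = insert (walk Y (Suc n) w) ((\<lambda>m. walk Y m w) ` {0..n})"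
    by (auto simp: atLeastAtMostSuc_conv)
  then show ?thesis by (simp add: walk_max_def max.commute)
qed

lemma walk_max_nonneg: "0 \<le> walk_max Y n w"
  by (induction n) (auto simp: walk_max_Suc)

lemma excess_nonpos: "excess n w \<le> 0"
  by (cases n) (auto simp: walk_max_Suc)

lemma walk_max_attained: "\<exists>k\<le>n. walk_max Y n w = walk Y k w"
proof -
  have "walk_max Y n w \<in> (\<lambda>m. walk Y m w) ` {0..n}" unfolding walk_max_def by (rule Max_in) auto
  then show ?thesis by auto
qed

lemma integral_exp_walk:
  assumes "\<mu>m \<le> Im z" "Im z \<le> \<mu>p"
  shows "(LINT w|M. iexpz z (walk Y n w)) = Phi M Y z ^ n"
proof -
  have "(\<Prod>i=1..n. iexpz z (Y i w)) = iexpz z (walk Y n w)" for w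
    by (simp add: walk_def exp_sum[symmetric] sum_distrib_left)
  then show ?thesis using integral_prod_exp_Y[of "\<lambda>_. z" n] assms by auto
qed

text \<open>Here k is a candidate for the time of the maximum: the first k increments get the tilt
  of the maximum, the others that of the excess, and independence factorizes the
  expectation.\<close>

lemma
  assumes "\<mu>m \<le> a" "a \<le> \<mu>p" "\<mu>m \<le> b" "b \<le> \<mu>p" "k \<le> n"
  shows integrable_exp_split_walk: "integrable M (\<lambda>w. exp (- a * walk Y k w - b * (walk Y n w - walk Y k w)))"
    and integral_exp_split_walk: "(LINT w|M. exp (- a * walk Y k w - b * (walk Y n w - walk Y k w))) = mgf a ^ k * mgf b ^ (n - k)"
proof -
  define z where "z i = \<i> * complex_of_real (if i \<le> k then a else b)" for i
  have e: "(\<Prod>i=1..n. exp (\<i> * z i * of_real (Y i w))) =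
     of_real (exp (- a * walk Y k w - b * (walk Y n w - walk Y k w)))" for w
  proof -
    have split: "{1..n} = {1..k} \<union> {k+1..n}" using assms(5) by auto
    have "(\<Prod>i=1..n. exp (\<i> * z i * of_real (Y i w))) = of_real (exp (\<Sum>i=1..n. - (if i \<le> k then a else b) * Y i w))"
      by (simp add: exp_sum[symmetric] z_def flip: exp_of_real)
    also have "(\<Sum>i=1..n. - (if i \<le> k then a else b) * Y i w) = (\<Sum>i=1..k. - a * Y i w) + (\<Sum>i=k+1..n. - b * Y i w)"
      unfolding split by (subst sum.union_disjoint) auto
    also have "\<dots> = - a * walk Y k w - b * (\<Sum>i=k+1..n. Y i w)"
      by (simp add: walk_def sum_distrib_left sum_negf)
    also have "(\<Sum>i=k+1..n. Y i w) = walk Y n w - walk Y k w"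
      unfolding walk_def split by (subst sum.union_disjoint) auto
    finally show ?thesis .
  qed
  have z: "\<mu>m \<le> Im (z i)" "Im (z i) \<le> \<mu>p" for i using assms by (auto simp: z_def)
  show "integrable M (\<lambda>w. exp (- a * walk Y k w - b * (walk Y n w - walk Y k w)))"
    using integrable_prod_exp_Y[of z n] z unfolding e by (simp only: complex_of_real_integrable_eq)
  have "(\<Prod>i=1..n. Phi M Y (z i)) = (\<Prod>i=1..k. Phi M Y (z i)) * (\<Prod>i=k+1..n. Phi M Y (z i))"
    using assms(5) by (subst prod.union_disjoint[symmetric]) (auto intro!: prod.cong)
  also have "\<dots> = (\<Prod>i=1..k. of_real (mgf a)) * (\<Prod>i=k+1..n. of_real (mgf b))"
    by (intro arg_cong2[where f = "(*)"] prod.cong) (auto simp: z_def Phi_imaginary mgf_def)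
  also have "\<dots> = of_real (mgf a ^ k * mgf b ^ (n - k))" by simp
  finally have "complex_of_real (LINT w|M. exp (- a * walk Y k w - b * (walk Y n w - walk Y k w))) = of_real (mgf a ^ k * mgf b ^ (n - k))"
    using integral_prod_exp_Y[of z n] z unfolding e by (simp only: integral_complex_of_real)
  then show "(LINT w|M. exp (- a * walk Y k w - b * (walk Y n w - walk Y k w))) = mgf a ^ k * mgf b ^ (n - k)"
    by (simp only: of_real_eq_iff)
qed

text \<open>The time at which the maximum is attained is random, so the exponential is bounded by
  the sum \<open>env\<close> over all k up to n. The q-series of its expectations is the Cauchy
  product of the geometric series with ratios q mgf(a') and q mgf(b'), both below 1 by condition
  (i).\<close>

lemma
  assumes "\<mu>m \<le> a" "b \<le> \<mu>p"
  shows integrable_exp_max_excess: "integrable M (\<lambda>w. exp (- a * walk_max Y n w - b * excess n w))"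
    and summable_exp_max_excess: "summable (\<lambda>n. q ^ n * (LINT w|M. exp (- a * walk_max Y n w - b * excess n w)))"
proof -
  \<comment> \<open>As the maximum is nonnegative and the excess nonpositive, these replacements
    only enlarge the exponential. They bring both tilts into the interval from \<mu>m to \<mu>p
    although a is bounded only below and b only above.\<close>
  define a' b' where "a' = min a 0" and "b' = max b 0"
  have ab: "\<mu>m \<le> a'" "a' \<le> \<mu>p" "\<mu>m \<le> b'" "b' \<le> \<mu>p" using assms mu by (auto simp: a'_def b'_def)
  define env where "env n w = (\<Sum>k\<le>n. exp (- a' * walk Y k w - b' * (walk Y n w - walk Y k w)))" for n w
  have env_int: "integrable M (env n)" for n
    unfolding env_def using ab by (intro Bochner_Integration.integrable_sum integrable_exp_split_walk) auto
  have env_eq: "(LINT w|M. env n w) = (\<Sum>k\<le>n. mgf a' ^ k * mgf b' ^ (n - k))" for n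
  proof -
    have "(LINT w|M. env n w) = (\<Sum>k\<le>n. LINT w|M. exp (- a' * walk Y k w - b' * (walk Y n w - walk Y k w)))"
      unfolding env_def using ab by (intro Bochner_Integration.integral_sum integrable_exp_split_walk) auto
    also have "\<dots> = (\<Sum>k\<le>n. mgf a' ^ k * mgf b' ^ (n - k))"
      using ab by (intro sum.cong refl integral_exp_split_walk) auto
    finally show ?thesis .
  qed
  have le: "exp (- a * walk_max Y n w - b * excess n w) \<le> env n w" for n w
  proof -
    obtain k where k: "k \<le> n" "walk_max Y n w = walk Y k w" using walk_max_attained by blast
    have "a' * walk_max Y n w \<le> a * walk_max Y n w" "b * - excess n w \<le> b' * - excess n w"
      using walk_max_nonneg[of n w] excess_nonpos[of n w] by (auto simp: a'_def b'_def intro!: mult_right_mono)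
    then have "exp (- a * walk_max Y n w - b * excess n w) \<le> exp (- a' * walk_max Y n w - b' * excess n w)"
      by (simp add: algebra_simps)
    also have "\<dots> = exp (- a' * walk Y k w - b' * (walk Y n w - walk Y k w))" using k by simp
    also have "\<dots> \<le> env n w" unfolding env_def
      using k by (intro member_le_sum) auto
    finally show ?thesis .
  qed
  have norm_le: "norm (exp (- a * walk_max Y n w - b * excess n w)) \<le> norm (env n w)" for n w
    using order_trans[OF le abs_ge_self] by (simp only: real_norm_def abs_exp_cancel)
  show int: "integrable M (\<lambda>w. exp (- a * walk_max Y n w - b * excess n w))" for n
    by (rule Bochner_Integration.integrable_bound[OF env_int[of n]]) (measurable, intro AE_I2 norm_le)
  have "summable (\<lambda>k. \<Sum>i\<le>k. (q * mgf a') ^ i * (q * mgf b') ^ (k - i))"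
    using q q_mgf_less ab mgf_nonneg by (intro summable_Cauchy_product) auto
  also have "(\<lambda>k. \<Sum>i\<le>k. (q * mgf a') ^ i * (q * mgf b') ^ (k - i)) = (\<lambda>n. q ^ n * (LINT w|M. env n w))"
  proof
    fix n
    have "(q * mgf a') ^ i * (q * mgf b') ^ (n - i) = q ^ n * (mgf a' ^ i * mgf b' ^ (n - i))" if "i \<le> n" for i
    proof -
      have "q ^ n = q ^ i * q ^ (n - i)" using that by (simp flip: power_add)
      then show ?thesis by (simp add: power_mult_distrib)
    qed
    then show "(\<Sum>i\<le>n. (q * mgf a') ^ i * (q * mgf b') ^ (n - i)) = q ^ n * (LINT w|M. env n w)"
      unfolding env_eq by (simp add: sum_distrib_left)
  qed
  finally have s: "summable (\<lambda>n. q ^ n * (LINT w|M. env n w))" .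
  show "summable (\<lambda>n. q ^ n * (LINT w|M. exp (- a * walk_max Y n w - b * excess n w)))"
  proof (rule summable_comparison_test'[OF s])
    fix n
    have "(LINT w|M. exp (- a * walk_max Y n w - b * excess n w)) \<le> (LINT w|M. env n w)"
      by (intro integral_mono int env_int le)
    then show "norm (q ^ n * (LINT w|M. exp (- a * walk_max Y n w - b * excess n w))) \<le> q ^ n * (LINT w|M. env n w)"
      using q by (auto simp: abs_mult integral_nonneg intro!: mult_left_mono)
  qed
qed

text \<open>The offset d allows an envelope taken later than n: it is 1 for the overshoot, which
  looks one step ahead, and 0 elsewhere. Its price is a factor q^(-d) in the series.\<close>

lemma
  fixes G :: "nat \<Rightarrow> 'a \<Rightarrow> complex"
  assumes ab: "\<mu>m \<le> a" "b \<le> \<mu>p"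
    and G: "\<And>n. G n \<in> borel_measurable walk_algebra"
    and le: "\<And>n w. norm (G n w) \<le> exp (- a * walk_max Y (d + n) w - b * excess (d + n) w)"
  shows integrable_at_T_bound: "integrable M (\<lambda>w. G (T w) w)"
    and sums_at_T_bound: "(\<lambda>n. of_real ((1 - q) * q ^ n) * (LINT w|M. G n w)) sums (LINT w|M. G (T w) w)"
    and integrable_G_bound: "integrable M (G n)"
proof -
  have int: "integrable M (G n)" for n
    by (rule Bochner_Integration.integrable_bound[OF integrable_exp_max_excess[OF ab, of "d + n"]])
       (use le measurable_walk_algebra_imp[OF G] in auto)
  have "summable (\<lambda>n. q ^ (n + d) * (LINT w|M. exp (- a * walk_max Y (n + d) w - b * excess (n + d) w)))"
    by (rule summable_ignore_initial_segment[OF summable_exp_max_excess[OF ab]])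
  from summable_mult[OF this, of "1 / q ^ d"]
  have s: "summable (\<lambda>n. q ^ n * (LINT w|M. exp (- a * walk_max Y (d + n) w - b * excess (d + n) w)))"
    using q by (simp add: power_add add.commute)
  have "summable (\<lambda>n. q ^ n * (LINT w|M. norm (G n w)))"
  proof (rule summable_comparison_test'[OF s])
    fix n
    have "(LINT w|M. norm (G n w)) \<le> (LINT w|M. exp (- a * walk_max Y (d + n) w - b * excess (d + n) w))"
      by (intro integral_mono int integrable_norm integrable_exp_max_excess ab le)
    then show "norm (q ^ n * (LINT w|M. norm (G n w))) \<le> q ^ n * (LINT w|M. exp (- a * walk_max Y (d + n) w - b * excess (d + n) w))"
      using q by (auto simp: abs_mult integral_nonneg intro!: mult_left_mono)
  qed
  from integrable_at_T[OF G int this] sums_at_T[OF G int this] int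
  show "integrable M (\<lambda>w. G (T w) w)" "(\<lambda>n. of_real ((1 - q) * q ^ n) * (LINT w|M. G n w)) sums (LINT w|M. G (T w) w)"
    "integrable M (G n)" by auto
qed

end

subsection \<open>Wiener--Hopf factorization\<close>

context geometric_walk begin

abbreviation walk_T :: "'a \<Rightarrow> real" where "walk_T w \<equiv> walk Y (T w) w"

abbreviation max_T :: "'a \<Rightarrow> real" where "max_T w \<equiv> walk_max Y (T w) w"

abbreviation excess_T :: "'a \<Rightarrow> real" where "excess_T w \<equiv> excess (T w) w"

text \<open>
  The series \<open>\<Sum>\<^sub>n q\<^sup>n/n E[exp (\<i>zX\<^sub>n); \<plusminus>X\<^sub>n > 0]\<close> are written as expectations at \<open>T\<close>; the term \<open>n = 0\<close>
  is absent because \<open>inverse 0 = 0\<close>.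
\<close>
definition log_plus :: "complex \<Rightarrow> complex" where
  "log_plus z = 1 / of_real (1 - q) *
     (LINT w|M. of_real (inverse (real (T w)) * indicator {0<..} (walk_T w)) * iexpz z (walk_T w))"

text \<open>The value 0 is counted on this side, so that the two indicators add up to 1 and the two
  transforms to the full one without any argument about atoms.\<close>

definition log_minus :: "complex \<Rightarrow> complex" where
  "log_minus z = 1 / of_real (1 - q) *
     (LINT w|M. of_real (inverse (real (T w)) * indicator {..0} (walk_T w)) * iexpz z (walk_T w))"

definition joint_transform :: "complex \<Rightarrow> complex \<Rightarrow> complex" where
  "joint_transform x z = (LINT w|M. iexpz x (max_T w) * iexpz z (excess_T w))"

text \<open>The walk is inspected one step after T: if that step sets a new record, z is conjugate
  to the amount by which the maximum at T is exceeded. This amount is positive, so the transform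
  continues into the upper half plane in z, whereas that of the excess continues into the lower
  one.\<close>

definition overshoot_transform :: "complex \<Rightarrow> complex \<Rightarrow> complex" where
  "overshoot_transform x z = (LINT w|M. indicator {max_T w<..} (walk Y (Suc (T w)) w) *
      iexpz x (max_T w) * iexpz z (walk Y (Suc (T w)) w - max_T w))"

lemma walk_at_T_measurable[measurable]:
  "(\<lambda>w. walk_T w) \<in> borel_measurable M"
  "(\<lambda>w. walk Y (Suc (T w)) w) \<in> borel_measurable M"
  "(\<lambda>w. max_T w) \<in> borel_measurable M"
  by (rule measurable_compose_countable[OF _ T_measurable], measurable)+

lemma inverse_real_T_measurable[measurable]: "(\<lambda>w. inverse (real (T w))) \<in> borel_measurable M"
  by (rule measurable_T)

lemma inverse_real_nat_le: "inverse (real n) \<le> 1"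
  by (cases n) (auto simp: field_simps)

lemma
  fixes c :: "nat \<Rightarrow> 'a \<Rightarrow> real"
  assumes z: "\<mu>m \<le> Im z" "Im z \<le> \<mu>p"
    and c: "\<And>n. c n \<in> borel_measurable walk_algebra" "\<And>n w. \<bar>c n w\<bar> \<le> 1"
  shows integrable_walk_at_T: "integrable M (\<lambda>w. of_real (c (T w) w) * iexpz z (walk_T w))"
    and sums_walk_at_T: "(\<lambda>n. of_real ((1 - q) * q ^ n) * (LINT w|M. of_real (c n w) * iexpz z (walk Y n w))) sums
        (LINT w|M. of_real (c (T w) w) * iexpz z (walk_T w))"
proof -
  note [measurable] = c(1)
  have 1: "(\<lambda>w. complex_of_real (c n w) * iexpz z (walk Y n w)) \<in> borel_measurable walk_algebra" for n
    by measurable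
  have 2: "norm (complex_of_real (c n w) * iexpz z (walk Y n w)) \<le> exp (- Im z * walk_max Y (0 + n) w - Im z * excess (0 + n) w)" for n w
    using mult_right_mono[OF c(2)[of n w], of "exp (- Im z * walk Y n w)"] by (simp add: norm_mult algebra_simps)
  show "integrable M (\<lambda>w. of_real (c (T w) w) * iexpz z (walk_T w))"
    by (rule integrable_at_T_bound[OF z 1 2])
  show "(\<lambda>n. of_real ((1 - q) * q ^ n) * (LINT w|M. of_real (c n w) * iexpz z (walk Y n w))) sums
        (LINT w|M. of_real (c (T w) w) * iexpz z (walk_T w))"
    by (rule sums_at_T_bound[OF z 1 2])
qed

text \<open>Where the walk is positive, lowering Im z only enlarges the modulus, so Im z may be
  replaced by its minimum with 0, which lies in the strip. Hence a lower bound on Im z is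
  enough.\<close>

lemma integrable_log_plus:
  assumes z: "\<mu>m \<le> Im z"
  shows "integrable M (\<lambda>w. of_real (inverse (real (T w)) * indicator {0<..} (walk_T w)) * iexpz z (walk_T w))"
proof -
  define \<gamma> where "\<gamma> = min (Im z) 0"
  have g: "\<mu>m \<le> \<gamma>" "\<gamma> \<le> \<mu>p" using z mu by (auto simp: \<gamma>_def)
  have "norm (complex_of_real (inverse (real n) * indicator {0<..} (walk Y n w)) * iexpz z (walk Y n w)) \<le>
      exp (- \<gamma> * walk_max Y (0 + n) w - \<gamma> * excess (0 + n) w)" for n w
  proof (cases "walk Y n w > 0")
    case True
    then have "\<gamma> * walk Y n w \<le> Im z * walk Y n w" by (intro mult_right_mono) (auto simp: \<gamma>_def)
    then have "inverse (real n) * exp (- Im z * walk Y n w) \<le> 1 * exp (- \<gamma> * walk Y n w)"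
      by (intro mult_mono inverse_real_nat_le) auto
    then show ?thesis using True by (simp add: norm_mult norm_inverse algebra_simps)
  qed simp
  from integrable_at_T_bound[OF g _ this] show ?thesis by measurable
qed

lemma integrable_log_minus:
  assumes z: "Im z \<le> \<mu>p"
  shows "integrable M (\<lambda>w. of_real (inverse (real (T w)) * indicator {..0} (walk_T w)) * iexpz z (walk_T w))"
proof -
  define \<gamma> where "\<gamma> = max (Im z) 0"
  have g: "\<mu>m \<le> \<gamma>" "\<gamma> \<le> \<mu>p" using z mu by (auto simp: \<gamma>_def)
  have "norm (complex_of_real (inverse (real n) * indicator {..0} (walk Y n w)) * iexpz z (walk Y n w)) \<le>
      exp (- \<gamma> * walk_max Y (0 + n) w - \<gamma> * excess (0 + n) w)" for n w
  proof (cases "walk Y n w \<le> 0")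
    case True
    then have "\<gamma> * walk Y n w \<le> Im z * walk Y n w" by (intro mult_right_mono_neg) (auto simp: \<gamma>_def)
    then have "inverse (real n) * exp (- Im z * walk Y n w) \<le> 1 * exp (- \<gamma> * walk Y n w)"
      by (intro mult_mono inverse_real_nat_le) auto
    then show ?thesis using True by (simp add: norm_mult norm_inverse algebra_simps)
  qed simp
  from integrable_at_T_bound[OF g _ this] show ?thesis by measurable
qed

lemma norm_integral_le_1:
  assumes "\<And>w. norm (f w) \<le> 1"
  shows "norm (LINT w|M. (f w :: complex)) \<le> 1"
proof (cases "integrable M f")
  case True
  have "norm (LINT w|M. f w) \<le> (LINT w|M. norm (f w))" by simp
  also have "\<dots> \<le> (LINT w|M. 1)" using True assms by (intro integral_mono) auto
  finally show ?thesis by (simp add: prob_space)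
qed (simp add: not_integrable_integral_eq)

lemma norm_log_plus_le:
  assumes "0 \<le> Im z"
  shows "norm (log_plus z) \<le> 1 / (1 - q)"
proof -
  have "norm (LINT w|M. of_real (inverse (real (T w)) * indicator {0<..} (walk_T w)) * iexpz z (walk_T w)) \<le> 1"
    using assms by (intro norm_integral_le_1)
      (auto simp: norm_mult norm_inverse indicator_def intro!: mult_le_one inverse_real_nat_le)
  moreover have "norm (1 / complex_of_real (1 - q)) = 1 / (1 - q)"
    using q by (simp add: norm_divide del: of_real_diff)
  ultimately show ?thesis using q unfolding log_plus_def norm_mult by (auto intro!: divide_right_mono)
qed

lemma norm_log_minus_le:
  assumes "Im z \<le> 0"
  shows "norm (log_minus z) \<le> 1 / (1 - q)"
proof -
  have "norm (LINT w|M. of_real (inverse (real (T w)) * indicator {..0} (walk_T w)) * iexpz z (walk_T w)) \<le> 1"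
    using assms by (intro norm_integral_le_1)
      (auto simp: norm_mult norm_inverse indicator_def mult_nonpos_nonpos intro!: mult_le_one inverse_real_nat_le)
  moreover have "norm (1 / complex_of_real (1 - q)) = 1 / (1 - q)"
    using q by (simp add: norm_divide del: of_real_diff)
  ultimately show ?thesis using q unfolding log_minus_def norm_mult by (auto intro!: divide_right_mono)
qed

lemma norm_q_Phi_less:
  assumes "\<mu>m \<le> Im z" "Im z \<le> \<mu>p"
  shows "norm (of_real q * Phi M Y z) < 1"
proof -
  have "norm (of_real q * Phi M Y z) = q * norm (Phi M Y z)" using q by (simp add: norm_mult)
  also have "\<dots> \<le> q * mgf (Im z)" using q norm_Phi_le by (intro mult_left_mono) auto
  also have "\<dots> < 1" using assms by (rule q_mgf_less)
  finally show ?thesis .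
qed

text \<open>The weight 1/T turns the geometric series in q\<Phi> into the logarithmic one, which
  sums to the principal branch because the modulus of q\<Phi> is below 1 on the strip.\<close>

lemma integral_inverse_T_walk:
  assumes z: "\<mu>m \<le> Im z" "Im z \<le> \<mu>p"
  shows "(LINT w|M. of_real (inverse (real (T w))) * iexpz z (walk_T w))
     = - (1 - q) * Ln (1 - of_real q * Phi M Y z)"
proof -
  have "(\<lambda>n. of_real ((1 - q) * q ^ n) * (LINT w|M. of_real (inverse (real n)) * iexpz z (walk Y n w))) sums
        (LINT w|M. of_real (inverse (real (T w))) * iexpz z (walk_T w))"
    using inverse_real_nat_le by (intro sums_walk_at_T[OF z]) auto
  then have 1: "(\<lambda>n. of_real ((1 - q) * q ^ n) * (of_real (inverse (real n)) * Phi M Y z ^ n)) sums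
        (LINT w|M. of_real (inverse (real (T w))) * iexpz z (walk_T w))"
    unfolding integral_mult_right_zero integral_exp_walk[OF z] .
  have "(\<lambda>n. - ((- (- (of_real q * Phi M Y z)))^n) / of_nat n) sums ln (1 + - (of_real q * Phi M Y z))"
    using norm_q_Phi_less[OF z] by (intro Ln_series') simp
  from sums_mult[OF this, of "- of_real (1 - q)"]
  have "(\<lambda>n. - of_real (1 - q) * (- ((- (- (of_real q * Phi M Y z)))^n) / of_nat n)) sums
      (- of_real (1 - q) * Ln (1 - of_real q * Phi M Y z))"
    by simp
  also have "(\<lambda>n. - of_real (1 - q) * (- ((- (- (of_real q * Phi M Y z)))^n) / of_nat n)) =
      (\<lambda>n. of_real ((1 - q) * q ^ n) * (of_real (inverse (real n)) * Phi M Y z ^ n))"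
    by (intro ext) (simp add: power_mult_distrib divide_inverse algebra_simps)
  finally have 2: "(\<lambda>n. of_real ((1 - q) * q ^ n) * (of_real (inverse (real n)) * Phi M Y z ^ n)) sums
       (- of_real (1 - q) * Ln (1 - of_real q * Phi M Y z))" .
  show ?thesis using sums_unique2[OF 1 2] by simp
qed

lemma log_plus_add_log_minus:
  assumes z: "\<mu>m \<le> Im z" "Im z \<le> \<mu>p"
  shows "log_plus z + log_minus z = - Ln (1 - of_real q * Phi M Y z)"
proof -
  have "log_plus z + log_minus z = 1 / of_real (1 - q) *
     (LINT w|M. of_real (inverse (real (T w)) * indicator {0<..} (walk_T w)) * iexpz z (walk_T w) +
       of_real (inverse (real (T w)) * indicator {..0} (walk_T w)) * iexpz z (walk_T w))"
    unfolding log_plus_def log_minus_def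
    by (subst Bochner_Integration.integral_add[OF integrable_log_plus[OF z(1)] integrable_log_minus[OF z(2)]]) (simp add: distrib_left)
  also have "(\<lambda>w. complex_of_real (inverse (real (T w)) * indicator {0<..} (walk_T w)) * iexpz z (walk_T w) +
       of_real (inverse (real (T w)) * indicator {..0} (walk_T w)) * iexpz z (walk_T w)) =
      (\<lambda>w. of_real (inverse (real (T w))) * iexpz z (walk_T w))"
    by (auto simp: indicator_def)
  also have "1 / of_real (1 - q) * (LINT w|M. of_real (inverse (real (T w))) * iexpz z (walk_T w)) =
     - Ln (1 - of_real q * Phi M Y z)"
    unfolding integral_inverse_T_walk[OF z] using q by (simp add: field_simps)
  finally show ?thesis .
qed

lemma exp_log_sum:
  assumes z: "\<mu>m \<le> Im z" "Im z \<le> \<mu>p"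
  shows "exp (log_plus z) * exp (log_minus z) * (1 - of_real q * Phi M Y z) = 1"
proof -
  have "1 - of_real q * Phi M Y z \<noteq> 0" using norm_q_Phi_less[OF z] by force
  then show ?thesis unfolding exp_add[symmetric] log_plus_add_log_minus[OF z] by (simp add: exp_minus)
qed

lemma holomorphic_log_plus: "log_plus holomorphic_on {z. \<mu>m < Im z}"
proof -
  have "(\<lambda>z. LINT w|M. of_real (inverse (real (T w)) * indicator {0<..} (walk_T w)) * iexpz z (walk_T w))
     holomorphic_on {z. \<mu>m < Im z}"
  proof (rule integral_exp_holomorphic)
    show "open {z. \<mu>m < Im z}" by (intro open_Collect_less continuous_intros)
  qed (measurable, auto intro!: integrable_log_plus simp del: of_real_mult)
  then show ?thesis unfolding log_plus_def by (intro holomorphic_intros)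
qed

lemma holomorphic_log_minus: "log_minus holomorphic_on {z. Im z < \<mu>p}"
proof -
  have "(\<lambda>z. LINT w|M. of_real (inverse (real (T w)) * indicator {..0} (walk_T w)) * iexpz z (walk_T w))
     holomorphic_on {z. Im z < \<mu>p}"
  proof (rule integral_exp_holomorphic)
    show "open {z. Im z < \<mu>p}" by (intro open_Collect_less continuous_intros)
  qed (measurable, auto intro!: integrable_log_minus simp del: of_real_mult)
  then show ?thesis unfolding log_minus_def by (intro holomorphic_intros)
qed

lemma
  assumes "\<mu>m \<le> Im x" "Im z \<le> \<mu>p"
  shows integrable_joint: "integrable M (\<lambda>w. iexpz x (max_T w) * iexpz z (excess_T w))"
    and sums_joint: "(\<lambda>n. of_real ((1 - q) * q ^ n) * (LINT w|M. iexpz x (walk_max Y n w) * iexpz z (excess n w)))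
       sums joint_transform x z"
    and integrable_joint_n: "integrable M (\<lambda>w. iexpz x (walk_max Y n w) * iexpz z (excess n w))"
proof -
  have 1: "(\<lambda>w. iexpz x (walk_max Y n w) * iexpz z (excess n w)) \<in> borel_measurable walk_algebra" for n
    by measurable
  have 2: "norm (iexpz x (walk_max Y n w) * iexpz z (excess n w)) \<le>
      exp (- Im x * walk_max Y (0 + n) w - Im z * excess (0 + n) w)" for n w
    by (simp add: norm_mult exp_diff exp_minus divide_inverse)
  show "integrable M (\<lambda>w. iexpz x (max_T w) * iexpz z (excess_T w))"
    by (rule integrable_at_T_bound[OF assms 1 2])
  show "(\<lambda>n. of_real ((1 - q) * q ^ n) * (LINT w|M. iexpz x (walk_max Y n w) * iexpz z (excess n w)))
       sums joint_transform x z"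
    unfolding joint_transform_def by (rule sums_at_T_bound[OF assms 1 2])
  show "integrable M (\<lambda>w. iexpz x (walk_max Y n w) * iexpz z (excess n w))"
    by (rule integrable_G_bound[OF assms 1 2])
qed

lemma
  assumes "\<mu>m \<le> Im x" "\<mu>m \<le> Im z"
  shows integrable_overshoot: "integrable M (\<lambda>w. indicator {max_T w<..} (walk Y (Suc (T w)) w) *
      iexpz x (max_T w) * iexpz z (walk Y (Suc (T w)) w - max_T w))"
    and sums_overshoot: "(\<lambda>n. of_real ((1 - q) * q ^ n) * (LINT w|M. indicator {walk_max Y n w<..} (walk Y (Suc n) w) *
      iexpz x (walk_max Y n w) * iexpz z (walk Y (Suc n) w - walk_max Y n w)))
       sums overshoot_transform x z"
    and integrable_overshoot_n: "integrable M (\<lambda>w. indicator {walk_max Y n w<..} (walk Y (Suc n) w) *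
      iexpz x (walk_max Y n w) * iexpz z (walk Y (Suc n) w - walk_max Y n w))"
proof -
  \<comment> \<open>At a record the new walk is the old maximum plus the overshoot, both
    nonnegative. Lowering both tilts to c bounds the integrand by exp(-c X) at time n + 1, which is
    the envelope there because the excess has become 0.\<close>
  define c where "c = min (min (Im x) (Im z)) 0"
  have c: "\<mu>m \<le> c" "c \<le> \<mu>p" using assms mu by (auto simp: c_def)
  have 1: "(\<lambda>w. indicator {walk_max Y n w<..} (walk Y (Suc n) w) *
      iexpz x (walk_max Y n w) * iexpz z (walk Y (Suc n) w - walk_max Y n w)) \<in> borel_measurable walk_algebra" for n
    unfolding indicator_def greaterThan_iff by measurable
  have 2: "norm (indicator {walk_max Y n w<..} (walk Y (Suc n) w) *
      iexpz x (walk_max Y n w) * iexpz z (walk Y (Suc n) w - walk_max Y n w)) \<le>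
      exp (- c * walk_max Y (1 + n) w - c * excess (1 + n) w)" for n w
  proof (cases "walk_max Y n w < walk Y (Suc n) w")
    case True
    then have "c * walk_max Y n w \<le> Im x * walk_max Y n w"
      "c * (walk Y (Suc n) w - walk_max Y n w) \<le> Im z * (walk Y (Suc n) w - walk_max Y n w)"
      using walk_max_nonneg[of n w] by (auto simp: c_def intro!: mult_right_mono)
    then have "exp (- (Im x * walk_max Y n w)) * exp (- (Im z * (walk Y (Suc n) w - walk_max Y n w))) \<le> exp (- c * walk Y (Suc n) w)"
      unfolding exp_add[symmetric] by (simp add: algebra_simps)
    then show ?thesis using True by (simp add: norm_mult walk_max_Suc max_def)
  qed simp
  show "integrable M (\<lambda>w. indicator {max_T w<..} (walk Y (Suc (T w)) w) *
      iexpz x (max_T w) * iexpz z (walk Y (Suc (T w)) w - max_T w))"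
    by (rule integrable_at_T_bound[OF c 1 2])
  show "(\<lambda>n. of_real ((1 - q) * q ^ n) * (LINT w|M. indicator {walk_max Y n w<..} (walk Y (Suc n) w) *
      iexpz x (walk_max Y n w) * iexpz z (walk Y (Suc n) w - walk_max Y n w)))
       sums overshoot_transform x z"
    unfolding overshoot_transform_def by (rule sums_at_T_bound[OF c 1 2])
  show "integrable M (\<lambda>w. indicator {walk_max Y n w<..} (walk Y (Suc n) w) *
      iexpz x (walk_max Y n w) * iexpz z (walk Y (Suc n) w - walk_max Y n w))"
    by (rule integrable_G_bound[OF c 1 2])
qed

text \<open>Only the walk is advanced while the maximum is kept. The new increment is independent of
  the past, so the expectation just picks up the factor \<Phi>(z).\<close>

lemma integral_next_step:
  assumes x: "\<mu>m \<le> Im x" and z: "\<mu>m \<le> Im z" "Im z \<le> \<mu>p"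
  shows "integrable M (\<lambda>w. iexpz x (walk_max Y n w) * iexpz z (walk Y (Suc n) w - walk_max Y n w))"
      (is "integrable M ?f")
    and "(LINT w|M. iexpz x (walk_max Y n w) * iexpz z (walk Y (Suc n) w - walk_max Y n w)) =
      Phi M Y z * (LINT w|M. iexpz x (walk_max Y n w) * iexpz z (excess n w))"
proof -
  \<comment> \<open>The past as a functional of the vector of the first n increments:
    \<open>walk\<close> and \<open>walk_max\<close> are applied to the coordinate maps, which makes
    block independence of Y applicable.\<close>
  define h where "h y = iexpz x (walk_max (\<lambda>i y. y i) n y) * iexpz z (walk (\<lambda>i y. y i) n y - walk_max (\<lambda>i y. y i) n y)"
    for y :: "nat \<Rightarrow> real"
  have [measurable]: "walk (\<lambda>i y. y i) m \<in> borel_measurable (Pi\<^sub>M {1..n} (\<lambda>_. borel))" if "m \<le> n" for m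
    unfolding walk_def using that by (intro borel_measurable_sum measurable_component_singleton) auto
  then have [measurable]: "walk_max (\<lambda>i y. y i) n \<in> borel_measurable (Pi\<^sub>M {1..n} (\<lambda>_. borel))"
    unfolding walk_max_def by (intro borel_measurable_Max) auto
  have h[measurable]: "h \<in> borel_measurable (Pi\<^sub>M {1..n} (\<lambda>_. borel))" unfolding h_def by measurable
  have g: "(\<lambda>y. iexpz z (y (Suc n))) \<in> borel_measurable (Pi\<^sub>M {Suc n} (\<lambda>_. borel :: real measure))"
    by measurable
  have blocks: "indep_var (Pi\<^sub>M {1..n} (\<lambda>_. borel)) (\<lambda>w. restrict (\<lambda>i. Y i w) {1..n}) (Pi\<^sub>M {Suc n} (\<lambda>_. borel)) (\<lambda>w. restrict (\<lambda>i. Y i w) {Suc n})"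
    by (rule indep_var_restrict[OF indep]) auto
  have ind: "indep_var borel (\<lambda>w. iexpz x (walk_max Y n w) * iexpz z (excess n w)) borel (\<lambda>w. iexpz z (Y (Suc n) w))"
  proof -
    have "walk (\<lambda>i y. y i) m (restrict (\<lambda>i. Y i w) {1..n}) = walk Y m w" if "m \<le> n" for m w
      unfolding walk_def using that by (intro sum.cong) auto
    moreover from this have "walk_max (\<lambda>i y. y i) n (restrict (\<lambda>i. Y i w) {1..n}) = walk_max Y n w" for w
      unfolding walk_max_def by (intro arg_cong[where f = Max] image_cong) auto
    ultimately have "h \<circ> (\<lambda>w. restrict (\<lambda>i. Y i w) {1..n}) = (\<lambda>w. iexpz x (walk_max Y n w) * iexpz z (excess n w))"
      by (auto simp: h_def)
    moreover have "(\<lambda>y. iexpz z (y (Suc n))) \<circ> (\<lambda>w. restrict (\<lambda>i. Y i w) {Suc n}) = (\<lambda>w. iexpz z (Y (Suc n) w))"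
      by auto
    ultimately show ?thesis using indep_var_compose[OF blocks h g] by simp
  qed
  have eq: "?f = (\<lambda>w. iexpz x (walk_max Y n w) * iexpz z (excess n w) * iexpz z (Y (Suc n) w))"
    by (auto simp: walk_Suc algebra_simps simp flip: exp_add)
  show "integrable M ?f"
    unfolding eq by (rule indep_var_integrable[OF ind integrable_joint_n[OF x z(2)] integrable_exp_Y[OF z]])
  show "(LINT w|M. ?f w) = Phi M Y z * (LINT w|M. iexpz x (walk_max Y n w) * iexpz z (excess n w))"
    unfolding eq
    by (subst indep_var_lebesgue_integral[OF ind integrable_joint_n[OF x z(2)] integrable_exp_Y[OF z]]) (simp add: integral_exp_Y[OF z])
qed

text \<open>One step of the chain \<open>(walk_max, excess)\<close>: an overshoot is moved from the second
  coordinate to the first.\<close>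
lemma joint_transform_fixed_point:
  assumes x: "\<mu>m \<le> Im x" and z: "\<mu>m \<le> Im z" "Im z \<le> \<mu>p"
  shows "joint_transform x z * (1 - of_real q * Phi M Y z) =
    of_real (1 - q) + of_real q * overshoot_transform x x - of_real q * overshoot_transform x z"
proof -
  define j where "j n w = iexpz x (walk_max Y n w) * iexpz z (excess n w)" for n w
  define u where "u y n w = indicator {walk_max Y n w<..} (walk Y (Suc n) w) *
      iexpz x (walk_max Y n w) * iexpz y (walk Y (Suc n) w - walk_max Y n w)" for y n w
  define p where "p n w = iexpz x (walk_max Y n w) * iexpz z (walk Y (Suc n) w - walk_max Y n w)" for n w
  have step: "(LINT w|M. j (Suc n) w) = Phi M Y z * (LINT w|M. j n w) + (LINT w|M. u x n w) - (LINT w|M. u z n w)" for n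
  proof -
    \<comment> \<open>Without a record the maximum is unchanged and both overshoot terms vanish. At
      a record \<open>p\<close> cancels against \<open>u z\<close>, and \<open>u x\<close> is the
      exponential at the new maximum, whose excess is 0.\<close>
    have "j (Suc n) w = p n w + u x n w - u z n w" for w
      by (auto simp: j_def p_def u_def walk_max_Suc max_def algebra_simps indicator_def simp flip: exp_add)
    then have "(LINT w|M. j (Suc n) w) = (LINT w|M. p n w + u x n w - u z n w)" by simp
    also have "\<dots> = (LINT w|M. p n w) + (LINT w|M. u x n w) - (LINT w|M. u z n w)"
      using integral_next_step(1)[OF x z, of n] integrable_overshoot_n[OF x x, of n] integrable_overshoot_n[OF x z(1), of n]
      unfolding p_def[symmetric] u_def[symmetric] by simp
    also have "(LINT w|M. p n w) = Phi M Y z * (LINT w|M. j n w)"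
      using integral_next_step(2)[OF x z, of n] by (simp add: p_def j_def)
    finally show ?thesis .
  qed
  have J: "(\<lambda>n. of_real ((1 - q) * q ^ n) * (LINT w|M. j n w)) sums joint_transform x z"
    using sums_joint[OF x z(2)] by (simp add: j_def)
  have U: "(\<lambda>n. of_real ((1 - q) * q ^ n) * (LINT w|M. u y n w)) sums overshoot_transform x y" if "\<mu>m \<le> Im y" for y
    using sums_overshoot[OF x that] by (simp add: u_def)
  have "(\<lambda>n. of_real q * (Phi M Y z * (of_real ((1 - q) * q ^ n) * (LINT w|M. j n w)) +
      of_real ((1 - q) * q ^ n) * (LINT w|M. u x n w) - of_real ((1 - q) * q ^ n) * (LINT w|M. u z n w))) sums
     (of_real q * (Phi M Y z * joint_transform x z + overshoot_transform x x - overshoot_transform x z))"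
    by (intro sums_mult sums_diff sums_add J U x z)
  also have "(\<lambda>n. of_real q * (Phi M Y z * (of_real ((1 - q) * q ^ n) * (LINT w|M. j n w)) +
      of_real ((1 - q) * q ^ n) * (LINT w|M. u x n w) - of_real ((1 - q) * q ^ n) * (LINT w|M. u z n w))) =
      (\<lambda>n. of_real ((1 - q) * q ^ Suc n) * (LINT w|M. j (Suc n) w))"
    unfolding step by (auto simp: algebra_simps)
  \<comment> \<open>Undoing the index shift adds the term n = 0, where maximum and excess are 0; it
    is the 1 - q of the identity.\<close>
  finally have "(\<lambda>n. of_real ((1 - q) * q ^ n) * (LINT w|M. j n w)) sums
     (of_real q * (Phi M Y z * joint_transform x z + overshoot_transform x x - overshoot_transform x z) + of_real ((1 - q) * q ^ 0) * (LINT w|M. j 0 w))"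
    by (rule sums_Suc)
  from sums_unique2[OF this J] show ?thesis
    by (simp add: j_def prob_space algebra_simps)
qed

text \<open>With x fixed, multiplying the one-step identity in y by exp(log_plus y) turns the factor
  1 - q\<Phi>(y) into exp(-log_minus y). One side, \<open>f\<close>, then continues to the upper
  half plane and the other, \<open>g\<close>, to the lower one.\<close>

theorem joint_transform_eq:
  assumes x: "\<mu>m < Im x" and z: "Im z < \<mu>p"
  shows "joint_transform x z = of_real (1 - q) * exp (log_plus x) * exp (log_minus z)"
proof -
  define f where "f y = exp (log_plus y) * (of_real (1 - q) + of_real q * overshoot_transform x x - of_real q * overshoot_transform x y)" for y
  define g where "g y = joint_transform x y * exp (- log_minus y)" for y
  \<comment> \<open>The expected modulus of exp(ixM), finite even when Im x is negative. It
    dominates both transforms on the half planes where the factor depending on y has modulus at most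
    1.\<close>
  define B where "B = (LINT w|M. norm (iexpz x (max_T w) * iexpz 0 (excess_T w)))"
  have B: "norm (LINT w|M. h w) \<le> B" if "h \<in> borel_measurable M" "\<And>w. norm (h w) \<le> norm (iexpz x (max_T w))" for h :: "'a \<Rightarrow> complex"
  proof -
    have i: "integrable M (\<lambda>w. norm (iexpz x (max_T w) * iexpz 0 (excess_T w)))"
      using x mu by (intro integrable_norm integrable_joint) auto
    have "integrable M h" by (rule Bochner_Integration.integrable_bound[OF i]) (use that in auto)
    have "norm (LINT w|M. h w) \<le> (LINT w|M. norm (h w))" by simp
    also have "\<dots> \<le> B" unfolding B_def using that \<open>integrable M h\<close> by (intro integral_mono i) auto
    finally show ?thesis .
  qed
  have B_nonneg: "0 \<le> B" unfolding B_def by simp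
  have "(\<lambda>y. overshoot_transform x y) holomorphic_on {z. \<mu>m < Im z}"
    unfolding overshoot_transform_def
  proof (rule integral_exp_holomorphic)
    show "open {z. \<mu>m < Im z}" by (intro open_Collect_less continuous_intros)
    show "(\<lambda>w. indicator {max_T w<..} (walk Y (Suc (T w)) w) * iexpz x (max_T w))
        \<in> borel_measurable M" unfolding indicator_def greaterThan_iff by measurable
  qed (use x in \<open>auto intro!: integrable_overshoot simp del: of_real_diff\<close>)
  then have f_hol: "f holomorphic_on {z. \<mu>m < Im z}"
    unfolding f_def by (intro holomorphic_intros holomorphic_log_plus)
  have "(\<lambda>y. joint_transform x y) holomorphic_on {z. Im z < \<mu>p}"
    unfolding joint_transform_def
  proof (rule integral_exp_holomorphic)
    show "open {z. Im z < \<mu>p}" by (intro open_Collect_less continuous_intros)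
  qed (use x in \<open>auto intro!: integrable_joint simp del: of_real_diff\<close>)
  then have g_hol: "g holomorphic_on {z. Im z < \<mu>p}"
    unfolding g_def by (intro holomorphic_intros holomorphic_log_minus)
  have fg: "f y = g y" if y: "\<mu>m < Im y" "Im y < \<mu>p" for y
  proof -
    have *: "exp (log_plus y) * exp (log_minus y) * (1 - of_real q * Phi M Y y) = 1"
      using y by (intro exp_log_sum) auto
    have "f y = exp (log_plus y) * (joint_transform x y * (1 - of_real q * Phi M Y y))"
      unfolding f_def using x y by (subst joint_transform_fixed_point) auto
    also have "\<dots> = joint_transform x y * ((exp (log_plus y) * exp (log_minus y) * (1 - of_real q * Phi M Y y)) / exp (log_minus y))"
      by simp
    also have "\<dots> = g y" unfolding * g_def by (simp add: exp_minus divide_inverse)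
    finally show ?thesis .
  qed
  have f_bound: "norm (f y) \<le> exp (1 / (1 - q)) * (norm (of_real (1 - q) + of_real q * overshoot_transform x x) + q * B)" if y: "Im y \<ge> 0" for y
  proof -
    have "norm (overshoot_transform x y) \<le> B"
      unfolding overshoot_transform_def
    proof (rule B)
      show "norm (indicator {max_T w<..} (walk Y (Suc (T w)) w) * iexpz x (max_T w) *
         iexpz y (walk Y (Suc (T w)) w - max_T w)) \<le> norm (iexpz x (max_T w))" for w
        using y by (auto simp: norm_mult indicator_def intro!: mult_left_le)
    qed (unfold indicator_def greaterThan_iff, measurable)
    then have "norm (of_real (1 - q) + of_real q * overshoot_transform x x - of_real q * overshoot_transform x y) \<le>
       norm (of_real (1 - q) + of_real q * overshoot_transform x x) + q * B"
      using q by (intro order_trans[OF norm_triangle_ineq4]) (simp add: norm_mult mult_left_mono)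
    moreover have "norm (exp (log_plus y)) \<le> exp (1 / (1 - q))"
      using norm_log_plus_le[OF y] complex_Re_le_cmod[of "log_plus y"] by (simp add: norm_exp_eq_Re)
    ultimately show ?thesis unfolding f_def norm_mult by (intro mult_mono) auto
  qed
  have g_bound: "norm (g y) \<le> B * exp (1 / (1 - q))" if y: "Im y \<le> 0" for y
  proof -
    have "norm (joint_transform x y) \<le> B"
      unfolding joint_transform_def
    proof (rule B)
      show "norm (iexpz x (max_T w) * iexpz y (excess_T w))
          \<le> norm (iexpz x (max_T w))" for w
        using y mult_nonpos_nonpos[OF y excess_nonpos[of "T w" w]] by (auto simp: norm_mult intro!: mult_left_le)
    qed measurable
    moreover have "norm (exp (- log_minus y)) \<le> exp (1 / (1 - q))"
      using norm_log_minus_le[OF y] complex_Re_le_cmod[of "- log_minus y"] by (simp add: norm_exp_eq_Re)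
    ultimately show ?thesis unfolding g_def norm_mult using B_nonneg by (intro mult_mono) auto
  qed
  obtain c where c: "\<And>y. \<mu>m < Im y \<Longrightarrow> f y = c" "\<And>y. Im y < \<mu>p \<Longrightarrow> g y = c"
    using liouville_glue[OF mu f_hol g_hol fg f_bound g_bound] by blast
  \<comment> \<open>At y = x the two overshoot terms of \<open>f\<close> cancel, which evaluates the
    Liouville constant without any limit at infinity.\<close>
  have "c = exp (log_plus x) * of_real (1 - q)" using c(1)[OF x] by (simp add: f_def)
  moreover have "joint_transform x z = c * exp (log_minus z)"
    using c(2)[OF z] by (simp add: g_def exp_minus field_simps)
  ultimately show ?thesis by simp
qed

end

section \<open>Inversion along horizontal lines\<close>

lemma norm_Ln_one_minus_le:
  fixes z :: complex
  assumes z: "norm z < 1"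
  shows "norm (Ln (1 - z)) \<le> norm z / (1 - norm z)"
proof -
  have "(\<lambda>n. - ((- (- z)) ^ n) / of_nat n) sums ln (1 + - z)" using z by (intro Ln_series') simp
  then have 1: "(\<lambda>n. - (z ^ Suc n) / of_nat (Suc n)) sums Ln (1 - z)"
    by (subst sums_Suc_iff) simp
  have 2: "(\<lambda>n. norm z * norm z ^ n) sums (norm z * (1 / (1 - norm z)))"
    using z by (intro sums_mult geometric_sums) simp
  have le: "norm (- (z ^ Suc n) / of_nat (Suc n)) \<le> norm z * norm z ^ n" for n
  proof -
    have "norm (- (z ^ Suc n) / of_nat (Suc n)) = norm z ^ Suc n / real (Suc n)"
      by (simp add: norm_divide norm_power norm_mult del: of_nat_Suc)
    also have "\<dots> \<le> norm z ^ Suc n / 1" by (intro divide_left_mono) auto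
    finally show ?thesis by simp
  qed
  have "norm (\<Sum>n. - (z ^ Suc n) / of_nat (Suc n)) \<le> (\<Sum>n. norm z * norm z ^ n)"
    using sums_summable[OF 2] le by (intro norm_suminf_le) auto
  then show ?thesis using sums_unique[OF 1] sums_unique[OF 2] by simp
qed

lemma norm_exp_minus_1_le: "norm (exp z - 1) \<le> norm z * exp (norm z)" for z :: complex
proof -
  have "norm (exp z - exp 0) \<le> exp (norm z) * norm (z - 0)"
  proof (rule field_differentiable_bound[where S = "cball 0 (norm z)" and f' = exp])
    show "(exp has_field_derivative exp x) (at x within cball 0 (norm z))" for x :: complex
      by (rule DERIV_subset[OF DERIV_exp]) auto
    show "norm (exp x) \<le> exp (norm z)" if "x \<in> cball 0 (norm z)" for x :: complex
      using that order_trans[OF complex_Re_le_cmod[of x]] by (simp add: norm_exp_eq_Re)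
  qed auto
  then show ?thesis by (simp add: mult.commute)
qed

text \<open>The modulus dominates both the vertical gap d and r = |t - s|, and max d r >= d(1 +
  r)/(1 + d). The distance to a point off the line is thus at least a constant times 1 + |t -
  s|.\<close>

lemma norm_line_diff_ge:
  assumes "u \<noteq> v"
  shows "\<bar>u - v\<bar> / (1 + \<bar>u - v\<bar>) * (1 + \<bar>t - s\<bar>) \<le> norm (Complex t u - Complex s v)"
proof -
  define d where "d = \<bar>u - v\<bar>"
  have d: "d > 0" using assms by (simp add: d_def)
  have n: "d \<le> norm (Complex t u - Complex s v)" "\<bar>t - s\<bar> \<le> norm (Complex t u - Complex s v)"
    using abs_Im_le_cmod[of "Complex t u - Complex s v"] abs_Re_le_cmod[of "Complex t u - Complex s v"] by (auto simp: d_def)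
  have "d / (1 + d) * (1 + \<bar>t - s\<bar>) \<le> max d \<bar>t - s\<bar>"
  proof (cases "\<bar>t - s\<bar> \<ge> d")
    case True
    then have "d * (1 + \<bar>t - s\<bar>) \<le> \<bar>t - s\<bar> * (1 + d)" by (simp add: algebra_simps)
    then have "d / (1 + d) * (1 + \<bar>t - s\<bar>) \<le> \<bar>t - s\<bar>" using d by (simp add: field_simps)
    then show ?thesis by simp
  next
    case False
    then have "d * (1 + \<bar>t - s\<bar>) \<le> d * (1 + d)" using d by (intro mult_left_mono) auto
    then have "d / (1 + d) * (1 + \<bar>t - s\<bar>) \<le> d" using d by (simp add: field_simps)
    then show ?thesis by simp
  qed
  also have "\<dots> \<le> norm (Complex t u - Complex s v)" using n by simp
  finally show ?thesis by (simp add: d_def)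
qed

lemma norm_divide_line_diff_le:
  fixes h :: complex
  assumes "u \<noteq> v"
  shows "norm (h / (Complex t u - Complex s v)) \<le> (1 + \<bar>u - v\<bar>) / \<bar>u - v\<bar> * (norm h * decay 1 (t - s))"
proof -
  define d where "d = \<bar>u - v\<bar>"
  have d: "d > 0" using assms by (simp add: d_def)
  have p: "0 < d / (1 + d) * (1 + \<bar>t - s\<bar>)" using d by (intro mult_pos_pos divide_pos_pos) auto
  have "norm (h / (Complex t u - Complex s v)) \<le> norm h / (d / (1 + d) * (1 + \<bar>t - s\<bar>))"
    unfolding norm_divide d_def using p assms norm_line_diff_ge[OF assms]
    by (intro divide_left_mono) (auto simp: d_def intro!: mult_pos_pos less_le_trans[OF p[unfolded d_def]])
  also have "\<dots> = (1 + d) / d * (norm h * decay 1 (t - s))"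
    using d by (simp add: powr_minus divide_simps)
  finally show ?thesis by (simp add: d_def)
qed

lemma minus_Complex: "- Complex a b = Complex (- a) (- b)"
  by (simp add: complex_eq_iff)

text \<open>No sign appears: the reflection reverses the direction, but the integral is a Lebesgue
  integral in the real part.\<close>

lemma line_integral_minus: "line_integral (- \<gamma>) g = line_integral \<gamma> (\<lambda>z. g (- z))"
  using lborel_integral_real_affine[of "-1" "\<lambda>t. g (Complex t (- \<gamma>))" 0]
  by (simp add: line_integral_def minus_Complex)

lemma line_integrable_minus: "line_integrable (- \<gamma>) g \<longleftrightarrow> line_integrable \<gamma> (\<lambda>z. g (- z))"
  using lborel_integrable_real_affine_iff[of "-1" "\<lambda>t. g (Complex t (- \<gamma>))" 0]
  by (simp add: line_integrable_def minus_Complex)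

lemma exp_Complex_mult_split:
  "exp (\<i> * Complex t \<gamma> * of_real x) = of_real (exp (- \<gamma> * x)) * exp (\<i> * of_real (t * x))"
  by (simp add: Complex_eq exp_add[symmetric] algebra_simps flip: exp_of_real)

lemma measurable_transform_line:
  assumes M: "sigma_finite_measure M" and [measurable]: "W \<in> borel_measurable M" "X \<in> borel_measurable M"
  shows "(\<lambda>t. LINT w|M. W w * iexpz (Complex t \<gamma>) (X w :: real)) \<in> borel_measurable borel"
proof -
  interpret sigma_finite_measure M by fact
  show ?thesis unfolding exp_Complex_mult_split by measurable
qed

text \<open>Tilting the weight by exp(-\<gamma>X) moves the integration from the real axis to height
  \<gamma>. With s = -i\<xi> - \<gamma> one has s + it = i(t + i\<gamma> - \<xi>) and Re s = Im
  \<xi> - \<gamma>, so positivity of Re s says that the pole \<xi> lies above the line.\<close>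

theorem line_inversion:
  fixes W :: "'a \<Rightarrow> complex" and X :: "'a \<Rightarrow> real"
  assumes M: "sigma_finite_measure M"
    and meas[measurable]: "X \<in> borel_measurable M"
    and W: "integrable M (\<lambda>w. W w * iexpz (Complex 0 \<gamma>) (X w))"
    and gap: "\<gamma> < Im \<xi>"
    and no_atom: "AE w in M. X w = b \<longrightarrow> W w = 0"
    and int: "line_integrable \<gamma> (\<lambda>\<eta>. (LINT w|M. W w * iexpz \<eta> (X w)) / (\<eta> - \<xi>))"
  shows "(LINT w|M. W w * (indicator {b<..} (X w) *\<^sub>R iexpz \<xi> (X w - b))) =
     1 / (2 * of_real pi * \<i>) * line_integral \<gamma> (\<lambda>\<eta>. exp (- \<i> * \<eta> * of_real b) * ((LINT w|M. W w * iexpz \<eta> (X w)) / (\<eta> - \<xi>)))"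
proof -
  define s where "s = - \<i> * \<xi> - of_real \<gamma>"
  define V where "V w = W w * of_real (exp (- \<gamma> * X w))" for w
  have V: "integrable M V" using W by (simp add: V_def[abs_def] exp_Complex_mult_split)
  have V_eq: "(LINT w|M. V w * exp (\<i> * of_real (t * X w))) = (LINT w|M. W w * iexpz (Complex t \<gamma>) (X w))" for t
    unfolding V_def exp_Complex_mult_split by (simp add: mult.assoc)
  have den: "s + \<i> * of_real t = \<i> * (Complex t \<gamma> - \<xi>)" for t by (simp add: s_def Complex_eq algebra_simps)
  have "integrable lborel (\<lambda>t. 1 / \<i> * ((LINT w|M. W w * iexpz (Complex t \<gamma>) (X w)) / (Complex t \<gamma> - \<xi>)))"
    using int unfolding line_integrable_def by (rule integrable_mult_right)
  then have int': "integrable lborel (\<lambda>t. (LINT w|M. V w * exp (\<i> * of_real (t * X w))) / (s + \<i> * of_real t))"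
    unfolding V_eq den by (simp only: times_divide_times_eq mult_1)
  have A: "(LINT w|M. V w * (indicator {b<..} (X w) *\<^sub>R exp (- s * of_real (X w - b)))) =
     1 / (2 * of_real pi) *
       (LINT t|lborel. exp (- \<i> * of_real (t * b)) * ((LINT w|M. V w * exp (\<i> * of_real (t * X w))) / (s + \<i> * of_real t)))"
  proof (rule halfline_inversion[OF M V meas _ _ int'])
    show "Re s > 0" using gap by (simp add: s_def)
    show "AE w in M. X w = b \<longrightarrow> V w = 0" using no_atom by eventually_elim (simp add: V_def)
  qed
  have B: "W w * (indicator {b<..} (X w) *\<^sub>R iexpz \<xi> (X w - b)) =
     of_real (exp (\<gamma> * b)) * (V w * (indicator {b<..} (X w) *\<^sub>R exp (- s * of_real (X w - b))))" for w
  proof -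
    have "iexpz \<xi> (X w - b) = of_real (exp (\<gamma> * b)) * of_real (exp (- \<gamma> * X w)) * exp (- s * of_real (X w - b))"
      by (simp add: s_def exp_add[symmetric] algebra_simps flip: exp_of_real)
    then show ?thesis by (simp add: V_def)
  qed
  have C: "of_real (exp (\<gamma> * b)) * (exp (- \<i> * of_real (t * b)) * ((LINT w|M. V w * exp (\<i> * of_real (t * X w))) / (s + \<i> * of_real t)))
    = 1 / \<i> * (exp (- \<i> * Complex t \<gamma> * of_real b) * ((LINT w|M. W w * iexpz (Complex t \<gamma>) (X w)) / (Complex t \<gamma> - \<xi>)))" for t
  proof -
    have e: "exp (- \<i> * Complex t \<gamma> * of_real b) = of_real (exp (\<gamma> * b)) * exp (- \<i> * of_real (t * b))"
      by (simp add: Complex_eq exp_add[symmetric] algebra_simps flip: exp_of_real)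
    show ?thesis unfolding V_eq den e
      by (simp only: divide_inverse inverse_mult_distrib mult_1_left mult_ac)
  qed
  have "(LINT w|M. W w * (indicator {b<..} (X w) *\<^sub>R iexpz \<xi> (X w - b))) =
     of_real (exp (\<gamma> * b)) * (LINT w|M. V w * (indicator {b<..} (X w) *\<^sub>R exp (- s * of_real (X w - b))))"
    unfolding B integral_mult_right_zero ..
  also have "\<dots> = 1 / (2 * of_real pi) *
     (LINT t|lborel. of_real (exp (\<gamma> * b)) * (exp (- \<i> * of_real (t * b)) * ((LINT w|M. V w * exp (\<i> * of_real (t * X w))) / (s + \<i> * of_real t))))"
    unfolding A integral_mult_right_zero by (rule mult.left_commute)
  also have "\<dots> = 1 / (2 * of_real pi) * (1 / \<i> *
     line_integral \<gamma> (\<lambda>\<eta>. exp (- \<i> * \<eta> * of_real b) * ((LINT w|M. W w * iexpz \<eta> (X w)) / (\<eta> - \<xi>))))"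
    unfolding C line_integral_def integral_mult_right_zero ..
  finally show ?thesis by (simp only: times_divide_times_eq mult_1 mult.assoc[symmetric])
qed

text \<open>This is \<open>line_inversion\<close> for -X with the pole at 0 and the line reflected
  to height -\<omega>. The event -X > -b is X < b, which differs from X <= b only where W vanishes
  almost everywhere.\<close>

corollary line_inversion_lower:
  fixes W :: "'a \<Rightarrow> complex" and X :: "'a \<Rightarrow> real"
  assumes M: "sigma_finite_measure M"
    and meas[measurable]: "X \<in> borel_measurable M"
    and W: "integrable M (\<lambda>w. W w * iexpz (Complex 0 \<omega>) (X w))"
    and \<omega>: "\<omega> > 0"
    and no_atom: "AE w in M. X w = b \<longrightarrow> W w = 0"
    and int: "line_integrable \<omega> (\<lambda>\<eta>. (LINT w|M. W w * iexpz \<eta> (X w)) / \<eta>)"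
  shows "(LINT w|M. W w * indicator {..b} (X w)) =
     1 / (2 * of_real pi) * line_integral \<omega> (\<lambda>\<eta>. exp (- \<i> * \<eta> * of_real b) * ((LINT w|M. W w * iexpz \<eta> (X w)) / (- \<i> * \<eta>)))"
proof -
  have W_meas[measurable]: "W \<in> borel_measurable M"
  proof -
    have "(\<lambda>w. W w * iexpz (Complex 0 \<omega>) (X w) * exp (- (\<i> * Complex 0 \<omega> * of_real (X w)))) \<in> borel_measurable M"
      using borel_measurable_integrable[OF W] by measurable
    then show ?thesis by (simp add: mult.assoc exp_minus_inverse)
  qed
  have eq: "\<i> * - \<eta> * of_real (X w) = \<i> * \<eta> * of_real (- X w)" for \<eta> w by simp
  have "(LINT w|M. W w * (indicator {- b<..} (- X w) *\<^sub>R iexpz 0 (- X w - - b))) =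
     1 / (2 * of_real pi * \<i>) * line_integral (- \<omega>) (\<lambda>\<eta>. exp (- \<i> * \<eta> * of_real (- b)) * ((LINT w|M. W w * iexpz \<eta> (- X w)) / (\<eta> - 0)))"
  proof (rule line_inversion[OF M])
    have "\<i> * Complex 0 (- \<omega>) * of_real (- X w) = \<i> * Complex 0 \<omega> * of_real (X w)" for w
      by (simp add: Complex_eq)
    then show "integrable M (\<lambda>w. W w * iexpz (Complex 0 (- \<omega>)) (- X w))" using W by simp
    show "- \<omega> < Im 0" using \<omega> by simp
    show "AE w in M. - X w = - b \<longrightarrow> W w = 0" using no_atom by simp
    have "integrable lborel (\<lambda>t. - ((LINT w|M. W w * iexpz (Complex t \<omega>) (X w)) / Complex t \<omega>))"
      using int unfolding line_integrable_def by (rule integrable_minus)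
    then show "line_integrable (- \<omega>) (\<lambda>\<eta>. (LINT w|M. W w * iexpz \<eta> (- X w)) / (\<eta> - 0))"
      by (subst line_integrable_minus) (simp add: line_integrable_def)
  qed measurable
  also have "(LINT w|M. W w * (indicator {- b<..} (- X w) *\<^sub>R iexpz 0 (- X w - - b))) = (LINT w|M. W w * indicator {..b} (X w))"
  proof (rule integral_cong_AE)
    show "AE w in M. W w * (indicator {- b<..} (- X w) *\<^sub>R iexpz 0 (- X w - - b)) = W w * indicator {..b} (X w)"
      using no_atom by eventually_elim (auto simp: indicator_def)
  qed measurable
  finally show ?thesis unfolding line_integral_minus
    by (simp add: line_integral_def mult.assoc flip: integral_mult_right_zero)
qed

section \<open>The Wiener--Hopf factors on horizontal lines\<close>

lemma borel_measurable_Complex_line[measurable]: "(\<lambda>t. Complex t c) \<in> borel_measurable borel"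
  unfolding Complex_eq by measurable

lemma (in prob_space) indep_set_mono: "indep_set A B \<Longrightarrow> B' \<subseteq> B \<Longrightarrow> indep_set A B'"
  unfolding indep_sets2_eq by blast

context geometric_walk begin

lemma sigma_finite_M: "sigma_finite_measure M"
  by (rule sigma_finite_measure_axioms)

text \<open>On the real axis the characteristic function of the walk at time n is \<Phi>^n, which
  tends to 0 with \<Phi> as soon as n >= 1.\<close>

lemma AE_walk_neq:
  assumes "n \<ge> 1"
  shows "AE w in M. walk Y n w \<noteq> b"
proof (rule no_atom_if_char_tendsto_0)
  show "prob_space M" by (rule prob_space_axioms)
  obtain C where C: "\<And>t. norm (Phi M Y (Complex t 0)) \<le> C * decay \<delta> t"
    using Phi_decay[of 0] mu by auto
  have "((\<lambda>s. C * (1 + s) powr (- \<delta>)) \<longlongrightarrow> 0) at_top" using delta by real_asymp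
  then have "((\<lambda>t::real. C * (1 + norm t) powr (- \<delta>)) \<longlongrightarrow> 0) at_infinity"
    by (rule filterlim_compose[OF _ filterlim_norm_at_top])
  then have "((\<lambda>t. Phi M Y (Complex t 0)) \<longlongrightarrow> 0) at_infinity"
    by (rule Lim_null_comparison[rotated]) (intro always_eventually allI, unfold real_norm_def, rule C)
  then have "((\<lambda>t. Phi M Y (Complex t 0) ^ n) \<longlongrightarrow> 0 ^ n) at_infinity"
    by (intro tendsto_power)
  moreover have "(LINT w|M. exp (\<i> * of_real (t * walk Y n w))) = Phi M Y (Complex t 0) ^ n" for t
    using integral_exp_walk[of "Complex t 0" n] mu by (simp add: Complex_eq mult.assoc)
  ultimately show "((\<lambda>t. LINT w|M. exp (\<i> * of_real (t * walk Y n w))) \<longlongrightarrow> 0) at_infinity"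
    using assms by (simp add: power_0_left)
qed measurable

lemma AE_all_walk_neq: "AE w in M. \<forall>n\<ge>1. walk Y n w \<noteq> b"
proof -
  have *: "AE w in M. 1 \<le> n \<longrightarrow> walk Y n w \<noteq> b" for n
  proof (cases "1 \<le> n")
    case True
    from AE_walk_neq[OF this, of b] show ?thesis by eventually_elim simp
  qed simp
  show ?thesis by (subst AE_all_countable) (intro allI *)
qed

text \<open>The exception is unavoidable since the walk starts at 0. The weights of the later
  inversions in the walk all vanish for T = 0: they contain 1/T, the indicator of T >= 1, or that of
  a negative excess.\<close>

lemma AE_walk_T_neq: "AE w in M. walk_T w = b \<longrightarrow> T w = 0"
  using AE_all_walk_neq[of b]
proof eventually_elim
  case (elim w)
  then have "walk_T w = b \<Longrightarrow> \<not> 1 \<le> T w" by blast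
  then show ?case by linarith
qed

text \<open>The maximum is the value of the walk at some time k, so off a null set it equals b only
  for k = 0. Its only possible atom is therefore at 0.\<close>

lemma AE_walk_max_T_neq: "AE w in M. max_T w = b \<longrightarrow> max_T w = 0"
  using AE_all_walk_neq[of b]
proof eventually_elim
  case (elim w)
  obtain k where k: "max_T w = walk Y k w" using walk_max_attained by blast
  show ?case
  proof
    assume "max_T w = b"
    then have "\<not> 1 \<le> k" using elim k by metis
    then have "k = 0" by linarith
    then show "max_T w = 0" using k by simp
  qed
qed

section \<open>Logarithmic transforms as Cauchy integrals, and their decay\<close>

lemma Ln_decay:
  assumes "\<mu>m \<le> \<gamma>" "\<gamma> \<le> \<mu>p"
  obtains C where "C \<ge> 0" "\<And>t. norm (Ln (1 - of_real q * Phi M Y (Complex t \<gamma>))) \<le> C * decay \<delta> t"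
proof -
  obtain C where C: "\<And>t. norm (Phi M Y (Complex t \<gamma>)) \<le> C * decay \<delta> t"
    using Phi_decay[OF assms] by blast
  have C0: "C \<ge> 0" using order_trans[OF norm_ge_zero C[of 0]] by simp
  \<comment> \<open>A bound for |q\<Phi>| on the entire line, below 1 by condition (i); it keeps the
    denominator of the logarithm estimate at least 1 - r.\<close>
  define r where "r = q * mgf \<gamma>"
  have r: "r < 1" using q_mgf_less[OF assms] by (simp add: r_def)
  show ?thesis
  proof (rule that)
    show "0 \<le> q * C / (1 - r)" using r q C0 by simp
    fix t
    define z where "z = of_real q * Phi M Y (Complex t \<gamma>)"
    have z1: "norm z \<le> r" using norm_Phi_le[of "Complex t \<gamma>"] q by (simp add: z_def r_def norm_mult mult_left_mono)
    have z2: "norm z \<le> q * (C * decay \<delta> t)" using C[of t] q by (simp add: z_def norm_mult mult_left_mono)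
    have "norm (Ln (1 - z)) \<le> norm z / (1 - norm z)" using z1 r by (intro norm_Ln_one_minus_le) simp
    also have "\<dots> \<le> (q * (C * decay \<delta> t)) / (1 - r)"
      using z1 z2 r order_trans[OF norm_ge_zero z2] by (intro frac_le) auto
    finally show "norm (Ln (1 - of_real q * Phi M Y (Complex t \<gamma>))) \<le> q * C / (1 - r) * decay \<delta> t"
      by (simp add: z_def mult.assoc)
  qed
qed

text \<open>Measurability is read off the representation as a transform at T, which avoids dealing
  with the branch cut of \<open>Ln\<close>.\<close>

lemma borel_measurable_Ln_line:
  assumes "\<mu>m \<le> \<gamma>" "\<gamma> \<le> \<mu>p"
  shows "(\<lambda>t. Ln (1 - of_real q * Phi M Y (Complex t \<gamma>))) \<in> borel_measurable borel"
proof -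
  have "(\<lambda>t. - (1 / of_real (1 - q)) * (LINT w|M. of_real (inverse (real (T w))) * iexpz (Complex t \<gamma>) (walk_T w))) \<in> borel_measurable borel"
    by (intro borel_measurable_times borel_measurable_const measurable_transform_line sigma_finite_M) measurable
  also have "(\<lambda>t. - (1 / of_real (1 - q)) * (LINT w|M. of_real (inverse (real (T w))) * iexpz (Complex t \<gamma>) (walk_T w))) =
     (\<lambda>t. Ln (1 - of_real q * Phi M Y (Complex t \<gamma>)))"
    using assms q by (intro ext, subst integral_inverse_T_walk) (auto simp: field_simps)
  finally show ?thesis .
qed

lemma line_integrable_Ln_divide:
  assumes g: "\<mu>m \<le> \<gamma>" "\<gamma> \<le> \<mu>p" and z: "\<gamma> \<noteq> Im z"
  shows "line_integrable \<gamma> (\<lambda>\<eta>. Ln (1 - of_real q * Phi M Y \<eta>) / (\<eta> - z))"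
  unfolding line_integrable_def
proof -
  note [measurable] = borel_measurable_Ln_line[OF g]
  obtain C where C: "C \<ge> 0" "\<And>t. norm (Ln (1 - of_real q * Phi M Y (Complex t \<gamma>))) \<le> C * decay \<delta> t"
    using Ln_decay[OF g] by blast
  define d where "d = (1 + \<bar>\<gamma> - Im z\<bar>) / \<bar>\<gamma> - Im z\<bar>"
  have "integrable lborel (\<lambda>t. d * (C * (decay \<delta> t * decay 1 (t - Re z))))"
    using delta by (intro integrable_mult_right integrable_powr_shift) auto
  then show "integrable lborel (\<lambda>t. Ln (1 - of_real q * Phi M Y (Complex t \<gamma>)) / (Complex t \<gamma> - z))"
  proof (rule integrable_norm_le)
    fix t
    have "norm (Ln (1 - of_real q * Phi M Y (Complex t \<gamma>)) / (Complex t \<gamma> - Complex (Re z) (Im z))) \<le>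
       d * (norm (Ln (1 - of_real q * Phi M Y (Complex t \<gamma>))) * decay 1 (t - Re z))"
      unfolding d_def by (rule norm_divide_line_diff_le[OF z])
    also have "\<dots> \<le> d * ((C * decay \<delta> t) * decay 1 (t - Re z))"
      using C z by (intro mult_left_mono mult_right_mono) (auto simp: d_def)
    finally show "norm (Ln (1 - of_real q * Phi M Y (Complex t \<gamma>)) / (Complex t \<gamma> - z)) \<le>
      d * (C * (decay \<delta> t * decay 1 (t - Re z)))"
      by (simp only: mult.assoc complex_surj)
    show "(\<lambda>t. Ln (1 - of_real q * Phi M Y (Complex t \<gamma>)) / (Complex t \<gamma> - z)) \<in> borel_measurable lborel"
      using borel_measurable_Ln_line[OF g] by (auto intro!: borel_measurable_divide borel_measurable_diff)
  qed
qed

text \<open>Half-line inversion at b = 0 for the weight 1/T. An atom at 0 is harmless: almost surely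
  the walk at T is 0 only if T = 0, where the weight is \<open>inverse 0 = 0\<close>.\<close>

lemma log_plus_eq_line_integral:
  assumes g: "\<mu>m \<le> \<gamma>" "\<gamma> \<le> \<mu>p" and z: "\<gamma> < Im z"
  shows "log_plus z = - (1 / (2 * of_real pi * \<i>)) * line_integral \<gamma> (\<lambda>\<eta>. Ln (1 - of_real q * Phi M Y \<eta>) / (\<eta> - z))"
proof -
  have h: "(LINT w|M. of_real (inverse (real (T w))) * iexpz \<eta> (walk_T w))
     = - of_real (1 - q) * Ln (1 - of_real q * Phi M Y \<eta>)" if "Im \<eta> = \<gamma>" for \<eta>
    using integral_inverse_T_walk[of \<eta>] g that by simp
  have h': "(LINT w|M. of_real (inverse (real (T w))) * iexpz (Complex t \<gamma>) (walk_T w))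
     = - of_real (1 - q) * Ln (1 - of_real q * Phi M Y (Complex t \<gamma>))" for t
    by (rule h) simp
  have "(LINT w|M. of_real (inverse (real (T w))) * (indicator {0<..} (walk_T w) *\<^sub>R iexpz z (walk_T w - 0))) =
     1 / (2 * of_real pi * \<i>) * line_integral \<gamma> (\<lambda>\<eta>. exp (- \<i> * \<eta> * of_real 0) * ((LINT w|M. of_real (inverse (real (T w))) * iexpz \<eta> (walk_T w)) / (\<eta> - z)))"
  proof (rule line_inversion[OF sigma_finite_M _ _ z])
    show "integrable M (\<lambda>w. of_real (inverse (real (T w))) * iexpz (Complex 0 \<gamma>) (walk_T w))"
      using g inverse_real_nat_le by (intro integrable_walk_at_T) auto
    show "AE w in M. walk_T w = 0 \<longrightarrow> complex_of_real (inverse (real (T w))) = 0"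
      using AE_walk_T_neq[of 0] by eventually_elim auto
    have "integrable lborel (\<lambda>t. - of_real (1 - q) * (Ln (1 - of_real q * Phi M Y (Complex t \<gamma>)) / (Complex t \<gamma> - z)))"
      using line_integrable_Ln_divide[OF g, of z] z unfolding line_integrable_def by (intro integrable_mult_right) auto
    then show "line_integrable \<gamma> (\<lambda>\<eta>. (LINT w|M. of_real (inverse (real (T w))) * iexpz \<eta> (walk_T w)) / (\<eta> - z))"
      unfolding line_integrable_def by (simp only: h' times_divide_eq_right)
  qed measurable
  also have "(LINT w|M. of_real (inverse (real (T w))) * (indicator {0<..} (walk_T w) *\<^sub>R iexpz z (walk_T w - 0))) =
    of_real (1 - q) * log_plus z"
    using q by (simp add: log_plus_def scaleR_conv_of_real mult.assoc)
  also have "line_integral \<gamma> (\<lambda>\<eta>. exp (- \<i> * \<eta> * of_real 0) * ((LINT w|M. of_real (inverse (real (T w))) * iexpz \<eta> (walk_T w)) / (\<eta> - z)))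
    = - of_real (1 - q) * line_integral \<gamma> (\<lambda>\<eta>. Ln (1 - of_real q * Phi M Y \<eta>) / (\<eta> - z))"
    unfolding line_integral_def integral_mult_right_zero[symmetric]
    by (simp only: h' times_divide_eq_right of_real_0 mult_zero_right exp_zero mult_1)
  also have "x * (- r * i) = r * (- x * i)" for x r i :: complex by simp
  finally have "of_real (1 - q) * log_plus z = of_real (1 - q) * (- (1 / (2 * of_real pi * \<i>)) * line_integral \<gamma> (\<lambda>\<eta>. Ln (1 - of_real q * Phi M Y \<eta>) / (\<eta> - z)))" .
  then show ?thesis using q by (subst (asm) mult_cancel_left) auto
qed

text \<open>The Cauchy integral is evaluated at z = 0, which lies above the line because \<alpha> <
  0; in particular \<open>c_plus\<close> does not depend on \<alpha>.\<close>

lemma c_plus_eq: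
  assumes "\<mu>m < \<alpha>" "\<alpha> < 0"
  shows "c_plus M Y q \<alpha> = exp (- log_plus 0)"
  using assms mu by (subst log_plus_eq_line_integral[of \<alpha>]) (auto simp: c_plus_def)

text \<open>The weight (1 + |s|)^(\<delta>/4) is shared by Peetre's inequality between the
  logarithm, of exponent \<delta>, and the Cauchy kernel, of exponent 1. There remain 3\<delta>/4
  and 1 - \<delta>/4, whose sum 1 + \<delta>/2 exceeds 1, so the integral is bounded uniformly in
  s.\<close>

lemma log_plus_decay:
  assumes v: "\<mu>m < v" "v \<le> \<mu>p"
  obtains C where "C \<ge> 0" "\<And>s. norm (log_plus (Complex s v)) \<le> C * decay (\<delta> / 4) s"
proof -
  \<comment> \<open>Any height from \<mu>m up to, but strictly below, v would serve; the gap to v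
    keeps the Cauchy kernel bounded.\<close>
  define \<gamma> where "\<gamma> = (\<mu>m + v) / 2"
  have g: "\<mu>m \<le> \<gamma>" "\<gamma> \<le> \<mu>p" "\<gamma> < v" using v by (auto simp: \<gamma>_def)
  obtain C where C: "C \<ge> 0" "\<And>t. norm (Ln (1 - of_real q * Phi M Y (Complex t \<gamma>))) \<le> C * decay \<delta> t"
    using Ln_decay[OF g(1,2)] by blast
  define d where "d = (1 + \<bar>\<gamma> - v\<bar>) / \<bar>\<gamma> - v\<bar>"
  have d: "d \<ge> 0" by (simp add: d_def)
  define K where "K = d * C * (2 * (LINT t|lborel. decay (3 * \<delta> / 4 + (1 - \<delta> / 4)) t))"
  show ?thesis
  proof (rule that)
    show "0 \<le> K / (2 * pi)" unfolding K_def using d C by (intro divide_nonneg_nonneg mult_nonneg_nonneg) auto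
    fix s
    define w where "w = (1 + \<bar>s\<bar>) powr (\<delta> / 4)"
    have w: "w > 0" by (simp add: w_def)
    have int: "integrable lborel (\<lambda>t. Ln (1 - of_real q * Phi M Y (Complex t \<gamma>)) / (Complex t \<gamma> - Complex s v))"
      using line_integrable_Ln_divide[OF g(1,2), of "Complex s v"] g(3) by (simp add: line_integrable_def)
    have le: "w * norm (Ln (1 - of_real q * Phi M Y (Complex t \<gamma>)) / (Complex t \<gamma> - Complex s v)) \<le>
        d * C * (decay (3 * \<delta> / 4) t * decay (1 - \<delta> / 4) (t - s))" for t
    proof -
      have "w \<le> ((1 + \<bar>t\<bar>) * (1 + \<bar>t - s\<bar>)) powr (\<delta> / 4)"
        unfolding w_def using delta by (intro powr_mono2 one_plus_abs_le_mult) auto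
      also have "\<dots> = (1 + \<bar>t\<bar>) powr (\<delta> / 4) * (1 + \<bar>t - s\<bar>) powr (\<delta> / 4)"
        by (rule powr_mult)
      finally have 1: "w \<le> (1 + \<bar>t\<bar>) powr (\<delta> / 4) * (1 + \<bar>t - s\<bar>) powr (\<delta> / 4)" .
      have "norm (Ln (1 - of_real q * Phi M Y (Complex t \<gamma>)) / (Complex t \<gamma> - Complex s v)) \<le>
         d * (norm (Ln (1 - of_real q * Phi M Y (Complex t \<gamma>))) * decay 1 (t - s))"
        unfolding d_def using g(3) by (intro norm_divide_line_diff_le) auto
      also have "\<dots> \<le> d * ((C * decay \<delta> t) * decay 1 (t - s))"
        using C d by (intro mult_left_mono mult_right_mono) auto
      finally have "w * norm (Ln (1 - of_real q * Phi M Y (Complex t \<gamma>)) / (Complex t \<gamma> - Complex s v)) \<le>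
         ((1 + \<bar>t\<bar>) powr (\<delta> / 4) * (1 + \<bar>t - s\<bar>) powr (\<delta> / 4)) * (d * ((C * decay \<delta> t) * decay 1 (t - s)))"
        by (intro mult_mono 1) auto
      also have "\<dots> = d * C * (((1 + \<bar>t\<bar>) powr (\<delta> / 4) * decay \<delta> t) * ((1 + \<bar>t - s\<bar>) powr (\<delta> / 4) * decay 1 (t - s)))"
        by (simp only: mult_ac)
      also have "(1 + \<bar>t\<bar>) powr (\<delta> / 4) * decay \<delta> t = decay (3 * \<delta> / 4) t"
        unfolding powr_add[symmetric] by (simp add: field_simps)
      also have "(1 + \<bar>t - s\<bar>) powr (\<delta> / 4) * decay 1 (t - s) = decay (1 - \<delta> / 4) (t - s)"
        unfolding powr_add[symmetric] by (simp add: algebra_simps)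
      finally show ?thesis .
    qed
    have "w * norm (line_integral \<gamma> (\<lambda>\<eta>. Ln (1 - of_real q * Phi M Y \<eta>) / (\<eta> - Complex s v))) \<le>
        w * (LINT t|lborel. norm (Ln (1 - of_real q * Phi M Y (Complex t \<gamma>)) / (Complex t \<gamma> - Complex s v)))"
      using w unfolding line_integral_def by (intro mult_left_mono integral_norm_bound) auto
    also have "\<dots> = (LINT t|lborel. w * norm (Ln (1 - of_real q * Phi M Y (Complex t \<gamma>)) / (Complex t \<gamma> - Complex s v)))"
      by (rule integral_mult_right_zero[symmetric])
    also have "\<dots> \<le> (LINT t|lborel. d * C * (decay (3 * \<delta> / 4) t * decay (1 - \<delta> / 4) (t - s)))"
    proof (rule integral_mono)
      show "integrable lborel (\<lambda>t. w * norm (Ln (1 - of_real q * Phi M Y (Complex t \<gamma>)) / (Complex t \<gamma> - Complex s v)))"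
        by (rule integrable_mult_right[OF integrable_norm[OF int]])
      show "integrable lborel (\<lambda>t. d * C * (decay (3 * \<delta> / 4) t * decay (1 - \<delta> / 4) (t - s)))"
        by (rule integrable_mult_right[OF integrable_powr_shift]) (use delta in auto)
    qed (rule le)
    also have "\<dots> = d * C * (LINT t|lborel. (decay (3 * \<delta> / 4) t * decay (1 - \<delta> / 4) (t - s)))"
      by (rule integral_mult_right_zero)
    also have "\<dots> \<le> K"
      unfolding K_def by (rule mult_left_mono[OF integral_powr_shift_le]) (use delta d C(1) in auto)
    finally have "w * norm (line_integral \<gamma> (\<lambda>\<eta>. Ln (1 - of_real q * Phi M Y \<eta>) / (\<eta> - Complex s v))) / (2 * pi) \<le> K / (2 * pi)"
      by (intro divide_right_mono) auto
    moreover have "norm (log_plus (Complex s v)) = norm (line_integral \<gamma> (\<lambda>\<eta>. Ln (1 - of_real q * Phi M Y \<eta>) / (\<eta> - Complex s v))) / (2 * pi)"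
      using log_plus_eq_line_integral[OF g(1,2), of "Complex s v"] g(3) by (simp add: norm_mult norm_divide)
    ultimately have "w * norm (log_plus (Complex s v)) \<le> K / (2 * pi)" by (simp only: times_divide_eq_right)
    then have "norm (log_plus (Complex s v)) \<le> K / (2 * pi) / w" using w by (simp only: pos_le_divide_eq mult.commute)
    also have "\<dots> = K / (2 * pi) * decay (\<delta> / 4) s"
      unfolding w_def powr_minus divide_inverse ..
    finally show "norm (log_plus (Complex s v)) \<le> K / (2 * pi) * decay (\<delta> / 4) s" .
  qed
qed

lemma exp_log_plus_decay:
  assumes v: "\<mu>m < v" "v \<le> \<mu>p"
  obtains C where "C \<ge> 0" "\<And>s. norm (exp (log_plus (Complex s v)) - 1) \<le> C * decay (\<delta> / 4) s"
proof -
  obtain C where C: "C \<ge> 0" "\<And>s. norm (log_plus (Complex s v)) \<le> C * decay (\<delta> / 4) s"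
    using log_plus_decay[OF v] by blast
  show ?thesis
  proof (rule that)
    show "0 \<le> C * exp C" using C by simp
    fix s
    have "decay (\<delta> / 4) s \<le> (1 + \<bar>s\<bar>) powr 0" using delta by (intro powr_mono) auto
    moreover have "1 + \<bar>s\<bar> \<noteq> 0" by linarith
    ultimately have "C * decay (\<delta> / 4) s \<le> C * 1" using C by (intro mult_left_mono) auto
    then have "norm (log_plus (Complex s v)) \<le> C" using C(2)[of s] by linarith
    then have "norm (log_plus (Complex s v)) * exp (norm (log_plus (Complex s v))) \<le> (C * decay (\<delta> / 4) s) * exp C"
      using C by (intro mult_mono) auto
    then show "norm (exp (log_plus (Complex s v)) - 1) \<le> C * exp C * decay (\<delta> / 4) s"
      using norm_exp_minus_1_le[of "log_plus (Complex s v)"] by (simp add: mult_ac)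
  qed
qed

text \<open>Total mass 1 at x = z = 0. This normalization trades the factor 1 - q for values of the
  logarithmic transforms at 0.\<close>

lemma exp_log_zero: "of_real (1 - q) * exp (log_plus 0) * exp (log_minus 0) = 1"
  using joint_transform_eq[of 0 0] mu by (simp add: joint_transform_def prob_space)

lemma phi_plus_eq:
  assumes "\<mu>m < Im z"
  shows "phi_plus M Y T z = exp (log_plus z - log_plus 0)"
proof -
  have "phi_plus M Y T z = joint_transform z 0" by (simp add: phi_plus_def joint_transform_def)
  also have "\<dots> = of_real (1 - q) * exp (log_plus z) * exp (log_minus 0)"
    using assms mu by (intro joint_transform_eq) auto
  also have "\<dots> = (of_real (1 - q) * exp (log_plus 0) * exp (log_minus 0)) * exp (log_plus z - log_plus 0)"
    by (simp add: exp_diff)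
  finally show ?thesis unfolding exp_log_zero by simp
qed

lemma phi_pp_eq:
  assumes "\<mu>m < \<alpha>" "\<alpha> < 0" "\<mu>m < Im z"
  shows "phi_pp M Y q T \<alpha> z = exp (- log_plus 0) * (exp (log_plus z) - 1)"
  using assms by (simp add: phi_pp_def phi_plus_eq c_plus_eq exp_diff exp_minus field_simps)

section \<open>Reflection of the walk and the minus factor\<close>

lemma walk_uminus: "walk (\<lambda>n w. - Y n w) n w = - walk Y n w"
  by (simp add: walk_def sum_negf)

lemma walk_max_uminus: "walk_max (\<lambda>n w. - Y n w) n w = - walk_min Y n w"
proof -
  have "- Min ((\<lambda>m. walk Y m w) ` {0..n}) = Max (uminus ` (\<lambda>m. walk Y m w) ` {0..n})"
    by (subst minus_Min_eq_Max) auto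
  then show ?thesis by (simp add: walk_max_def walk_min_def walk_uminus image_image)
qed

lemma Phi_uminus: "Phi M (\<lambda>n w. - Y n w) z = Phi M Y (- z)"
  by (simp add: Phi_def)

text \<open>The strip is mirrored, and the exponent \<delta> stays. T remains independent of the
  reflected path because negation is measurable on path space, so that path generates no sets beyond
  those of the original one.\<close>

lemma geometric_walk_uminus: "geometric_walk M (\<lambda>n w. - Y n w) T q (- \<mu>p) (- \<mu>m) \<delta>"
proof unfold_locales
  show "indep_vars (\<lambda>_. borel) (\<lambda>n w. - Y n w) UNIV"
    using indep_vars_compose2[OF indep, where Y = "\<lambda>_ y. - y" and N = "\<lambda>_. borel"] by simp
  show "distr M borel (\<lambda>w. - Y n w) = distr M borel (\<lambda>w. - Y 0 w)" for n
  proof -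
    have *: "distr M borel (\<lambda>w. - Y n w) = distr (distr M borel (Y n)) borel uminus" for n
      by (subst distr_distr) (auto simp: comp_def)
    show ?thesis unfolding *[of n] *[of 0] ident[of n] ..
  qed
  show "0 < q" "q < 1" by (fact q)+
  have "(\<lambda>w n. walk (\<lambda>n w. - Y n w) n w) -` B \<inter> space M \<in> {(\<lambda>w n. walk Y n w) -` B \<inter> space M |B. B \<in> sets (Pi\<^sub>M UNIV (\<lambda>_. borel))}"
    if B: "B \<in> sets (Pi\<^sub>M UNIV (\<lambda>_. borel))" for B
  proof -
    define B' where "B' = (\<lambda>x n. - x n) -` B \<inter> space (Pi\<^sub>M UNIV (\<lambda>_. borel :: real measure))"
    have "(\<lambda>x n. - x n) \<in> measurable (Pi\<^sub>M UNIV (\<lambda>_. borel :: real measure)) (Pi\<^sub>M UNIV (\<lambda>_. borel))"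
      by (rule measurable_PiM_single') (auto simp: space_PiM)
    from measurable_sets[OF this B] have "B' \<in> sets (Pi\<^sub>M UNIV (\<lambda>_. borel))" by (simp add: B'_def)
    moreover have "(\<lambda>w n. walk (\<lambda>n w. - Y n w) n w) -` B \<inter> space M = (\<lambda>w n. walk Y n w) -` B' \<inter> space M"
      by (intro set_eqI) (simp add: B'_def walk_uminus space_PiM)
    ultimately show ?thesis by (intro CollectI exI[of _ B'] conjI)
  qed
  then have "indep_set {T -` A \<inter> space M |A. A \<in> sets (count_space UNIV)}
     {(\<lambda>w n. walk (\<lambda>n w. - Y n w) n w) -` B \<inter> space M |B. B \<in> sets (Pi\<^sub>M UNIV (\<lambda>_. borel))}"
  proof -
    assume sub: "\<And>B. B \<in> sets (Pi\<^sub>M UNIV (\<lambda>_. borel)) \<Longrightarrow>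
      (\<lambda>w n. walk (\<lambda>n w. - Y n w) n w) -` B \<inter> space M \<in> {(\<lambda>w n. walk Y n w) -` B \<inter> space M |B. B \<in> sets (Pi\<^sub>M UNIV (\<lambda>_. borel))}"
    have ind: "indep_set {T -` A \<inter> space M |A. A \<in> sets (count_space UNIV)}
       {(\<lambda>w n. walk Y n w) -` B \<inter> space M |B. B \<in> sets (Pi\<^sub>M UNIV (\<lambda>_. borel))}"
      using geometric by (simp add: indep_geometric_time_def)
    have le: "{(\<lambda>w n. walk (\<lambda>n w. - Y n w) n w) -` B \<inter> space M |B. B \<in> sets (Pi\<^sub>M UNIV (\<lambda>_. borel))} \<subseteq>
       {(\<lambda>w n. walk Y n w) -` B \<inter> space M |B. B \<in> sets (Pi\<^sub>M UNIV (\<lambda>_. borel))}" (is "?L \<subseteq> ?R")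
    proof
      fix A assume "A \<in> ?L"
      then obtain B where "A = (\<lambda>w n. walk (\<lambda>n w. - Y n w) n w) -` B \<inter> space M" "B \<in> sets (Pi\<^sub>M UNIV (\<lambda>_. borel))"
        by (elim CollectE exE conjE)
      with sub show "A \<in> ?R" by (simp only:)
    qed
    show ?thesis by (rule indep_set_mono[OF ind le])
  qed
  then show "indep_geometric_time M (\<lambda>n w. - Y n w) q T"
    using geometric by (simp add: indep_geometric_time_def)
  show "- \<mu>p < 0" "0 < - \<mu>m" using mu by auto
  show "integrable M (\<lambda>w. exp (- \<gamma> * - Y 0 w))" if "- \<mu>p \<le> \<gamma>" "\<gamma> \<le> - \<mu>m" for \<gamma>
    using mgf_integrable[of "- \<gamma>"] that by simp
  show "q * (LINT w|M. exp (- \<gamma> * - Y 0 w)) < 1" if "- \<mu>p \<le> \<gamma>" "\<gamma> \<le> - \<mu>m" for \<gamma>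
    using mgf_less[of "- \<gamma>"] that by simp
  show "0 < \<delta>" "\<delta> \<le> 1" by (fact delta)+
  show "\<exists>C. \<forall>t. norm (Phi M (\<lambda>n w. - Y n w) (Complex t \<gamma>)) \<le> C * decay \<delta> t"
    if "- \<mu>p \<le> \<gamma>" "\<gamma> \<le> - \<mu>m" for \<gamma>
  proof -
    obtain C where C: "\<And>t. norm (Phi M Y (Complex t (- \<gamma>))) \<le> C * decay \<delta> t"
      using Phi_decay[of "- \<gamma>"] \<open>- \<mu>p \<le> \<gamma>\<close> \<open>\<gamma> \<le> - \<mu>m\<close> by auto
    have "norm (Phi M (\<lambda>n w. - Y n w) (Complex t \<gamma>)) \<le> C * decay \<delta> t" for t
      using C[of "- t"] by (simp add: Phi_uminus minus_Complex)
    then show ?thesis by blast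
  qed
qed

text \<open>Reflection maps {..0} to {0..}. The difference from {0<..} is the event that the walk at
  T is 0, on which almost surely T = 0 and the weight is 0.\<close>

lemma log_minus_eq_uminus:
  "log_minus z = geometric_walk.log_plus M (\<lambda>n w. - Y n w) T q (- z)"
proof -
  interpret neg: geometric_walk M "\<lambda>n w. - Y n w" T q "- \<mu>p" "- \<mu>m" \<delta> by (rule geometric_walk_uminus)
  have "(LINT w|M. of_real (inverse (real (T w)) * indicator {..0} (walk_T w)) * iexpz z (walk_T w)) =
     (LINT w|M. of_real (inverse (real (T w)) * indicator {0<..} (- walk_T w)) * iexpz (- z) (- walk_T w))"
  proof (rule integral_cong_AE)
    show "AE w in M. of_real (inverse (real (T w)) * indicator {..0} (walk_T w)) * iexpz z (walk_T w) =
      of_real (inverse (real (T w)) * indicator {0<..} (- walk_T w)) * iexpz (- z) (- walk_T w)"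
      using AE_walk_T_neq[of 0] by eventually_elim (auto simp: indicator_def)
  qed measurable
  then show ?thesis by (simp add: log_minus_def neg.log_plus_def walk_uminus)
qed

lemma exp_log_minus_decay:
  assumes v: "\<mu>m \<le> v" "v < \<mu>p"
  obtains C where "C \<ge> 0" "\<And>s. norm (exp (log_minus (Complex s v)) - 1) \<le> C * decay (\<delta> / 4) s"
proof -
  interpret neg: geometric_walk M "\<lambda>n w. - Y n w" T q "- \<mu>p" "- \<mu>m" \<delta> by (rule geometric_walk_uminus)
  obtain C where C: "C \<ge> 0" "\<And>s. norm (exp (neg.log_plus (Complex s (- v))) - 1) \<le> C * decay (\<delta> / 4) s"
    using neg.exp_log_plus_decay[of "- v"] v by auto
  show ?thesis
  proof (rule that[OF C(1)])
    show "norm (exp (log_minus (Complex s v)) - 1) \<le> C * decay (\<delta> / 4) s" for s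
      using C(2)[of "- s"] by (simp add: log_minus_eq_uminus minus_Complex)
  qed
qed

text \<open>The minimum is minus the maximum of the reflected walk, so the factor follows from the
  plus case at -z. That \<open>log_minus\<close> also governs the excess in
  \<open>joint_transform_eq\<close> reflects the duality between the minimum and the walk minus its
  maximum.\<close>

lemma phi_mm_eq:
  assumes "0 < \<beta>" "\<beta> < \<mu>p" "Im z < \<mu>p"
  shows "phi_mm M Y q T \<beta> z = exp (- log_minus 0) * (exp (log_minus z) - 1)"
proof -
  interpret neg: geometric_walk M "\<lambda>n w. - Y n w" T q "- \<mu>p" "- \<mu>m" \<delta> by (rule geometric_walk_uminus)
  have "phi_minus M Y T z = phi_plus M (\<lambda>n w. - Y n w) T (- z)"
    by (simp add: phi_minus_def phi_plus_def walk_max_uminus)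
  moreover have "c_minus M Y q \<beta> = c_plus M (\<lambda>n w. - Y n w) q (- \<beta>)"
    unfolding c_minus_def c_plus_def line_integral_minus by (simp add: Phi_uminus line_integral_def)
  ultimately have "phi_mm M Y q T \<beta> z = phi_pp M (\<lambda>n w. - Y n w) q T (- \<beta>) (- z)"
    by (simp add: phi_mm_def phi_pp_def)
  then show ?thesis
    using assms by (simp add: neg.phi_pp_eq log_minus_eq_uminus)
qed

end

section \<open>The single and the double integral\<close>

context geometric_walk begin

text \<open>Followed up the imaginary axis, the transform of a nonnegative variable converges to the
  mass of its atom at 0; for a nonpositive variable the same holds going down.\<close>

lemma exp_imaginary_tendsto:
  assumes "0 \<le> x"
  shows "(\<lambda>n. exp (\<i> * Complex 0 (real n) * of_real x)) \<longlonglongrightarrow> indicator {0} x"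
proof (cases "x = 0")
  case False
  then have "x > 0" using assms by simp
  then have "(\<lambda>n. exp (- (real n * x))) \<longlonglongrightarrow> 0" by real_asymp
  then have "(\<lambda>n. complex_of_real (exp (- (real n * x)))) \<longlonglongrightarrow> of_real 0" by (rule tendsto_of_real)
  moreover have "exp (\<i> * Complex 0 (real n) * of_real x) = of_real (exp (- (real n * x)))" for n
    using exp_Complex_mult_split[of 0 "real n" x] by simp
  ultimately show ?thesis using False by simp
qed simp

lemma norm_exp_imaginary_le: "0 \<le> x \<Longrightarrow> norm (exp (\<i> * Complex 0 (real n) * of_real x)) \<le> 1"
  by simp

lemma log_plus_tendsto: "(\<lambda>n. log_plus (Complex 0 (real n))) \<longlonglongrightarrow> 0"
proof -
  have "(\<lambda>n. LINT w|M. of_real (inverse (real (T w)) * indicator {0<..} (walk_T w)) * iexpz (Complex 0 (real n)) (walk_T w))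
    \<longlonglongrightarrow> (LINT w|M. (0::complex))"
  proof (rule integral_tendsto_dominated[where w = "\<lambda>_. 1"])
    show "norm (complex_of_real (inverse (real (T w)) * indicator {0<..} (walk_T w)) * iexpz (Complex 0 (real n)) (walk_T w)) \<le> 1" for n w
      by (auto simp: norm_mult norm_inverse indicator_def intro!: mult_le_one inverse_real_nat_le)
    show "(\<lambda>n. complex_of_real (inverse (real (T w)) * indicator {0<..} (walk_T w)) * iexpz (Complex 0 (real n)) (walk_T w)) \<longlonglongrightarrow> 0" for w
    proof (cases "walk_T w > 0")
      case True
      then have "(\<lambda>n. iexpz (Complex 0 (real n)) (walk_T w)) \<longlonglongrightarrow> 0"
        using exp_imaginary_tendsto[of "walk_T w"] by simp
      then show ?thesis by (rule tendsto_mult_right_zero)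
    qed simp
  qed measurable
  from tendsto_mult_right_zero[OF this[simplified], of "1 / of_real (1 - q)"]
  show ?thesis by (simp add: log_plus_def)
qed

lemma log_minus_tendsto: "(\<lambda>n. log_minus (Complex 0 (- real n))) \<longlonglongrightarrow> 0"
proof -
  interpret neg: geometric_walk M "\<lambda>n w. - Y n w" T q "- \<mu>p" "- \<mu>m" \<delta> by (rule geometric_walk_uminus)
  show ?thesis using neg.log_plus_tendsto by (simp add: log_minus_eq_uminus minus_Complex)
qed

text \<open>Letting x run up the imaginary axis in \<open>joint_transform_eq\<close> isolates M = 0
  on the left and sends log_plus to 0 on the right. At z = 0 the mass of the atom is (1 - q)
  exp(log_minus 0) = exp(-log_plus 0), the value of \<open>c_plus\<close>.\<close>

lemma integral_max_eq_0:
  assumes z: "Im z < \<mu>p"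
  shows "(LINT w|M. indicator {0} (max_T w) * iexpz z (excess_T w)) = of_real (1 - q) * exp (log_minus z)"
proof (rule LIMSEQ_unique)
  have int: "integrable M (\<lambda>w. iexpz z (excess_T w))"
    using integrable_joint[of 0 z] z mu by simp
  show "(\<lambda>n. joint_transform (Complex 0 (real n)) z) \<longlonglongrightarrow> (LINT w|M. indicator {0} (max_T w) * iexpz z (excess_T w))"
    unfolding joint_transform_def
  proof (rule integral_tendsto_dominated[OF _ integrable_norm[OF int]])
    show "norm (iexpz (Complex 0 (real n)) (max_T w) * iexpz z (excess_T w))
        \<le> norm (iexpz z (excess_T w))" for n w
      unfolding norm_mult by (intro mult_left_le_one_le norm_exp_imaginary_le walk_max_nonneg) auto
    show "(\<lambda>n. iexpz (Complex 0 (real n)) (max_T w) * iexpz z (excess_T w))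
      \<longlonglongrightarrow> indicator {0} (max_T w) * iexpz z (excess_T w)" for w
      by (intro tendsto_mult tendsto_const exp_imaginary_tendsto walk_max_nonneg)
  qed measurable
  have "(\<lambda>n. of_real (1 - q) * exp (log_plus (Complex 0 (real n))) * exp (log_minus z)) \<longlonglongrightarrow> of_real (1 - q) * exp 0 * exp (log_minus z)"
    by (intro tendsto_intros log_plus_tendsto)
  moreover have "joint_transform (Complex 0 (real n)) z = of_real (1 - q) * exp (log_plus (Complex 0 (real n))) * exp (log_minus z)" for n
    using z mu by (intro joint_transform_eq) auto
  ultimately show "(\<lambda>n. joint_transform (Complex 0 (real n)) z) \<longlonglongrightarrow> of_real (1 - q) * exp (log_minus z)"
    by simp
qed

lemma exp_imaginary_excess_tendsto:
  "(\<lambda>n. iexpz (Complex 0 (- real n)) (excess m w)) \<longlonglongrightarrow> indicator {0} (excess m w)"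
proof -
  have "\<i> * Complex 0 (- real n) * of_real (excess m w) = \<i> * Complex 0 (real n) * of_real (- excess m w)" for n
    by (simp add: Complex_eq algebra_simps)
  moreover have "indicator {0} (excess m w) = (indicator {0} (- excess m w) :: complex)" by (simp add: indicator_def)
  moreover have "0 \<le> - excess m w" using excess_nonpos[of m w] by simp
  ultimately show ?thesis using exp_imaginary_tendsto[of "- excess m w"] by (simp only:)
qed

lemma norm_exp_imaginary_excess_le: "norm (iexpz (Complex 0 (- real n)) (excess m w)) \<le> 1"
  using mult_nonneg_nonpos[OF _ excess_nonpos, of "real n" m w] by simp

lemma integral_excess_eq_0:
  assumes x: "\<mu>m < Im x"
  shows "(LINT w|M. iexpz x (max_T w) * indicator {0} (excess_T w)) = of_real (1 - q) * exp (log_plus x)"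
proof (rule LIMSEQ_unique)
  have int: "integrable M (\<lambda>w. iexpz x (max_T w))"
    using integrable_joint[of x 0] x mu by simp
  show "(\<lambda>n. joint_transform x (Complex 0 (- real n))) \<longlonglongrightarrow> (LINT w|M. iexpz x (max_T w) * indicator {0} (excess_T w))"
    unfolding joint_transform_def
  proof (rule integral_tendsto_dominated[OF _ integrable_norm[OF int]])
    show "norm (iexpz x (max_T w) * iexpz (Complex 0 (- real n)) (excess_T w))
        \<le> norm (iexpz x (max_T w))" for n w
      unfolding norm_mult by (intro mult_right_le_one_le norm_exp_imaginary_excess_le) auto
    show "(\<lambda>n. iexpz x (max_T w) * iexpz (Complex 0 (- real n)) (excess_T w))
      \<longlonglongrightarrow> iexpz x (max_T w) * indicator {0} (excess_T w)" for w
      by (intro tendsto_mult tendsto_const exp_imaginary_excess_tendsto)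
  qed measurable
  have "(\<lambda>n. of_real (1 - q) * exp (log_plus x) * exp (log_minus (Complex 0 (- real n)))) \<longlonglongrightarrow> of_real (1 - q) * exp (log_plus x) * exp 0"
    by (intro tendsto_intros log_minus_tendsto)
  moreover have "joint_transform x (Complex 0 (- real n)) = of_real (1 - q) * exp (log_plus x) * exp (log_minus (Complex 0 (- real n)))" for n
    using x mu by (intro joint_transform_eq) auto
  ultimately show "(\<lambda>n. joint_transform x (Complex 0 (- real n))) \<longlonglongrightarrow> of_real (1 - q) * exp (log_plus x)"
    by simp
qed

lemma integral_max_excess_eq_0:
  "(LINT w|M. indicator {0} (max_T w) * indicator {0} (excess_T w)) = complex_of_real (1 - q)"
proof (rule LIMSEQ_unique)
  define a where "a n = (LINT w|M. indicator {0} (max_T w) * iexpz (Complex 0 (- real n)) (excess_T w))" for n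
  show "a \<longlonglongrightarrow> (LINT w|M. indicator {0} (max_T w) * indicator {0} (excess_T w))"
    unfolding a_def
  proof (rule integral_tendsto_dominated[where w = "\<lambda>_. 1"])
    show "norm (indicator {0} (max_T w) * iexpz (Complex 0 (- real n)) (excess_T w)) \<le> 1" for n w
      unfolding norm_mult by (intro mult_le_one norm_exp_imaginary_excess_le) (auto simp: indicator_def)
    show "(\<lambda>n. indicator {0} (max_T w) * iexpz (Complex 0 (- real n)) (excess_T w))
      \<longlonglongrightarrow> indicator {0} (max_T w) * indicator {0} (excess_T w)" for w
      by (intro tendsto_mult tendsto_const exp_imaginary_excess_tendsto)
  qed measurable
  have "(\<lambda>n. of_real (1 - q) * exp (log_minus (Complex 0 (- real n)))) \<longlonglongrightarrow> of_real (1 - q) * exp 0"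
    by (intro tendsto_intros log_minus_tendsto)
  moreover have "a = (\<lambda>n. of_real (1 - q) * exp (log_minus (Complex 0 (- real n))))"
    unfolding a_def using mu by (intro ext integral_max_eq_0) auto
  ultimately show "a \<longlonglongrightarrow> complex_of_real (1 - q)" by simp
qed

text \<open>Removing the atoms of the two independent factors at \<open>0\<close>, whose masses are \<open>c\<^sup>+\<close> and \<open>c\<^sup>-\<close>.\<close>
lemma
  assumes x: "\<mu>m < Im x" and z: "Im z < \<mu>p"
  shows integrable_joint_pos_neg: "integrable M (\<lambda>w. indicator {0<..} (max_T w) * indicator {..<0} (excess_T w) *
        iexpz z (excess_T w) * iexpz x (max_T w))"
    and integral_joint_pos_neg: "(LINT w|M. indicator {0<..} (max_T w) * indicator {..<0} (excess_T w) *
        iexpz z (excess_T w) * iexpz x (max_T w))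
      = of_real (1 - q) * (exp (log_plus x) - 1) * (exp (log_minus z) - 1)"
proof -
  define m d where "m w = max_T w" and "d w = excess_T w" for w
  define ex ez where "ex w = iexpz x (m w)" and "ez w = iexpz z (d w)" for w
  have [measurable]: "m \<in> borel_measurable M" "d \<in> borel_measurable M" unfolding m_def d_def by measurable
  have [measurable]: "ex \<in> borel_measurable M" "ez \<in> borel_measurable M" unfolding ex_def ez_def by measurable
  have m0: "0 \<le> m w" and d0: "d w \<le> 0" for w
    using walk_max_nonneg excess_nonpos by (auto simp: m_def d_def)
  have i0: "integrable M (\<lambda>w. ex w * ez w)"
    using integrable_joint[of x z] x z by (simp add: ex_def ez_def m_def d_def)
  have ind: "integrable M (\<lambda>w. f w * (ex w * ez w))"
    if "f \<in> borel_measurable M" "\<And>w. norm (f w) \<le> 1" for f :: "'a \<Rightarrow> complex"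
    by (rule Bochner_Integration.integrable_bound[OF i0])
       (use that in \<open>auto simp: norm_mult mult_left_le_one_le\<close>)
  \<comment> \<open>Inclusion-exclusion for the events m = 0 and d = 0, using m >= 0 >= d. On such
    an event the corresponding exponential equals 1.\<close>
  have eq: "indicator {0<..} (m w) * indicator {..<0} (d w) * ez w * ex w =
     ex w * ez w - indicator {0} (m w) * ez w - ex w * indicator {0} (d w) + indicator {0} (m w) * indicator {0} (d w)" for w
    using m0[of w] d0[of w] by (auto simp: indicator_def ex_def ez_def)
  have e: "indicator {0} (m w) * (ex w * ez w) = indicator {0} (m w) * ez w"
    "indicator {0} (d w) * (ex w * ez w) = ex w * indicator {0} (d w)"
    "indicator {0} (m w) * indicator {0} (d w) * (ex w * ez w) = indicator {0} (m w) * indicator {0} (d w)" for w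
    by (auto simp: indicator_def ex_def ez_def)
  have i1: "integrable M (\<lambda>w. indicator {0} (m w) * ez w)"
    by (rule ind[of "\<lambda>w. indicator {0} (m w)", unfolded e]) (measurable, simp add: indicator_def)
  have i2: "integrable M (\<lambda>w. ex w * indicator {0} (d w))"
    by (rule ind[of "\<lambda>w. indicator {0} (d w)", unfolded e]) (measurable, simp add: indicator_def)
  have i3: "integrable M (\<lambda>w. indicator {0} (m w) * indicator {0} (d w) :: complex)"
    by (rule ind[of "\<lambda>w. indicator {0} (m w) * indicator {0} (d w)", unfolded e]) (measurable, simp add: indicator_def)
  have "integrable M (\<lambda>w. indicator {0<..} (m w) * indicator {..<0} (d w) * ez w * ex w)"
    unfolding eq by (intro Bochner_Integration.integrable_add Bochner_Integration.integrable_diff i0 i1 i2 i3)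
  then show "integrable M (\<lambda>w. indicator {0<..} (max_T w) * indicator {..<0} (excess_T w) *
        iexpz z (excess_T w) * iexpz x (max_T w))"
    by (simp only: m_def d_def ex_def ez_def)
  have "(LINT w|M. indicator {0<..} (m w) * indicator {..<0} (d w) * ez w * ex w) =
     (LINT w|M. ex w * ez w) - (LINT w|M. indicator {0} (m w) * ez w) - (LINT w|M. ex w * indicator {0} (d w)) + (LINT w|M. indicator {0} (m w) * indicator {0} (d w))"
    unfolding eq using i0 i1 i2 i3 by simp
  also have "\<dots> = of_real (1 - q) * exp (log_plus x) * exp (log_minus z) - of_real (1 - q) * exp (log_minus z) - of_real (1 - q) * exp (log_plus x) + of_real (1 - q)"
    using joint_transform_eq[OF x z] integral_max_eq_0[OF z] integral_excess_eq_0[OF x] integral_max_excess_eq_0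
    by (simp add: joint_transform_def m_def d_def ex_def ez_def)
  finally show "(LINT w|M. indicator {0<..} (max_T w) * indicator {..<0} (excess_T w) *
        iexpz z (excess_T w) * iexpz x (max_T w))
      = of_real (1 - q) * (exp (log_plus x) - 1) * (exp (log_minus z) - 1)"
    by (simp add: m_def d_def ex_def ez_def algebra_simps)
qed

text \<open>Dropping T = 0 starts the geometric series at n = 1 and gives q\<Phi>/(1 - q\<Phi>),
  which inherits the decay of \<Phi> because 1 - q\<Phi> stays away from 0 on the line. The dropped
  term has a constant transform; it becomes the leading indicator of the value function.\<close>

lemma
  assumes \<omega>: "0 < \<omega>" "\<omega> < \<mu>p"
  shows line_integrable_single: "line_integrable \<omega> (single_integrand M Y q a1 x1)"
    and integral_single: "(LINT w|M. of_real (indicator {1..} (T w)) * indicator {..a1 - x1} (walk_T w)) =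
      of_real (1 - q) * (1 / (2 * of_real pi) * line_integral \<omega> (single_integrand M Y q a1 x1))"
proof -
  define h where "h \<eta> = (LINT w|M. of_real (indicator {1..} (T w)) * iexpz \<eta> (walk_T w))" for \<eta>
  have [measurable]: "(\<lambda>w. complex_of_real (indicator {1..} (T w))) \<in> borel_measurable M" by (rule measurable_T)
  have h_eq: "h \<eta> = of_real (1 - q) * (of_real q * Phi M Y \<eta> / (1 - of_real q * Phi M Y \<eta>))" if "Im \<eta> = \<omega>" for \<eta>
  proof -
    have z: "\<mu>m \<le> Im \<eta>" "Im \<eta> \<le> \<mu>p" using that \<omega> mu by auto
    have "(\<lambda>n. of_real ((1 - q) * q ^ n) * (LINT w|M. of_real (indicator {1..} n) * iexpz \<eta> (walk Y n w))) sums h \<eta>"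
      unfolding h_def by (intro sums_walk_at_T[OF z]) (auto simp: indicator_def)
    then have 1: "(\<lambda>n. of_real ((1 - q) * q ^ n) * (of_real (indicator {1..} n) * Phi M Y \<eta> ^ n)) sums h \<eta>"
      unfolding integral_mult_right_zero integral_exp_walk[OF z] .
    have "(\<lambda>n. of_real (1 - q) * (of_real q * Phi M Y \<eta> * (of_real q * Phi M Y \<eta>) ^ n)) sums
       (of_real (1 - q) * (of_real q * Phi M Y \<eta> * (1 / (1 - of_real q * Phi M Y \<eta>))))"
      using norm_q_Phi_less[OF z] by (intro sums_mult geometric_sums)
    also have "(\<lambda>n. of_real (1 - q) * (of_real q * Phi M Y \<eta> * (of_real q * Phi M Y \<eta>) ^ n)) =
      (\<lambda>n. of_real ((1 - q) * q ^ Suc n) * (of_real (indicator {1..} (Suc n)) * Phi M Y \<eta> ^ Suc n))"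
      by (intro ext) (simp add: power_mult_distrib)
    finally have "(\<lambda>n. of_real ((1 - q) * q ^ n) * (of_real (indicator {1..} n) * Phi M Y \<eta> ^ n)) sums
      (of_real (1 - q) * (of_real q * Phi M Y \<eta> * (1 / (1 - of_real q * Phi M Y \<eta>))) + of_real ((1 - q) * q ^ 0) * (of_real (indicator {1..} (0::nat)) * Phi M Y \<eta> ^ 0))"
      by (rule sums_Suc)
    from sums_unique2[OF 1 this] show ?thesis by simp
  qed
  obtain C where C: "\<And>t. norm (Phi M Y (Complex t \<omega>)) \<le> C * decay \<delta> t"
    using Phi_decay[of \<omega>] \<omega> mu by auto
  define r where "r = q * mgf \<omega>"
  have r: "r < 1" using q_mgf_less[of \<omega>] \<omega> mu by (simp add: r_def)
  have h_bound: "norm (h (Complex t \<omega>)) \<le> C / (1 - r) * decay \<delta> t" for t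
  proof -
    define p where "p = of_real q * Phi M Y (Complex t \<omega>)"
    have p1: "norm p \<le> r" using norm_Phi_le[of "Complex t \<omega>"] q by (simp add: p_def r_def norm_mult mult_left_mono)
    have "norm p \<le> norm (Phi M Y (Complex t \<omega>))" using q by (simp add: p_def norm_mult mult_left_le_one_le)
    then have p2: "norm p \<le> C * decay \<delta> t" using C[of t] by linarith
    have "1 - r \<le> norm (1 - p)" using norm_triangle_ineq2[of 1 p] p1 by simp
    then have "norm p / norm (1 - p) \<le> C * decay \<delta> t / (1 - r)"
      using p2 r order_trans[OF norm_ge_zero p2] by (intro frac_le) auto
    moreover have "norm (h (Complex t \<omega>)) = (1 - q) * (norm p / norm (1 - p))"
      using q unfolding p_def by (subst h_eq) (auto simp: norm_mult norm_divide simp del: of_real_diff)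
    moreover have "(1 - q) * (norm p / norm (1 - p)) \<le> norm p / norm (1 - p)"
      using q by (intro mult_left_le_one_le) auto
    ultimately show ?thesis by simp
  qed
  have meas: "(\<lambda>t. h (Complex t \<omega>)) \<in> borel_measurable borel"
    unfolding h_def by (intro measurable_transform_line sigma_finite_M) measurable
  have int: "integrable lborel (\<lambda>t. h (Complex t \<omega>) / Complex t \<omega>)"
  proof -
    have "integrable lborel (\<lambda>t. (1 + \<omega>) / \<omega> * (C / (1 - r) * (decay \<delta> t * decay 1 (t - 0))))"
      using delta by (intro integrable_mult_right integrable_powr_shift) auto
    then show ?thesis
    proof (rule integrable_norm_le)
      fix t
      have "norm (h (Complex t \<omega>) / (Complex t \<omega> - Complex 0 0)) \<le> (1 + \<bar>\<omega> - 0\<bar>) / \<bar>\<omega> - 0\<bar> * (norm (h (Complex t \<omega>)) * decay 1 (t - 0))"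
        using \<omega> by (intro norm_divide_line_diff_le) auto
      also have "\<dots> \<le> (1 + \<bar>\<omega> - 0\<bar>) / \<bar>\<omega> - 0\<bar> * (C / (1 - r) * decay \<delta> t * decay 1 (t - 0))"
        using h_bound \<omega> by (intro mult_left_mono mult_right_mono) auto
      also have "\<dots> = (1 + \<omega>) / \<omega> * (C / (1 - r) * (decay \<delta> t * decay 1 (t - 0)))"
        using \<omega> by simp
      also have "Complex t \<omega> - Complex 0 0 = Complex t \<omega>" by (simp add: complex_eq_iff)
      finally show "norm (h (Complex t \<omega>) / Complex t \<omega>) \<le> (1 + \<omega>) / \<omega> * (C / (1 - r) * (decay \<delta> t * decay 1 (t - 0)))" .
      show "(\<lambda>t. h (Complex t \<omega>) / Complex t \<omega>) \<in> borel_measurable lborel"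
        using meas by (auto intro!: borel_measurable_divide)
    qed
  qed
  have single_eq: "single_integrand M Y q a1 x1 \<eta> = 1 / of_real (1 - q) * (exp (- \<i> * \<eta> * of_real (a1 - x1)) * (h \<eta> / (- \<i> * \<eta>)))" if "Im \<eta> = \<omega>" for \<eta>
  proof -
    have e: "\<i> * of_real (x1 - a1) * \<eta> = - \<i> * \<eta> * of_real (a1 - x1)" by (simp add: algebra_simps)
    have "complex_of_real (1 - q) \<noteq> 0" using q by (simp del: of_real_diff)
    then show ?thesis unfolding single_integrand_def h_eq[OF that] e by (simp add: mult_ac del: of_real_diff)
  qed
  show "line_integrable \<omega> (single_integrand M Y q a1 x1)"
    unfolding line_integrable_def
  proof (rule Bochner_Integration.integrable_bound[OF integrable_mult_right[OF int, of "of_real (exp (\<omega> * (a1 - x1))) / of_real (1 - q)"]])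
    have "single_integrand M Y q a1 x1 (Complex t \<omega>) = 1 / of_real (1 - q) * (exp (- \<i> * Complex t \<omega> * of_real (a1 - x1)) * (h (Complex t \<omega>) / (- \<i> * Complex t \<omega>)))" for t
      by (rule single_eq) simp
    note eq = this
    show "(\<lambda>t. single_integrand M Y q a1 x1 (Complex t \<omega>)) \<in> borel_measurable lborel"
      unfolding eq using meas by (auto intro!: borel_measurable_divide borel_measurable_times simp del: of_real_diff)
    show "AE t in lborel. norm (single_integrand M Y q a1 x1 (Complex t \<omega>)) \<le> norm (of_real (exp (\<omega> * (a1 - x1))) / of_real (1 - q) * (h (Complex t \<omega>) / Complex t \<omega>))"
      unfolding eq by (intro AE_I2) (simp add: norm_mult norm_divide del: of_real_diff)
  qed
  have "(LINT w|M. of_real (indicator {1..} (T w)) * indicator {..a1 - x1} (walk_T w)) =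
    1 / (2 * of_real pi) * line_integral \<omega> (\<lambda>\<eta>. exp (- \<i> * \<eta> * of_real (a1 - x1)) * ((LINT w|M. of_real (indicator {1..} (T w)) * iexpz \<eta> (walk_T w)) / (- \<i> * \<eta>)))"
  proof (rule line_inversion_lower[OF sigma_finite_M _ _ \<omega>(1)])
    show "integrable M (\<lambda>w. of_real (indicator {1..} (T w)) * iexpz (Complex 0 \<omega>) (walk_T w))"
      using \<omega> mu by (intro integrable_walk_at_T) (auto simp: indicator_def)
    show "AE w in M. walk_T w = a1 - x1 \<longrightarrow> complex_of_real (indicator {1..} (T w)) = 0"
      using AE_walk_T_neq[of "a1 - x1"] by eventually_elim auto
    show "line_integrable \<omega> (\<lambda>\<eta>. (LINT w|M. of_real (indicator {1..} (T w)) * iexpz \<eta> (walk_T w)) / \<eta>)"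
      using int by (simp add: line_integrable_def h_def)
  qed measurable
  also have "line_integral \<omega> (\<lambda>\<eta>. exp (- \<i> * \<eta> * of_real (a1 - x1)) * ((LINT w|M. of_real (indicator {1..} (T w)) * iexpz \<eta> (walk_T w)) / (- \<i> * \<eta>)))
    = of_real (1 - q) * line_integral \<omega> (single_integrand M Y q a1 x1)"
    unfolding line_integral_def integral_mult_right_zero[symmetric] h_def[symmetric]
  proof (intro Bochner_Integration.integral_cong refl)
    fix t
    have "complex_of_real (1 - q) \<noteq> 0" using q by (simp del: of_real_diff)
    then show "exp (- \<i> * Complex t \<omega> * of_real (a1 - x1)) * (h (Complex t \<omega>) / (- \<i> * Complex t \<omega>)) = of_real (1 - q) * single_integrand M Y q a1 x1 (Complex t \<omega>)"
      by (subst single_eq) (auto simp del: of_real_diff)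
  qed
  finally show "(LINT w|M. of_real (indicator {1..} (T w)) * indicator {..a1 - x1} (walk_T w)) =
      of_real (1 - q) * (1 / (2 * of_real pi) * line_integral \<omega> (single_integrand M Y q a1 x1))"
    by (simp only: mult.left_commute)
qed

end

section \<open>Absolute convergence of the double integral\<close>

lemma one_plus_abs_powr_le_1: "0 \<le> p \<Longrightarrow> decay p t \<le> 1" for t :: real
  using powr_mono[of "- p" 0 "1 + \<bar>t\<bar>"] by (simp split: if_splits)

lemma norm_inverse_line_diff_le:
  assumes "u \<noteq> v"
  shows "norm (inverse (Complex t u - Complex s v)) \<le> (1 + \<bar>u - v\<bar>) / \<bar>u - v\<bar> * decay 1 (t - s)"
  using norm_divide_line_diff_le[OF assms, of 1 t s] by (simp add: inverse_eq_divide)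

text \<open>The kernel 1/(\<xi>(\<xi> - \<eta>)) alone is not integrable over both lines together.
  The decay of Q lifts the exponent in t to 1 + p and that of P lifts the one of the s-integral to p
  + 1, so any p > 0 suffices. The s-integral is bounded uniformly in t, which decouples the
  variables.\<close>

lemma
  fixes P Q :: "real \<Rightarrow> complex"
  assumes meas[measurable]: "P \<in> borel_measurable borel" "Q \<in> borel_measurable borel"
    and PQ: "\<And>s. norm (P s) \<le> A * decay p s" "\<And>t. norm (Q t) \<le> B * decay p t"
    and p: "0 < p" and uv: "u < 0" "0 < v"
  shows integrable_double_kernel:
      "integrable (lborel \<Otimes>\<^sub>M lborel) (\<lambda>(t, s). P s * (Q t / (Complex t v * (Complex t v - Complex s u))))"
    and integrable_inner_kernel: "integrable lborel (\<lambda>t. Q t / (Complex t v * (Complex t v - Complex s u)))"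
proof -
  define c where "c = (1 + v) / v"
  define d where "d = (1 + \<bar>v - u\<bar>) / \<bar>v - u\<bar>"
  have A: "A \<ge> 0" using order_trans[OF norm_ge_zero PQ(1)[of 0]] by simp
  have B: "B \<ge> 0" using order_trans[OF norm_ge_zero PQ(2)[of 0]] by simp
  have cd: "c \<ge> 0" "d \<ge> 0" using uv by (auto simp: c_def d_def)
  have inner_le: "norm (Q t / (Complex t v * (Complex t v - Complex s u))) \<le>
      B * c * d * (decay (1 + p) t * decay 1 (t - s))" for s t
  proof -
    have "norm (inverse (Complex t v)) \<le> c * decay 1 t"
      using norm_inverse_line_diff_le[of v 0 t 0] uv by (simp add: c_def zero_complex.code[symmetric])
    moreover have "norm (inverse (Complex t v - Complex s u)) \<le> d * decay 1 (t - s)"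
      unfolding d_def using uv by (intro norm_inverse_line_diff_le) auto
    ultimately have "norm (Q t) * (norm (inverse (Complex t v)) * norm (inverse (Complex t v - Complex s u))) \<le>
       (B * decay p t) * ((c * decay 1 t) * (d * decay 1 (t - s)))"
      using PQ B cd by (intro mult_mono mult_nonneg_nonneg) auto
    also have "\<dots> = B * c * d * ((decay 1 t * decay p t) * decay 1 (t - s))"
      by (simp only: mult_ac)
    also have "decay 1 t * decay p t = decay (1 + p) t"
      by (simp only: powr_add[symmetric] minus_add_distrib)
    finally show ?thesis by (simp only: divide_inverse norm_mult inverse_mult_distrib)
  qed
  have int1: "integrable lborel (\<lambda>t. decay (1 + p) t)"
    using p by (intro integrable_one_plus_abs_powr) simp
  show "integrable lborel (\<lambda>t. Q t / (Complex t v * (Complex t v - Complex s u)))"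
  proof (rule integrable_norm_le[OF integrable_mult_right[OF int1, of "B * c * d"]])
    fix t
    have "decay (1 + p) t * decay 1 (t - s) \<le> decay (1 + p) t * 1"
      by (intro mult_left_mono one_plus_abs_powr_le_1) auto
    then have "B * c * d * (decay (1 + p) t * decay 1 (t - s)) \<le> B * c * d * (decay (1 + p) t * 1)"
      using B cd by (intro mult_left_mono) auto
    then show "norm (Q t / (Complex t v * (Complex t v - Complex s u))) \<le> B * c * d * decay (1 + p) t"
      using inner_le[of t s] by linarith
  qed measurable
  define G where "G t s = A * B * c * d * (decay (1 + p) t * (decay p s * decay 1 (s - t)))" for t s
  have G_nonneg: "0 \<le> G t s" for t s using A B cd by (simp add: G_def)
  have nG: "norm (G t s) = G t s" for t s using G_nonneg by simp
  have G_int: "integrable lborel (G t)" for t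
    unfolding G_def using p by (intro integrable_mult_right integrable_powr_shift) auto
  have [measurable]: "case_prod G \<in> borel_measurable (lborel \<Otimes>\<^sub>M lborel)" unfolding G_def by measurable
  define J where "J = (LINT s|lborel. decay (p + 1) s)"
  have "integrable (lborel \<Otimes>\<^sub>M lborel) (case_prod G)"
  proof (rule lborel_pair.Fubini_integrable)
    show "integrable lborel (\<lambda>t. LINT s|lborel. norm (case (t, s) of (t, s) \<Rightarrow> G t s))"
    proof (rule integrable_norm_le[OF integrable_mult_right[OF int1, of "A * B * c * d * (2 * J)"]])
      fix t
      have "(LINT s|lborel. norm (G t s)) = A * B * c * d * (decay (1 + p) t * (LINT s|lborel. decay p s * decay 1 (s - t)))"
        unfolding nG unfolding G_def integral_mult_right_zero ..
      also have "\<dots> \<le> A * B * c * d * (decay (1 + p) t * (2 * J))"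
        unfolding J_def using A B cd p by (intro mult_left_mono integral_powr_shift_le mult_nonneg_nonneg) auto
      also have "\<dots> = A * B * c * d * (2 * J) * decay (1 + p) t" by (simp only: mult_ac)
      finally show "norm (LINT s|lborel. norm (case (t, s) of (t, s) \<Rightarrow> G t s)) \<le> A * B * c * d * (2 * J) * decay (1 + p) t"
        by simp
    qed measurable
  qed (use G_int in auto)
  then show "integrable (lborel \<Otimes>\<^sub>M lborel) (\<lambda>(t, s). P s * (Q t / (Complex t v * (Complex t v - Complex s u))))"
  proof (rule integrable_norm_le)
    have "norm (P s * (Q t / (Complex t v * (Complex t v - Complex s u)))) \<le>
      (A * decay p s) * (B * c * d * (decay (1 + p) t * decay 1 (t - s)))" for t s
      unfolding norm_mult[of "P s"] using A by (intro mult_mono PQ inner_le) auto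
    also have "(A * decay p s) * (B * c * d * (decay (1 + p) t * decay 1 (t - s))) = G t s" for t s
      by (simp only: G_def mult_ac abs_minus_commute[of t s])
    finally show "norm (case x of (t, s) \<Rightarrow> P s * (Q t / (Complex t v * (Complex t v - Complex s u)))) \<le> case_prod G x" for x
      by (cases x) simp
    show "(\<lambda>(t, s). P s * (Q t / (Complex t v * (Complex t v - Complex s u)))) \<in> borel_measurable (lborel \<Otimes>\<^sub>M lborel)"
      unfolding Complex_eq by measurable
  qed
qed

context geometric_walk begin

lemma phi_pp_decay:
  assumes "\<mu>m < \<alpha>" "\<alpha> < 0" "\<mu>m < v" "v \<le> \<mu>p"
  obtains C where "\<And>s. norm (phi_pp M Y q T \<alpha> (Complex s v)) \<le> C * decay (\<delta> / 4) s"
proof -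
  obtain C where C: "\<And>s. norm (exp (log_plus (Complex s v)) - 1) \<le> C * decay (\<delta> / 4) s"
    using exp_log_plus_decay[OF assms(3,4)] by blast
  show ?thesis
  proof (rule that)
    show "norm (phi_pp M Y q T \<alpha> (Complex s v)) \<le> norm (exp (- log_plus 0)) * C * decay (\<delta> / 4) s" for s
      using assms mult_left_mono[OF C[of s], of "norm (exp (- log_plus 0))"]
      by (simp add: phi_pp_eq norm_mult mult.assoc)
  qed
qed

lemma phi_mm_decay:
  assumes "0 < \<beta>" "\<beta> < \<mu>p" "\<mu>m \<le> v" "v < \<mu>p"
  obtains C where "\<And>s. norm (phi_mm M Y q T \<beta> (Complex s v)) \<le> C * decay (\<delta> / 4) s"
proof -
  obtain C where C: "\<And>s. norm (exp (log_minus (Complex s v)) - 1) \<le> C * decay (\<delta> / 4) s"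
    using exp_log_minus_decay[OF assms(3,4)] by blast
  show ?thesis
  proof (rule that)
    show "norm (phi_mm M Y q T \<beta> (Complex s v)) \<le> norm (exp (- log_minus 0)) * C * decay (\<delta> / 4) s" for s
      using assms mult_left_mono[OF C[of s], of "norm (exp (- log_minus 0))"]
      by (simp add: phi_mm_eq norm_mult mult.assoc)
  qed
qed

lemma walk_min_at_T_measurable[measurable]: "(\<lambda>w. walk_min Y (T w) w) \<in> borel_measurable M"
proof -
  have "walk_min Y n \<in> borel_measurable M" for n unfolding walk_min_def by measurable
  then show ?thesis by (rule measurable_compose_countable[OF _ T_measurable])
qed

lemma borel_measurable_phi_pp_line: "(\<lambda>s. phi_pp M Y q T \<alpha> (Complex s v)) \<in> borel_measurable borel"
  unfolding phi_pp_def phi_plus_def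
  using measurable_transform_line[OF sigma_finite_M, of "\<lambda>_. 1" "\<lambda>w. max_T w" v] by simp

lemma borel_measurable_phi_mm_line: "(\<lambda>s. phi_mm M Y q T \<beta> (Complex s v)) \<in> borel_measurable borel"
  unfolding phi_mm_def phi_minus_def
  using measurable_transform_line[OF sigma_finite_M, of "\<lambda>_. 1" "\<lambda>w. walk_min Y (T w) w" v] by simp

text \<open>By \<open>exp_log_zero\<close> the product of \<open>c_plus\<close> and
  \<open>c_minus\<close> is 1 - q. The product of the two factors is thus exactly the transform of
  maximum and excess with their atoms at 0 removed.\<close>

lemma phi_pp_mult_phi_mm:
  assumes "\<mu>m < \<alpha>" "\<alpha> < 0" "0 < \<beta>" "\<beta> < \<mu>p" "\<mu>m < Im x" "Im z < \<mu>p"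
  shows "phi_pp M Y q T \<alpha> x * phi_mm M Y q T \<beta> z = of_real (1 - q) * (exp (log_plus x) - 1) * (exp (log_minus z) - 1)"
proof -
  have "exp (- log_plus 0) * exp (- log_minus 0) = of_real (1 - q)"
    using exp_log_zero by (simp add: exp_minus field_simps del: of_real_diff)
  then show ?thesis using assms by (simp add: phi_pp_eq phi_mm_eq mult_ac del: of_real_diff)
qed

section \<open>The double integral\<close>

context
  fixes \<alpha> \<beta> \<omega>m \<omega>1 a1 a2 x1 :: real
  assumes alpha: "\<mu>m < \<alpha>" "\<alpha> < 0" and beta: "0 < \<beta>" "\<beta> < \<mu>p"
    and omegas: "\<mu>m < \<omega>m" "\<omega>m < 0" "0 < \<omega>1" "\<omega>1 < \<mu>p"
    and le: "a1 \<le> a2" "x1 \<le> a2"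
begin

text \<open>Here t runs along the inner line at height \<omega>1 and s along the outer one at height
  \<omega>m. Integrating out t gives the outer integrand, integrating out s the transform in the
  walk.\<close>

definition kernel :: "real \<Rightarrow> real \<Rightarrow> complex" where
  "kernel t s = exp (\<i> * of_real (x1 - a2) * Complex s \<omega>m) * phi_pp M Y q T \<alpha> (Complex s \<omega>m) *
     inner_integrand M Y q T \<beta> a1 a2 (Complex s \<omega>m) (Complex t \<omega>1)"

lemma integrable_kernel: "integrable (lborel \<Otimes>\<^sub>M lborel) (\<lambda>(t, s). kernel t s)"
    and integrable_inner: "Im \<eta> = \<omega>m \<Longrightarrow> line_integrable \<omega>1 (inner_integrand M Y q T \<beta> a1 a2 \<eta>)"
proof -
  note [measurable] = borel_measurable_phi_pp_line borel_measurable_phi_mm_line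
  define P where "P s = exp (\<i> * of_real (x1 - a2) * Complex s \<omega>m) * phi_pp M Y q T \<alpha> (Complex s \<omega>m)" for s
  define Q where "Q t = exp (\<i> * Complex t \<omega>1 * of_real (a2 - a1)) * phi_mm M Y q T \<beta> (Complex t \<omega>1)" for t
  have meas: "P \<in> borel_measurable borel" "Q \<in> borel_measurable borel" unfolding P_def Q_def by measurable
  obtain A where A: "\<And>s. norm (phi_pp M Y q T \<alpha> (Complex s \<omega>m)) \<le> A * decay (\<delta> / 4) s"
    using phi_pp_decay[OF alpha, of \<omega>m] omegas mu by auto
  obtain B where B: "\<And>s. norm (phi_mm M Y q T \<beta> (Complex s \<omega>1)) \<le> B * decay (\<delta> / 4) s"
    using phi_mm_decay[OF beta, of \<omega>1] omegas mu by auto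
  have P: "norm (P s) \<le> exp (- ((x1 - a2) * \<omega>m)) * A * decay (\<delta> / 4) s" for s
    using mult_left_mono[OF A[of s], of "exp (- ((x1 - a2) * \<omega>m))"] by (simp add: P_def norm_mult mult.assoc)
  have Q: "norm (Q t) \<le> exp (- (\<omega>1 * (a2 - a1))) * B * decay (\<delta> / 4) t" for t
    using mult_left_mono[OF B[of t], of "exp (- (\<omega>1 * (a2 - a1)))"] by (simp add: Q_def norm_mult mult.assoc)
  have p: "0 < \<delta> / 4" using delta by simp
  show "integrable (lborel \<Otimes>\<^sub>M lborel) (\<lambda>(t, s). kernel t s)"
    using integrable_double_kernel[OF meas P Q p omegas(2,3)]
    by (simp add: kernel_def P_def Q_def inner_integrand_def)
  show "line_integrable \<omega>1 (inner_integrand M Y q T \<beta> a1 a2 \<eta>)" if "Im \<eta> = \<omega>m"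
  proof -
    have "Complex (Re \<eta>) \<omega>m = \<eta>" using that by (simp add: complex_eq_iff)
    then show ?thesis using integrable_inner_kernel[OF meas P Q p omegas(2,3), of "Re \<eta>"]
      by (simp add: line_integrable_def Q_def inner_integrand_def)
  qed
qed

lemma outer_integrand_eq: "outer_integrand M Y q T \<alpha> \<beta> a1 a2 x1 \<omega>1 (Complex s \<omega>m) = (LINT t|lborel. kernel t s)"
  by (simp add: outer_integrand_def kernel_def line_integral_def)

lemma integrable_outer: "line_integrable \<omega>m (outer_integrand M Y q T \<alpha> \<beta> a1 a2 x1 \<omega>1)"
  unfolding line_integrable_def outer_integrand_eq
  by (rule lborel_pair.integrable_snd) (use integrable_kernel in simp)

text \<open>The transform \<open>H\<close> required by the inversion in the walk is itself an
  inversion integral in the maximum, with its argument \<xi> in the role of the pole; \<xi> lies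
  above the line of that integral because \<omega>m < 0 < \<omega>1.\<close>

lemma integral_outer:
  "(LINT w|M. indicator {a2 - x1<..} (max_T w) * indicator {..<0} (excess_T w) * indicator {..a1 - x1} (walk_T w)) =
    - (1 / (2 * of_real pi)\<^sup>2) * line_integral \<omega>m (outer_integrand M Y q T \<alpha> \<beta> a1 a2 x1 \<omega>1)"
proof -
  define b1 b2 where "b1 = a1 - x1" and "b2 = a2 - x1"
  have b2: "0 \<le> b2" using le by (simp add: b2_def)
  define W where "W w = (indicator {b2<..} (max_T w) * indicator {..<0} (excess_T w) :: complex)" for w
  define H where "H \<xi> = (LINT w|M. W w * iexpz \<xi> (walk_T w))" for \<xi>
  have W_meas[measurable]: "W \<in> borel_measurable M" unfolding W_def by measurable
  text \<open>Inverting in the maximum first, at a fixed transform argument \<open>\<xi>\<close> of the walk itself.\<close>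
  have H_eq: "H \<xi> = exp (\<i> * \<xi> * of_real b2) * (1 / (2 * of_real pi * \<i>) *
      (LINT s|lborel. exp (- \<i> * Complex s \<omega>m * of_real b2) * (phi_pp M Y q T \<alpha> (Complex s \<omega>m) * phi_mm M Y q T \<beta> \<xi> / (Complex s \<omega>m - \<xi>))))"
    if \<xi>: "Im \<xi> = \<omega>1" for \<xi>
  proof -
    \<comment> \<open>The walk is maximum plus excess. \<open>V\<close> carries the exponential of
      the excess, and the half-line inversion supplies exp(i\<xi>(M - b2)), so that exp(i\<xi>X)
      results up to the factor exp(-i\<xi> b2).\<close>
    define V where "V w = indicator {0<..} (max_T w) * indicator {..<0} (excess_T w) *
        iexpz \<xi> (excess_T w)" for w
    have V: "(LINT w|M. V w * iexpz \<eta> (max_T w)) = phi_pp M Y q T \<alpha> \<eta> * phi_mm M Y q T \<beta> \<xi>"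
      if "Im \<eta> = \<omega>m" for \<eta>
      unfolding V_def using that \<xi> omegas alpha beta
      by (subst integral_joint_pos_neg) (auto simp: phi_pp_mult_phi_mm)
    have "(LINT w|M. V w * (indicator {b2<..} (max_T w) *\<^sub>R iexpz \<xi> (max_T w - b2))) =
      1 / (2 * of_real pi * \<i>) * line_integral \<omega>m (\<lambda>\<eta>. exp (- \<i> * \<eta> * of_real b2) * ((LINT w|M. V w * iexpz \<eta> (max_T w)) / (\<eta> - \<xi>)))"
    proof (rule line_inversion[OF sigma_finite_M])
      show "integrable M (\<lambda>w. V w * exp (\<i> * Complex 0 \<omega>m * of_real (max_T w)))"
        unfolding V_def using \<xi> omegas by (intro integrable_joint_pos_neg) auto
      show "\<omega>m < Im \<xi>" using \<xi> omegas by simp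
      show "AE w in M. max_T w = b2 \<longrightarrow> V w = 0"
        using AE_walk_max_T_neq[of b2] by eventually_elim (auto simp: V_def)
      obtain A where A: "\<And>s. norm (phi_pp M Y q T \<alpha> (Complex s \<omega>m)) \<le> A * decay (\<delta> / 4) s"
        using phi_pp_decay[OF alpha, of \<omega>m] omegas mu by auto
      define d where "d = (1 + \<bar>\<omega>m - \<omega>1\<bar>) / \<bar>\<omega>m - \<omega>1\<bar>"
      have "integrable lborel (\<lambda>s. d * (norm (phi_mm M Y q T \<beta> \<xi>) * A * (decay (\<delta> / 4) s * decay 1 (s - Re \<xi>))))"
        using delta by (intro integrable_mult_right integrable_powr_shift) auto
      then have "integrable lborel (\<lambda>s. phi_pp M Y q T \<alpha> (Complex s \<omega>m) * phi_mm M Y q T \<beta> \<xi> / (Complex s \<omega>m - \<xi>))"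
      proof (rule integrable_norm_le)
        fix s
        have "norm (phi_pp M Y q T \<alpha> (Complex s \<omega>m) * phi_mm M Y q T \<beta> \<xi> / (Complex s \<omega>m - Complex (Re \<xi>) \<omega>1)) \<le>
           d * (norm (phi_pp M Y q T \<alpha> (Complex s \<omega>m) * phi_mm M Y q T \<beta> \<xi>) * decay 1 (s - Re \<xi>))"
          unfolding d_def using omegas by (intro norm_divide_line_diff_le) auto
        also have "\<dots> \<le> d * (((A * decay (\<delta> / 4) s) * norm (phi_mm M Y q T \<beta> \<xi>)) * decay 1 (s - Re \<xi>))"
          unfolding norm_mult by (intro mult_left_mono mult_right_mono A) (auto simp: d_def)
        also have "\<dots> = d * (norm (phi_mm M Y q T \<beta> \<xi>) * A * (decay (\<delta> / 4) s * decay 1 (s - Re \<xi>)))"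
          by (simp only: mult_ac)
        also have "Complex (Re \<xi>) \<omega>1 = \<xi>" using \<xi> by (simp add: complex_eq_iff)
        finally show "norm (phi_pp M Y q T \<alpha> (Complex s \<omega>m) * phi_mm M Y q T \<beta> \<xi> / (Complex s \<omega>m - \<xi>)) \<le>
          d * (norm (phi_mm M Y q T \<beta> \<xi>) * A * (decay (\<delta> / 4) s * decay 1 (s - Re \<xi>)))" .
        note [measurable] = borel_measurable_phi_pp_line
        show "(\<lambda>s. phi_pp M Y q T \<alpha> (Complex s \<omega>m) * phi_mm M Y q T \<beta> \<xi> / (Complex s \<omega>m - \<xi>)) \<in> borel_measurable lborel"
          by measurable
      qed
      then show "line_integrable \<omega>m (\<lambda>\<eta>. (LINT w|M. V w * iexpz \<eta> (max_T w)) / (\<eta> - \<xi>))"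
        unfolding line_integrable_def by (subst V) simp_all
    qed measurable
    also have "(\<lambda>w. V w * (indicator {b2<..} (max_T w) *\<^sub>R iexpz \<xi> (max_T w - b2))) =
        (\<lambda>w. exp (- \<i> * \<xi> * of_real b2) * (W w * iexpz \<xi> (walk_T w)))"
    proof
      fix w
      have "iexpz \<xi> (excess_T w) * iexpz \<xi> (max_T w - b2) =
         exp (- \<i> * \<xi> * of_real b2) * iexpz \<xi> (walk_T w)"
        by (simp add: exp_add[symmetric] algebra_simps)
      \<comment> \<open>As b2 >= 0, the condition M > 0 contained in \<open>V\<close> follows from M
        > b2; the removed atom of the maximum lies outside the event.\<close>
      moreover have "indicator {0<..} x * indicator {b2<..} x = (indicator {b2<..} x :: complex)" for x :: real
        using b2 by (auto simp: indicator_def)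
      ultimately show "V w * (indicator {b2<..} (max_T w) *\<^sub>R iexpz \<xi> (max_T w - b2)) =
        exp (- \<i> * \<xi> * of_real b2) * (W w * iexpz \<xi> (walk_T w))"
        by (auto simp: V_def W_def indicator_def)
    qed
    finally have "exp (- \<i> * \<xi> * of_real b2) * H \<xi> = 1 / (2 * of_real pi * \<i>) *
      line_integral \<omega>m (\<lambda>\<eta>. exp (- \<i> * \<eta> * of_real b2) * ((LINT w|M. V w * iexpz \<eta> (max_T w)) / (\<eta> - \<xi>)))"
      unfolding H_def by simp
    also have "line_integral \<omega>m (\<lambda>\<eta>. exp (- \<i> * \<eta> * of_real b2) * ((LINT w|M. V w * iexpz \<eta> (max_T w)) / (\<eta> - \<xi>))) =
      (LINT s|lborel. exp (- \<i> * Complex s \<omega>m * of_real b2) * (phi_pp M Y q T \<alpha> (Complex s \<omega>m) * phi_mm M Y q T \<beta> \<xi> / (Complex s \<omega>m - \<xi>)))"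
      unfolding line_integral_def by (subst V) simp_all
    finally have "exp (\<i> * \<xi> * of_real b2) * (exp (- \<i> * \<xi> * of_real b2) * H \<xi>) = exp (\<i> * \<xi> * of_real b2) * (1 / (2 * of_real pi * \<i>) *
      (LINT s|lborel. exp (- \<i> * Complex s \<omega>m * of_real b2) * (phi_pp M Y q T \<alpha> (Complex s \<omega>m) * phi_mm M Y q T \<beta> \<xi> / (Complex s \<omega>m - \<xi>))))"
      by (rule arg_cong)
    moreover have "exp (\<i> * \<xi> * of_real b2) * (exp (- \<i> * \<xi> * of_real b2) * H \<xi>) = H \<xi>"
      by (simp add: mult.assoc[symmetric] exp_minus_inverse)
    ultimately show ?thesis by simp
  qed
  \<comment> \<open>The sign: 1/(2 pi i) times 1/(-i) is 1/(2 pi), and turning \<eta> - \<xi> into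
    the \<xi> - \<eta> of \<open>inner_integrand\<close> contributes a minus.\<close>
  have kernel_eq: "exp (- \<i> * Complex t \<omega>1 * of_real b1) * (H (Complex t \<omega>1) / (- \<i> * Complex t \<omega>1)) =
      - (1 / (2 * of_real pi)) * (LINT s|lborel. kernel t s)" for t
  proof -
    define \<xi> where "\<xi> = Complex t \<omega>1"
    have "kernel t s = - (iexpz \<xi> (b2 - b1) / \<xi>) *
       (exp (- \<i> * Complex s \<omega>m * of_real b2) * (phi_pp M Y q T \<alpha> (Complex s \<omega>m) * phi_mm M Y q T \<beta> \<xi> / (Complex s \<omega>m - \<xi>)))" for s
    proof -
      have "\<i> * of_real (x1 - a2) * Complex s \<omega>m = - \<i> * Complex s \<omega>m * of_real b2"
        by (simp add: b2_def algebra_simps)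
      moreover have "b2 - b1 = a2 - a1" by (simp add: b1_def b2_def)
      moreover have "inverse (\<xi> - Complex s \<omega>m) = - inverse (Complex s \<omega>m - \<xi>)"
        by (simp add: inverse_minus_eq[symmetric])
      ultimately show ?thesis
        by (simp add: kernel_def inner_integrand_def \<xi>_def[symmetric] divide_inverse)
    qed
    then have "(LINT s|lborel. kernel t s) = - (iexpz \<xi> (b2 - b1) / \<xi>) *
      (LINT s|lborel. exp (- \<i> * Complex s \<omega>m * of_real b2) * (phi_pp M Y q T \<alpha> (Complex s \<omega>m) * phi_mm M Y q T \<beta> \<xi> / (Complex s \<omega>m - \<xi>)))"
      by (simp only: integral_mult_right_zero)
    moreover have "exp (- \<i> * \<xi> * of_real b1) * exp (\<i> * \<xi> * of_real b2) = iexpz \<xi> (b2 - b1)"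
      by (simp add: exp_add[symmetric] algebra_simps)
    moreover have "x * (y * (1 / (2 * p * \<i>) * I) / (- \<i> * \<xi>)) = - (1 / (2 * p)) * (- (x * y / \<xi>) * I)" for x y p I
      by (simp add: divide_simps)
    ultimately show ?thesis
      unfolding \<xi>_def[symmetric] by (subst H_eq) (simp_all add: \<xi>_def)
  qed
  \<comment> \<open>The decay of \<open>H\<close> is not visible in its definition. Up to a factor
    of constant modulus on the line, H/\<xi> is the s-integral of \<open>kernel\<close>, hence
    integrable by Fubini.\<close>
  have int: "integrable lborel (\<lambda>t. H (Complex t \<omega>1) / Complex t \<omega>1)"
  proof (rule Bochner_Integration.integrable_bound)
    show "integrable lborel (\<lambda>t. of_real (exp (- (\<omega>1 * b1)) / (2 * pi)) * (LINT s|lborel. kernel t s))"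
      by (intro integrable_mult_right lborel_pair.integrable_fst) (use integrable_kernel in simp)
    have "norm (H (Complex t \<omega>1) / Complex t \<omega>1) = norm (of_real (exp (- (\<omega>1 * b1)) / (2 * pi)) * (LINT s|lborel. kernel t s))" for t
    proof -
      have "exp (\<omega>1 * b1) * norm (H (Complex t \<omega>1) / Complex t \<omega>1) = norm (exp (- \<i> * Complex t \<omega>1 * of_real b1) * (H (Complex t \<omega>1) / (- \<i> * Complex t \<omega>1)))"
        by (simp add: norm_mult norm_divide)
      also have "\<dots> = 1 / (2 * pi) * norm (LINT s|lborel. kernel t s)"
        unfolding kernel_eq by (simp add: norm_mult norm_divide)
      finally have e: "1 / (2 * pi) * norm (LINT s|lborel. kernel t s) = exp (\<omega>1 * b1) * norm (H (Complex t \<omega>1) / Complex t \<omega>1)"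
        by (rule sym)
      have "norm (of_real (exp (- (\<omega>1 * b1)) / (2 * pi)) * (LINT s|lborel. kernel t s)) =
          exp (- (\<omega>1 * b1)) * (1 / (2 * pi) * norm (LINT s|lborel. kernel t s))"
        by (simp add: norm_mult norm_divide)
      also have "\<dots> = norm (H (Complex t \<omega>1) / Complex t \<omega>1)"
        unfolding e by (simp add: mult.assoc[symmetric] exp_minus_inverse mult.commute[of "exp (- (\<omega>1 * b1))"])
      finally show ?thesis by (rule sym)
    qed
    then show "AE t in lborel. norm (H (Complex t \<omega>1) / Complex t \<omega>1) \<le> norm (of_real (exp (- (\<omega>1 * b1)) / (2 * pi)) * (LINT s|lborel. kernel t s))"
      by (intro AE_I2) simp
    have "(\<lambda>t. H (Complex t \<omega>1)) \<in> borel_measurable borel"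
      unfolding H_def by (intro measurable_transform_line sigma_finite_M) measurable
    then show "(\<lambda>t. H (Complex t \<omega>1) / Complex t \<omega>1) \<in> borel_measurable lborel"
      by (auto intro!: borel_measurable_divide)
  qed
  have "(LINT w|M. W w * indicator {..b1} (walk_T w)) =
     1 / (2 * of_real pi) * line_integral \<omega>1 (\<lambda>\<xi>. exp (- \<i> * \<xi> * of_real b1) * (H \<xi> / (- \<i> * \<xi>)))"
    unfolding H_def
  proof (rule line_inversion_lower[OF sigma_finite_M _ _ omegas(3)])
    have W_eq: "W w = of_real (indicator {b2<..} (max_T w) * indicator {..<0} (excess_T w))" for w
      by (simp add: W_def indicator_def)
    show "integrable M (\<lambda>w. W w * exp (\<i> * Complex 0 \<omega>1 * of_real (walk_T w)))"
      unfolding W_eq using omegas mu by (intro integrable_walk_at_T) (auto simp: indicator_def)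
    show "AE w in M. walk_T w = b1 \<longrightarrow> W w = 0"
      using AE_walk_T_neq[of b1] by eventually_elim (auto simp: W_def)
    show "line_integrable \<omega>1 (\<lambda>\<eta>. (LINT w|M. W w * iexpz \<eta> (walk_T w)) / \<eta>)"
      using int by (simp add: line_integrable_def H_def)
  qed measurable
  also have "line_integral \<omega>1 (\<lambda>\<xi>. exp (- \<i> * \<xi> * of_real b1) * (H \<xi> / (- \<i> * \<xi>))) = - (1 / (2 * of_real pi)) * (LINT t|lborel. LINT s|lborel. kernel t s)"
    unfolding line_integral_def kernel_eq integral_mult_right_zero ..
  also have "(LINT t|lborel. LINT s|lborel. kernel t s) = (LINT s|lborel. LINT t|lborel. kernel t s)"
    using lborel_pair.Fubini_integral[of kernel] integrable_kernel by simp
  also have "\<dots> = line_integral \<omega>m (outer_integrand M Y q T \<alpha> \<beta> a1 a2 x1 \<omega>1)"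
    unfolding line_integral_def outer_integrand_eq ..
  finally show ?thesis
    by (simp add: W_def b1_def b2_def power2_eq_square)
qed

end

end

section \<open>The value function at the geometric time\<close>

context geometric_walk begin

text \<open>The law of T contributes 1 - q. For T = 0 the maximum is 0 <= a2 - x1, so only x1 <= a1
  is tested. In the subtracted term the indicator of a negative excess can be inserted, since a walk
  ending at or below a1 - x1 <= a2 - x1 lies strictly below a maximum above a2 - x1.\<close>

lemma V_gen_payoff_eq:
  assumes ax: "a1 \<le> a2" "x1 \<le> x2" "x2 \<le> a2"
  shows "of_real (1 - q) * complex_of_real (V_gen M Y (payoff a1 a2) q x1 x2) =
     of_real (1 - q) * indicator {..a1} x1 +
     (LINT w|M. of_real (indicator {1..} (T w)) * indicator {..a1 - x1} (walk_T w)) -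
     (LINT w|M. indicator {a2 - x1<..} (max_T w) * indicator {..<0} (excess_T w) * indicator {..a1 - x1} (walk_T w))"
proof -
  define c :: "nat \<Rightarrow> 'a \<Rightarrow> real"
    where "c n w = indicator {..a1 - x1} (walk Y n w) * indicator {..a2 - x1} (walk_max Y n w)" for n w
  \<comment> \<open>The walk never exceeds its running maximum, so \<open>min a1 x2\<close> in the
    payoff acts as a1; and x2 <= a2 reduces the bound on the updated maximum to one on the maximum
    of the walk.\<close>
  have payoff_eq: "payoff a1 a2 (x1 + walk Y n w) (max x2 (x1 + walk_max Y n w)) = c n w" for n w
    using ax excess_nonpos[of n w] by (auto simp: payoff_def c_def indicator_def)
  have V_eq: "V M Y (payoff a1 a2) n x1 x2 = (LINT w|M. c n w)" for n
    by (simp add: V_def payoff_eq)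
  have c_meas: "c n \<in> borel_measurable walk_algebra" for n unfolding c_def by measurable
  have c_le: "\<bar>c n w\<bar> \<le> 1" for n w by (simp add: c_def indicator_def)
  have "(\<lambda>n. of_real ((1 - q) * q ^ n) * (LINT w|M. of_real (c n w) * iexpz 0 (walk Y n w))) sums
      (LINT w|M. of_real (c (T w) w) * iexpz 0 (walk_T w))"
    using mu c_meas c_le by (intro sums_walk_at_T) auto
  then have "(\<lambda>n. complex_of_real ((1 - q) * q ^ n * (LINT w|M. c n w))) sums complex_of_real (LINT w|M. c (T w) w)"
    by simp
  then have "(\<lambda>n. (1 - q) * q ^ n * (LINT w|M. c n w)) sums (LINT w|M. c (T w) w)"
    by (simp only: sums_of_real_iff)
  from sums_mult[OF this, of "1 / (1 - q)"]
  have "(\<lambda>n. q ^ n * V M Y (payoff a1 a2) n x1 x2) sums ((LINT w|M. c (T w) w) / (1 - q))"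
    using q by (simp add: V_eq mult.assoc)
  then have "V_gen M Y (payoff a1 a2) q x1 x2 = (LINT w|M. c (T w) w) / (1 - q)"
    unfolding V_gen_def by (rule sums_unique[symmetric])
  then have "(1 - q) * V_gen M Y (payoff a1 a2) q x1 x2 = (LINT w|M. c (T w) w)"
    using q by simp
  then have 1: "of_real (1 - q) * complex_of_real (V_gen M Y (payoff a1 a2) q x1 x2) = (LINT w|M. of_real (c (T w) w))"
    by (simp only: of_real_mult[symmetric] integral_complex_of_real)
  have [measurable]: "(\<lambda>w. complex_of_real (indicator {1..} (T w))) \<in> borel_measurable M"
    "(\<lambda>w. indicator {0} (T w) :: complex) \<in> borel_measurable M" by (rule measurable_T)+
  have bounded: "integrable M f" if "f \<in> borel_measurable M" "\<And>w. norm (f w) \<le> 1" for f :: "'a \<Rightarrow> complex"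
    by (rule integrable_const_bound[of _ 1]) (use that in auto)
  have split: "complex_of_real (c (T w) w) = indicator {..a1} x1 * indicator {0} (T w) +
      of_real (indicator {1..} (T w)) * indicator {..a1 - x1} (walk_T w) -
      indicator {a2 - x1<..} (max_T w) * indicator {..<0} (excess_T w) * indicator {..a1 - x1} (walk_T w)" for w
  proof (cases "T w = 0")
    case True
    then show ?thesis using ax by (simp add: c_def indicator_def)
  next
    case False
    then show ?thesis using ax by (auto simp: c_def indicator_def)
  qed
  have T0: "(LINT w|M. indicator {0} (T w)) = complex_of_real (1 - q)"
  proof -
    have "(LINT w|M. indicator {0} (T w)) = (LINT w|M. complex_of_real (indicator {w \<in> space M. T w = 0} w))"
      by (intro Bochner_Integration.integral_cong refl) (auto simp: indicator_def)
    also have "\<dots> = complex_of_real (1 - q)" using prob_T[of 0] by simp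
    finally show ?thesis .
  qed
  have i: "integrable M (\<lambda>w. indicator {..a1} x1 * indicator {0} (T w) :: complex)"
    "integrable M (\<lambda>w. complex_of_real (indicator {1..} (T w)) * indicator {..a1 - x1} (walk_T w))"
    "integrable M (\<lambda>w. indicator {a2 - x1<..} (max_T w) * indicator {..<0} (excess_T w) * indicator {..a1 - x1} (walk_T w) :: complex)"
    by (rule bounded, measurable, simp add: indicator_def)+
  have "(LINT w|M. complex_of_real (c (T w) w)) = (LINT w|M. indicator {..a1} x1 * indicator {0} (T w)) +
     (LINT w|M. of_real (indicator {1..} (T w)) * indicator {..a1 - x1} (walk_T w)) -
     (LINT w|M. indicator {a2 - x1<..} (max_T w) * indicator {..<0} (excess_T w) * indicator {..a1 - x1} (walk_T w))"
    unfolding split using i by (simp only: Bochner_Integration.integral_diff Bochner_Integration.integral_add Bochner_Integration.integrable_add)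
  also have "(LINT w|M. indicator {..a1} x1 * indicator {0} (T w)) = complex_of_real (1 - q) * indicator {..a1} x1"
    unfolding integral_mult_right_zero T0 by (rule mult.commute)
  finally show ?thesis using 1 by simp
qed

end

text \<open>Outside a ball of radius R >= 1 the O-bound applies, and 1 + |t| <= 2|\<xi>| produces
  the constant 2^e; lowering the exponent weakens the bound there because |\<xi>| >= 1. Inside the
  ball the moment at \<gamma> bounds \<Phi>, and (1 + R)^e compensates for the weight.\<close>

lemma Phi_bigo_imp_line_decay:
  assumes M: "prob_space M" and \<delta>: "0 < \<delta>"
    and bigo: "Phi M Y \<in> O[inf at_infinity (principal {\<xi>. Im \<xi> \<in> {\<mu>m..\<mu>p}})](\<lambda>\<xi>. complex_of_real (norm \<xi> powr (- \<delta>)))"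
    and \<gamma>: "\<mu>m \<le> \<gamma>" "\<gamma> \<le> \<mu>p"
  shows "\<exists>C. \<forall>t. norm (Phi M Y (Complex t \<gamma>)) \<le> C * (1 + \<bar>t\<bar>) powr (- min \<delta> 1)"
proof -
  define e where "e = min \<delta> 1"
  have e: "0 < e" "e \<le> \<delta>" using \<delta> by (auto simp: e_def)
  obtain c where c: "c > 0" and "\<forall>\<^sub>F \<xi> in inf at_infinity (principal {\<xi>. Im \<xi> \<in> {\<mu>m..\<mu>p}}).
     norm (Phi M Y \<xi>) \<le> c * norm (complex_of_real (norm \<xi> powr (- \<delta>)))"
    using landau_o.bigE[OF bigo] by blast
  then obtain b where b: "\<And>\<xi>. b \<le> norm \<xi> \<Longrightarrow> Im \<xi> \<in> {\<mu>m..\<mu>p} \<Longrightarrow> norm (Phi M Y \<xi>) \<le> c * norm \<xi> powr (- \<delta>)"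
    unfolding eventually_inf_principal eventually_at_infinity by auto
  define R where "R = max b 1"
  define m where "m = (LINT w|M. exp (- \<gamma> * Y 0 w))"
  have m: "norm (Phi M Y (Complex t \<gamma>)) \<le> m" for t
    unfolding Phi_def m_def by (rule order_trans[OF integral_norm_bound]) simp
  have m0: "0 \<le> m" unfolding m_def by simp
  have R: "1 \<le> R" by (simp add: R_def)
  have "norm (Phi M Y (Complex t \<gamma>)) \<le> (c * 2 powr e + m * (1 + R) powr e) * decay e t" for t
  proof (cases "R \<le> norm (Complex t \<gamma>)")
    case True
    define n where "n = norm (Complex t \<gamma>)"
    have n: "1 \<le> n" "\<bar>t\<bar> \<le> n" using True R abs_Re_le_cmod[of "Complex t \<gamma>"] by (auto simp: n_def)
    have "norm (Phi M Y (Complex t \<gamma>)) \<le> c * n powr (- \<delta>)"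
      unfolding n_def using True \<gamma> by (intro b) (auto simp: R_def)
    also have "\<dots> \<le> c * n powr (- e)" using c n e by (intro mult_left_mono powr_mono) auto
    also have "\<dots> \<le> c * ((1 + \<bar>t\<bar>) / 2) powr (- e)"
      using c n e by (intro mult_left_mono powr_mono2') auto
    also have "\<dots> = c * 2 powr e * decay e t"
      by (simp add: powr_divide powr_minus divide_simps)
    also have "\<dots> \<le> (c * 2 powr e + m * (1 + R) powr e) * decay e t"
      using m0 by (intro mult_right_mono) auto
    finally show ?thesis .
  next
    case False
    then have "\<bar>t\<bar> \<le> R" using abs_Re_le_cmod[of "Complex t \<gamma>"] by simp
    then have "(1 + R) powr (- e) \<le> decay e t" using e by (intro powr_mono2') auto
    then have "m * (1 + R) powr e * (1 + R) powr (- e) \<le> m * (1 + R) powr e * decay e t"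
      using m0 by (intro mult_left_mono) auto
    moreover have "m * (1 + R) powr e * (1 + R) powr (- e) = m"
      using R by (simp add: powr_minus)
    ultimately have "norm (Phi M Y (Complex t \<gamma>)) \<le> m * (1 + R) powr e * decay e t"
      using m[of t] by linarith
    also have "\<dots> \<le> (c * 2 powr e + m * (1 + R) powr e) * decay e t"
      using c by (intro mult_right_mono) auto
    finally show ?thesis .
  qed
  then show ?thesis unfolding e_def by blast
qed

theorem theorem3p8:
  fixes M :: "'a measure" and Y :: "nat \<Rightarrow> 'a \<Rightarrow> real" and T :: "'a \<Rightarrow> nat"
    and q a1 a2 x1 x2 \<mu>m \<mu>p \<alpha> \<beta> \<omega>m \<omega>1 \<omega> :: real
  assumes "prob_space M"
    and indep: "prob_space.indep_vars M (\<lambda>_. borel) Y UNIV"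
    and ident: "\<And>n. distr M borel (Y n) = distr M borel (Y 0)"
    and q: "0 < q" "q < 1"
    and T: "indep_geometric_time M Y q T"
    and ax: "a1 \<le> a2" "x1 \<le> x2" "x2 \<le> a2"
    and mu: "\<mu>m < 0" "0 < \<mu>p"
    and i_mgf: "\<And>\<gamma>. \<gamma> \<in> {\<mu>m..\<mu>p} \<Longrightarrow> integrable M (\<lambda>w. exp (- \<gamma> * Y 0 w))"
    and i_pos: "\<And>\<gamma>. \<gamma> \<in> {\<mu>m..\<mu>p} \<Longrightarrow> Re (1 - of_real q * Phi M Y (\<i> * of_real \<gamma>)) > 0"
    and ii: "\<exists>\<delta>>0. Phi M Y \<in> O[inf at_infinity (principal {\<xi>. Im \<xi> \<in> {\<mu>m..\<mu>p}})](\<lambda>\<xi>. complex_of_real (norm \<xi> powr (- \<delta>)))"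
    and alpha: "\<mu>m < \<alpha>" "\<alpha> < 0"
    and beta: "0 < \<beta>" "\<beta> < \<mu>p"
    and omegas: "\<mu>m < \<omega>m" "\<omega>m < 0" "0 < \<omega>1" "\<omega>1 < \<mu>p"
    and omega: "0 < \<omega>" "\<omega> < \<mu>p"
  shows "line_integrable \<omega> (single_integrand M Y q a1 x1) \<and>
         (\<forall>\<eta>. Im \<eta> = \<omega>m \<longrightarrow> line_integrable \<omega>1 (inner_integrand M Y q T \<beta> a1 a2 \<eta>)) \<and>
         line_integrable \<omega>m (outer_integrand M Y q T \<alpha> \<beta> a1 a2 x1 \<omega>1) \<and>
         complex_of_real (V_gen M Y (payoff a1 a2) q x1 x2) =
           indicator {..a1} x1
           + 1 / (2 * of_real pi) * line_integral \<omega> (single_integrand M Y q a1 x1)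
           + 1 / ((2 * of_real pi)\<^sup>2 * (1 - of_real q)) *
             line_integral \<omega>m (outer_integrand M Y q T \<alpha> \<beta> a1 a2 x1 \<omega>1)"
proof -
  obtain \<delta> where \<delta>: "0 < \<delta>"
    and bigo: "Phi M Y \<in> O[inf at_infinity (principal {\<xi>. Im \<xi> \<in> {\<mu>m..\<mu>p}})](\<lambda>\<xi>. complex_of_real (norm \<xi> powr (- \<delta>)))"
    using ii by blast
  have mgf_less: "q * (LINT w|M. exp (- \<gamma> * Y 0 w)) < 1" if "\<mu>m \<le> \<gamma>" "\<gamma> \<le> \<mu>p" for \<gamma>
    using i_pos[of \<gamma>] that by (simp add: Phi_imaginary)
  interpret prob_space M by fact
  interpret geometric_walk M Y T q \<mu>m \<mu>p "min \<delta> 1"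
  proof unfold_locales
    show "indep_vars (\<lambda>_. borel) Y UNIV" by (fact indep)
    show "distr M borel (Y n) = distr M borel (Y 0)" for n by (fact ident)
    show "indep_geometric_time M Y q T" by (fact T)
    show "0 < min \<delta> 1" "min \<delta> 1 \<le> 1" using \<delta> by auto
    show "\<exists>C. \<forall>t. norm (Phi M Y (Complex t \<gamma>)) \<le> C * (1 + \<bar>t\<bar>) powr (- min \<delta> 1)"
      if "\<mu>m \<le> \<gamma>" "\<gamma> \<le> \<mu>p" for \<gamma>
      by (rule Phi_bigo_imp_line_decay[OF \<open>prob_space M\<close> \<delta> bigo that])
  qed (use q mu i_mgf mgf_less in auto)
  have x1: "x1 \<le> a2" using ax by linarith
  note outer = alpha beta omegas ax(1) x1
  have q0: "complex_of_real (1 - q) \<noteq> 0" using q by (simp del: of_real_diff)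
  define S where "S = line_integral \<omega> (single_integrand M Y q a1 x1)"
  define D where "D = line_integral \<omega>m (outer_integrand M Y q T \<alpha> \<beta> a1 a2 x1 \<omega>1)"
  \<comment> \<open>The subtracted probability is itself minus a double integral, which therefore
    enters with a plus. It is the only term without a factor 1 - q, so dividing by 1 - q leaves the
    quotient on it alone.\<close>
  have "of_real (1 - q) * complex_of_real (V_gen M Y (payoff a1 a2) q x1 x2) =
     of_real (1 - q) * indicator {..a1} x1 + of_real (1 - q) * (1 / (2 * of_real pi) * S) - - (1 / (2 * of_real pi)\<^sup>2) * D"
    unfolding S_def D_def V_gen_payoff_eq[OF ax] integral_single[OF omega] integral_outer[OF outer] ..
  also have "\<dots> = of_real (1 - q) * (indicator {..a1} x1 + 1 / (2 * of_real pi) * S + 1 / ((2 * of_real pi)\<^sup>2 * of_real (1 - q)) * D)"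
    using q0 by (simp add: distrib_left del: of_real_diff)
  finally have "complex_of_real (V_gen M Y (payoff a1 a2) q x1 x2) =
     indicator {..a1} x1 + 1 / (2 * of_real pi) * S + 1 / ((2 * of_real pi)\<^sup>2 * of_real (1 - q)) * D"
    using q0 by (simp only: mult_cancel_left simp_thms)
  then have "complex_of_real (V_gen M Y (payoff a1 a2) q x1 x2) =
     indicator {..a1} x1 + 1 / (2 * of_real pi) * S + 1 / ((2 * of_real pi)\<^sup>2 * (1 - of_real q)) * D"
    by simp
  then show ?thesis
    unfolding S_def D_def
    using line_integrable_single[OF omega] integrable_inner[OF outer] integrable_outer[OF outer] by blast
qed

end
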